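(* Let $\lambda_0,\lambda_1>0$, $\gamma_0>0>\gamma_1$ and $t>0$. Let $\Gamma$ be the associated telegraph process, $m_t=\min_{u\in[0,t]}\Gamma(u)$, $M_t=\max_{u\in[0,t]}\Gamma(u)$, and let $\zeta^m_t$, $\zeta^M_t\in[0,t]$ be the times at which $\Gamma$ reaches $m_t$ and $M_t$ on $[0,t]$. Let the measures $F_i(\mathrm ds;y;n)$ and $G^{\pm}(\mathrm dx;t;n)$ be the explicit ones given in the context. Then the following hold. (i) For all $n\ge0$, $$\mathrm P_0\{\zeta^m_t=0,\ m_t=0,\ \Gamma(t)\in \mathrm dx,\ N(t)=n\}=G^+(\mathrm dx;t;n),\quad x>0,$$ $$\mathrm P_1\{\zeta^M_t=0,\ M_t=0,\ \Gamma(t)\in \mathrm dx,\ N(t)=n\}=G^-(\mathrm dx;t;n),\quad x<0.$$ (ii) On $x<0$: $\mathrm P_0\{\zeta^m_t=t,\ m_t=\Gamma(t)\in \mathrm dx,\ N(t)=n\}$ equals $0$ if $n$ is even and $\frac{1}{-\gamma_1}f_0(t,x;n)\,\mathrm dx$ if $n$ is odd; $\mathrm P_1\{\zeta^m_t=t,\ m_t=\Gamma(t)\in \mathrm dx,\ N(t)=n\}$ equals $0$ if $n$ is odd, $\frac1{-\gamma_1}f_1(t,x;n)\,\mathrm dx$ if $n\ge2$ is even, and $e^{-\lambda_1t}\delta_{\gamma_1t}(\mathrm dx)$ if $n=0$. On $x>0$: $\mathrm P_0\{\zeta^M_t=t,\ M_t=\Gamma(t)\in \mathrm dx,\ N(t)=n\}$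 equals $0$ if $n$ is odd, $\frac1{\gamma_0}f_0(t,x;n)\,\mathrm dx$ if $n\ge2$ is even, and $e^{-\lambda_0t}\delta_{\gamma_0t}(\mathrm dx)$ if $n=0$; $\mathrm P_1\{\zeta^M_t=t,\ M_t=\Gamma(t)\in \mathrm dx,\ N(t)=n\}$ equals $0$ if $n$ is even and $\frac1{\gamma_0}f_1(t,x;n)\,\mathrm dx$ if $n$ is odd. (iii) On $0<s<t$, $y<\min(0,x)$: $$\mathrm P_0\{\zeta^m_t\in \mathrm ds,\ m_t\in \mathrm dy,\ \Gamma(t)\in \mathrm dx,\ N(t)=n\}=\lambda_1\sum_{1\le k\le\lfloor n/2\rfloor}F_0(\mathrm ds;y;2k-1)\,G^+(\mathrm dx-y;t-s;n-2k)\,\mathrm dy,\quad n\ge2,$$ $$\mathrm P_1\{\zeta^m_t\in \mathrm ds,\ m_t\in \mathrm dy,\ \Gamma(t)\in \mathrm dx,\ N(t)=n\}=\lambda_1\sum_{0\le k\le\lfloor (n-1)/2\rfloor}F_1(\mathrm ds;y;2k)\,G^+(\mathrm dx-y;t-s;n-2k-1)\,\mathrm dy,\quad n\ge1;$$ and on $0<s<t$, $y>\max(0,x)$: $$\mathrm P_0\{\zeta^M_t\in \mathrm ds,\ M_t\in \mathrm dy,\ \Gamma(t)\in \mathrm dx,\ N(t)=n\}=\lambda_0\sum_{0\le k\le\lfloor (n-1)/2\rfloor}F_0(\mathrm ds;y;2k)\,G^-(\mathrm dx-y;t-s;n-2k-1)\,\mathrm dy,\quad n\ge1,$$ $$\mathrm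 P_1\{\zeta^M_t\in \mathrm ds,\ M_t\in \mathrm dy,\ \Gamma(t)\in \mathrm dx,\ N(t)=n\}=\lambda_0\sum_{1\le k\le\lfloor n/2\rfloor}F_1(\mathrm ds;y;2k-1)\,G^-(\mathrm dx-y;t-s;n-2k)\,\mathrm dy,\quad n\ge2.$$
   Context: $\varepsilon=\varepsilon(t)\in\{0,1\}$, $t\ge0$, is a two-state continuous-time Markov process which leaves state $i$ at rate $\lambda_i$ and switches to state $1-i$. $\mathrm P_i\{\cdot\}=\mathrm P\{\cdot\mid\varepsilon(0)=i\}$. $N(t)$ is the number of switchings of $\varepsilon$ up to time $t$, $N(0)=0$. The telegraph process is $\Gamma(t)=\int_0^t\gamma_{\varepsilon(s)}\,\mathrm ds$. Notation: $$\xi_0(t,x)=\frac{x-\gamma_1t}{\gamma_0-\gamma_1},\qquad \xi_1(t,x)=\frac{\gamma_0t-x}{\gamma_0-\gamma_1},\qquad z(t,x)=\lambda_0\lambda_1\xi_0(t,x)\xi_1(t,x),\qquad \theta(t,x)=\frac{\exp(-\lambda_0\xi_0(t,x)-\lambda_1\xi_1(t,x))}{\gamma_0-\gamma_1}.$$ The measures $F_i(\mathrm ds;y;n)$ on $s>0$ (these are the joint laws of the first passage time of level $y$ and of the number of switchings up to it): for $n\ge1$, $F_i(\mathrm ds;y;n)=f_i(s,y;n)\,\mathrm ds$, with, for $n\ge0$, for $y>0$: $f_0(s,y;2n+1)=0$, $f_1(s,y;2n+2)=0$, $f_1(s,y;2n+1)=\frac{\lambda_1}{\xi_0(s,y)}\frac{z(s,y)^n}{n!^2}\theta(s,y)\big(y-\frac{\gamma_1}{n+1}\xi_1(s,y)\big)\mathbf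 1_{\{s>y/\gamma_0\}}$, $f_0(s,y;2n+2)=\lambda_0\lambda_1y\frac{z(s,y)^n}{n!(n+1)!}\theta(s,y)\mathbf 1_{\{s>y/\gamma_0\}}$; for $y<0$: $f_1(s,y;2n+1)=0$, $f_0(s,y;2n+2)=0$, $f_0(s,y;2n+1)=\frac{\lambda_0}{\xi_1(s,y)}\frac{z(s,y)^n}{n!^2}\theta(s,y)\big(-y+\frac{\gamma_0}{n+1}\xi_0(s,y)\big)\mathbf 1_{\{s>y/\gamma_1\}}$, $f_1(s,y;2n+2)=-\lambda_0\lambda_1y\frac{z(s,y)^n}{n!(n+1)!}\theta(s,y)\mathbf 1_{\{s>y/\gamma_1\}}$. For $n=0$: $F_0(\mathrm ds;y;0)=e^{-\lambda_0s}\delta_{y/\gamma_0}(\mathrm ds)$ if $y>0$, and $F_1(\mathrm ds;y;0)=e^{-\lambda_1s}\delta_{y/\gamma_1}(\mathrm ds)$ if $y<0$. The measures $G^\pm$: $G^+(\mathrm dx;t;0)=e^{-\lambda_0t}\delta_{\gamma_0t}(\mathrm dx)$, $G^-(\mathrm dx;t;0)=e^{-\lambda_1t}\delta_{\gamma_1t}(\mathrm dx)$, and for $n\ge1$, $G^\pm(\mathrm dx;t;n)=g^\pm(t,x;n)\,\mathrm dx$ with, for $n\ge0$, $g^+(t,x;2n+1)=\frac{\lambda_0}{\gamma_0\xi_0(t,x)}\frac{z(t,x)^n}{n!^2}\theta(t,x)\big(x-\frac{\gamma_1}{n+1}\xi_1(t,x)\big)\mathbf 1_{\{0<x<\gamma_0t\}}$,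 $g^+(t,x;2n+2)=\lambda_0\lambda_1\frac{x}{\gamma_0}\frac{z(t,x)^n}{n!(n+1)!}\theta(t,x)\mathbf 1_{\{0<x<\gamma_0t\}}$, $g^-(t,x;2n+1)=\frac{\lambda_1}{\gamma_1\xi_1(t,x)}\frac{z(t,x)^n}{n!^2}\theta(t,x)\big(x-\frac{\gamma_0}{n+1}\xi_0(t,x)\big)\mathbf 1_{\{\gamma_1t<x<0\}}$, $g^-(t,x;2n+2)=\lambda_0\lambda_1\frac{x}{\gamma_1}\frac{z(t,x)^n}{n!(n+1)!}\theta(t,x)\mathbf 1_{\{\gamma_1t<x<0\}}$. $G^\pm(\mathrm dx-y;t;n)$ denotes the image of $G^\pm(\cdot;t;n)$ under the translation $x\mapsto x+y$. $\delta_a$ is the Dirac measure at $a$. A product such as $F(\mathrm ds;y)\,G(\mathrm dx-y;t-s)\,\mathrm dy$ is the measure on triples $(s,y,x)$ obtained by integrating first in $x$, then in $s$, then in $y$.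
   Formalization: In (iii) the prefactors λ₁ (minimum) and λ₀ (maximum) are replaced by λ₁/(−γ₁) and λ₀/γ₀; as printed the formulas are off by the factor |γ₁| resp. γ₀ (e.g. total mass for P₁, minimum, n=1), hence false unless γ₁=−1 resp. γ₀=1. *)

theory Defs
  imports "HOL-Probability.Probability"
begin

section \<open>The two-state Markov process and the telegraph process\<close>

definition past :: "'w measure \<Rightarrow> (real \<Rightarrow> 'w \<Rightarrow> nat) \<Rightarrow> real \<Rightarrow> 'w set set" where
  "past M eps s = sigma_sets (space M) {{\<omega> \<in> space M. eps r \<omega> = j} | r j. 0 \<le> r \<and> r \<le> s}"

text \<open>
  A time-homogeneous Markov process with states 0 and 1, transition function p and transition
  rates lam i (from i to 1 - i), with cadlag paths.  For a path in a discrete state space, cadlag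
  means locally constant to the right, and with a left limit in the discrete sense; only
  finitely many switchings then occur on bounded time intervals.
\<close>

locale two_state_markov = prob_space M
  for M :: "'w measure" +
  fixes eps :: "real \<Rightarrow> 'w \<Rightarrow> nat" and lam :: "nat \<Rightarrow> real"
  assumes measurable_eps: "\<And>u. 0 \<le> u \<Longrightarrow> eps u \<in> measurable M (count_space UNIV)"
    and states: "\<And>u \<omega>. 0 \<le> u \<Longrightarrow> \<omega> \<in> space M \<Longrightarrow> eps u \<omega> \<in> {0, 1}"
    and right_continuous:
      "\<And>u \<omega>. 0 \<le> u \<Longrightarrow> \<omega> \<in> space M \<Longrightarrow> (\<forall>\<^sub>F r in at_right u. eps r \<omega> = eps u \<omega>)"
    and left_limits:
      "\<And>u \<omega>. 0 < u \<Longrightarrow> \<omega> \<in> space M \<Longrightarrow> (\<exists>j. \<forall>\<^sub>F r in at_left u. eps r \<omega> = j)"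
    and markov:
      "\<exists>p :: real \<Rightarrow> nat \<Rightarrow> nat \<Rightarrow> real.
        (\<forall>h\<ge>0. \<forall>i\<in>{0, 1}. (\<forall>j\<in>{0, 1}. 0 \<le> p h i j) \<and> p h i 0 + p h i 1 = 1) \<and>
        (\<forall>s\<ge>0. \<forall>h\<ge>0. \<forall>A\<in>past M eps s. \<forall>i\<in>{0, 1}. \<forall>j\<in>{0, 1}.
           prob (A \<inter> {\<omega> \<in> space M. eps s \<omega> = i \<and> eps (s + h) \<omega> = j}) =
           prob (A \<inter> {\<omega> \<in> space M. eps s \<omega> = i}) * p h i j) \<and>
        (\<forall>i\<in>{0, 1}. ((\<lambda>h. p h i (1 - i) / h) \<longlongrightarrow> lam i) (at_right 0))"

definition starts_at :: "'w measure \<Rightarrow> (real \<Rightarrow> 'w \<Rightarrow> nat) \<Rightarrow> nat \<Rightarrow> 'w set" where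
  "starts_at M eps i = {\<omega> \<in> space M. eps 0 \<omega> = i}"

text \<open>The conditional probability P( . | eps(0) = i); meaningful if eps(0) = i has positive probability.\<close>

definition cond_start :: "'w measure \<Rightarrow> (real \<Rightarrow> 'w \<Rightarrow> nat) \<Rightarrow> nat \<Rightarrow> 'w measure" where
  "cond_start M eps i = uniform_measure M (starts_at M eps i)"

definition num_switch :: "(real \<Rightarrow> 'w \<Rightarrow> nat) \<Rightarrow> real \<Rightarrow> 'w \<Rightarrow> nat" where
  "num_switch eps t \<omega> = card {u. 0 < u \<and> u \<le> t \<and> \<not> (\<forall>\<^sub>F r in at_left u. eps r \<omega> = eps u \<omega>)}"

definition telegraph :: "(nat \<Rightarrow> real) \<Rightarrow> (real \<Rightarrow> 'w \<Rightarrow> nat) \<Rightarrow> real \<Rightarrow> 'w \<Rightarrow> real" where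
  "telegraph gam eps u \<omega> = integral {0..u} (\<lambda>s. gam (eps s \<omega>))"

text \<open>
  The telegraph process has Lipschitz paths, so the infimum and supremum over [0, t] are attained.
  The extremum is attained only once almost surely on each of the events considered; on the
  exceptional paths the time of the extremum is taken to be the first one.
\<close>

definition run_min :: "(real \<Rightarrow> 'w \<Rightarrow> real) \<Rightarrow> real \<Rightarrow> 'w \<Rightarrow> real" where
  "run_min X t \<omega> = (INF u\<in>{0..t}. X u \<omega>)"

definition run_max :: "(real \<Rightarrow> 'w \<Rightarrow> real) \<Rightarrow> real \<Rightarrow> 'w \<Rightarrow> real" where
  "run_max X t \<omega> = (SUP u\<in>{0..t}. X u \<omega>)"

definition time_min :: "(real \<Rightarrow> 'w \<Rightarrow> real) \<Rightarrow> real \<Rightarrow> 'w \<Rightarrow> real" where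
  "time_min X t \<omega> = Inf {u \<in> {0..t}. X u \<omega> = run_min X t \<omega>}"

definition time_max :: "(real \<Rightarrow> 'w \<Rightarrow> real) \<Rightarrow> real \<Rightarrow> 'w \<Rightarrow> real" where
  "time_max X t \<omega> = Inf {u \<in> {0..t}. X u \<omega> = run_max X t \<omega>}"

section \<open>The explicit measures\<close>

definition xi :: "(nat \<Rightarrow> real) \<Rightarrow> nat \<Rightarrow> real \<Rightarrow> real \<Rightarrow> real" where
  "xi gam i t x =
    (if i = 0 then (x - gam 1 * t) / (gam 0 - gam 1) else (gam 0 * t - x) / (gam 0 - gam 1))"

definition zz :: "(nat \<Rightarrow> real) \<Rightarrow> (nat \<Rightarrow> real) \<Rightarrow> real \<Rightarrow> real \<Rightarrow> real" where
  "zz lam gam t x = lam 0 * lam 1 * xi gam 0 t x * xi gam 1 t x"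

definition theta :: "(nat \<Rightarrow> real) \<Rightarrow> (nat \<Rightarrow> real) \<Rightarrow> real \<Rightarrow> real \<Rightarrow> real" where
  "theta lam gam t x = exp (- lam 0 * xi gam 0 t x - lam 1 * xi gam 1 t x) / (gam 0 - gam 1)"

text \<open>
  The densities f and g are given by separate formulas for the indices m = 2n + 1 and m = 2n + 2,
  n = 0, 1, ...; so n = m div 2 if m is odd and n = m div 2 - 1 if m is even.  Their values at
  m = 0 (and that of f at y = 0) are irrelevant and not used.
\<close>

definition f_dens :: "(nat \<Rightarrow> real) \<Rightarrow> (nat \<Rightarrow> real) \<Rightarrow> nat \<Rightarrow> real \<Rightarrow> real \<Rightarrow> nat \<Rightarrow> real" where
  "f_dens lam gam i s y m =
    (if y > 0 \<and> s > y / gam 0 then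
       (if odd m \<and> i = 1 then
          (let n = m div 2 in
             lam 1 / xi gam 0 s y * (zz lam gam s y ^ n / (fact n)\<^sup>2) * theta lam gam s y
             * (y - gam 1 / (n + 1) * xi gam 1 s y))
        else if even m \<and> i = 0 then
          (let n = m div 2 - 1 in
             lam 0 * lam 1 * y * (zz lam gam s y ^ n / (fact n * fact (n + 1))) * theta lam gam s y)
        else 0)
     else if y < 0 \<and> s > y / gam 1 then
       (if odd m \<and> i = 0 then
          (let n = m div 2 in
             lam 0 / xi gam 1 s y * (zz lam gam s y ^ n / (fact n)\<^sup>2) * theta lam gam s y
             * (- y + gam 0 / (n + 1) * xi gam 0 s y))
        else if even m \<and> i = 1 then
          (let n = m div 2 - 1 in
             - lam 0 * lam 1 * y * (zz lam gam s y ^ n / (fact n * fact (n + 1))) * theta lam gam s y)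
        else 0)
     else 0)"

definition F_meas :: "(nat \<Rightarrow> real) \<Rightarrow> (nat \<Rightarrow> real) \<Rightarrow> nat \<Rightarrow> real \<Rightarrow> nat \<Rightarrow> real measure" where
  "F_meas lam gam i y m =
    (if m = 0 then
       (if i = 0 \<and> y > 0 \<or> i = 1 \<and> y < 0
        then density (return borel (y / gam i)) (\<lambda>s. ennreal (exp (- lam i * s)))
        else null_measure borel)
     else density lborel (\<lambda>s. ennreal (f_dens lam gam i s y m)))"

definition g_plus :: "(nat \<Rightarrow> real) \<Rightarrow> (nat \<Rightarrow> real) \<Rightarrow> real \<Rightarrow> real \<Rightarrow> nat \<Rightarrow> real" where
  "g_plus lam gam t x m =
    (if 0 < x \<and> x < gam 0 * t then
       (if odd m then
          (let n = m div 2 in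
             lam 0 / (gam 0 * xi gam 0 t x) * (zz lam gam t x ^ n / (fact n)\<^sup>2) * theta lam gam t x
             * (x - gam 1 / (n + 1) * xi gam 1 t x))
        else
          (let n = m div 2 - 1 in
             lam 0 * lam 1 * (x / gam 0) * (zz lam gam t x ^ n / (fact n * fact (n + 1)))
             * theta lam gam t x))
     else 0)"

definition g_minus :: "(nat \<Rightarrow> real) \<Rightarrow> (nat \<Rightarrow> real) \<Rightarrow> real \<Rightarrow> real \<Rightarrow> nat \<Rightarrow> real" where
  "g_minus lam gam t x m =
    (if gam 1 * t < x \<and> x < 0 then
       (if odd m then
          (let n = m div 2 in
             lam 1 / (gam 1 * xi gam 1 t x) * (zz lam gam t x ^ n / (fact n)\<^sup>2) * theta lam gam t x
             * (x - gam 0 / (n + 1) * xi gam 0 t x))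
        else
          (let n = m div 2 - 1 in
             lam 0 * lam 1 * (x / gam 1) * (zz lam gam t x ^ n / (fact n * fact (n + 1)))
             * theta lam gam t x))
     else 0)"

definition point_mass :: "real \<Rightarrow> real \<Rightarrow> real measure" where
  "point_mass c a = scale_measure (ennreal c) (return borel a)"

definition G_plus :: "(nat \<Rightarrow> real) \<Rightarrow> (nat \<Rightarrow> real) \<Rightarrow> real \<Rightarrow> nat \<Rightarrow> real measure" where
  "G_plus lam gam t m =
    (if m = 0 then point_mass (exp (- lam 0 * t)) (gam 0 * t)
     else density lborel (\<lambda>x. ennreal (g_plus lam gam t x m)))"

definition G_minus :: "(nat \<Rightarrow> real) \<Rightarrow> (nat \<Rightarrow> real) \<Rightarrow> real \<Rightarrow> nat \<Rightarrow> real measure" where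
  "G_minus lam gam t m =
    (if m = 0 then point_mass (exp (- lam 1 * t)) (gam 1 * t)
     else density lborel (\<lambda>x. ennreal (g_minus lam gam t x m)))"

text \<open>
  The value on B of the measure F(ds; y) G(dx - y; t - s) dy on triples (s, y, x).

  F( . ; y) is a law in the time variable at a fixed level y.  To describe a joint law of an
  extremum, of its time and of the final position, it has to be turned into a law in the level
  variable: a path that runs in state i along its running extremum crosses the level interval dy
  during a time interval of length dy / \<bar>gam i\<bar>.  Hence this measure enters the joint laws with
  the rate lam i multiplied by 1 / \<bar>gam i\<bar>, that is, lam 1 / (- gam 1) for the minimum and
  lam 0 / gam 0 for the maximum.
\<close>

definition split_meas ::
  "real \<Rightarrow> (real \<Rightarrow> real measure) \<Rightarrow> (real \<Rightarrow> real measure) \<Rightarrow> (real \<times> real \<times> real) set \<Rightarrow> ennreal" where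
  "split_meas t F G B =
    (\<integral>\<^sup>+ y. (\<integral>\<^sup>+ s. (\<integral>\<^sup>+ x. indicator B (s, y, x) \<partial>distr (G (t - s)) borel (\<lambda>x. x + y)) \<partial>F y) \<partial>lborel)"

end

theory Submission
  imports Defs
begin

text \<open>
  The Markov property at fixed times determines the law of the switching times: the probability of no
  switching and of exactly one switching in an interval follow from dyadic approximation, and the sets
  "first switching before c, next one after c, prescribed behaviour after c" form a generating
  intersection-stable class.  Under this law holding times are independent exponential variables.

  The densities are of ballot type.  In terms of the occupation times A, D of the two states, peeling off the
  last segment of a path that stays above its starting point integrates the density in A or in D
  alternately, and polynomials satisfy this recursion.  Reversing time turns such paths into those which
  end at their strict minimum.  Peeling off the first segment then shows by induction that a path with
  its minimum strictly inside the time interval splits at that point into a path of the second kind, a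
  switching, and a path of the first kind.
\<close>

section \<open>Alternating exponential holding times\<close>

text \<open>The Markov property is assumed at deterministic times only, whereas a path has to be
  restarted at a random switching. Hence the deterministic \<open>c\<close> in
  \<open>first_window s c D\<close>, placed between the first two switchings: a restart at
  \<open>c\<close> loses nothing, because the time already spent in the new state is forgotten
  (\<open>jump_law_shift\<close>). Any path with a switching admits such a \<open>c\<close> from one
  countable set, which is why these sets generate all events needed. The laws in question mix atoms,
  densities and measures on triples. All of them are values of one functional,
  \<open>W n a b p q r f\<close>, which integrates \<open>f\<close> over the triple (first time of
  the minimum, minimum, end) on the event of n switchings; maxima follow by reflection. The divisors
  \<open>- gam 1\<close> and \<open>gam 0\<close> come from two descriptions of the same paths:
  \<open>ending\<close> has a density in the position at a fixed time, F has one in time at a fixed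
  level, and a path moving with speed V converts ds into dy = V ds.\<close>

definition holding :: "(nat \<Rightarrow> real) measure" where
  "holding = (\<Pi>\<^sub>M i\<in>UNIV. density lborel (exponential_density 1))"

lemma sets_holding [measurable_cong]: "sets holding = sets (\<Pi>\<^sub>M i\<in>UNIV. borel)"
  unfolding holding_def by (intro sets_PiM_cong) auto

lemma space_holding [simp]: "space holding = UNIV"
  by (simp add: holding_def space_PiM)

lemma prob_space_holding: "prob_space holding"
  unfolding holding_def by (intro prob_space_PiM prob_space_exponential_density) simp

lemma sigma_finite_holding: "sigma_finite_measure holding"
  by (rule prob_space_imp_sigma_finite[OF prob_space_holding])

definition tail :: "(nat \<Rightarrow> 'a) \<Rightarrow> nat \<Rightarrow> 'a" where
  "tail h i = h (Suc i)"

lemma measurable_tail [measurable (raw)]: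
  assumes "h \<in> N \<rightarrow>\<^sub>M (\<Pi>\<^sub>M i\<in>UNIV. M)"
  shows "(\<lambda>x. tail (h x)) \<in> N \<rightarrow>\<^sub>M (\<Pi>\<^sub>M i\<in>UNIV. M)"
  using assms measurable_space[OF assms]
  by (intro measurable_PiM_single') (auto simp: space_PiM tail_def PiE_iff)

lemma tail_case_nat [simp]: "tail (case_nat x h) = h"
  by (simp add: tail_def fun_eq_iff)

text \<open>Regeneration at the first switching: the product measure splits into coordinate 0 and
  the rest, and a unit exponential variable divided by \<open>a\<close> has rate \<open>a\<close>.
  With all coordinates of rate 1, one measure serves both orders of the rates.\<close>

lemma nn_integral_holding:
  assumes a: "a > 0" and F [measurable]: "case_prod F \<in> borel_measurable (borel \<Otimes>\<^sub>M holding)"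
  shows "(\<integral>\<^sup>+h. F (h 0 / a) (tail h) \<partial>holding) =
    (\<integral>\<^sup>+u\<in>{0..}. ennreal (a * exp (- a * u)) * (\<integral>\<^sup>+h. F u h \<partial>holding) \<partial>lborel)"
proof -
  let ?E = "density lborel (exponential_density 1)"
  interpret E: prob_space ?E by (rule prob_space_exponential_density) simp
  interpret H: sequence_space ?E ..
  interpret S: sigma_finite_measure holding by (rule sigma_finite_holding)
  have S: "H.S = holding" by (simp add: holding_def)
  have [measurable]: "(\<lambda>h. F (h 0 / a) (tail h)) \<in> borel_measurable holding" by measurable
  have "(\<integral>\<^sup>+h. F (h 0 / a) (tail h) \<partial>holding) =
      (\<integral>\<^sup>+h. F (h 0 / a) (tail h) \<partial>distr (?E \<Otimes>\<^sub>M holding) holding (\<lambda>(s, \<omega>). case_nat s \<omega>))"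
    using H.PiM_iter by (simp add: S)
  also have "\<dots> = (\<integral>\<^sup>+z. F (fst z / a) (snd z) \<partial>(?E \<Otimes>\<^sub>M holding))"
    by (subst nn_integral_distr) (auto simp: split_beta' cong: nn_integral_cong)
  also have "\<dots> = (\<integral>\<^sup>+x. (\<integral>\<^sup>+h. F (x / a) h \<partial>holding) \<partial>?E)"
    by (subst S.nn_integral_fst[symmetric]) auto
  also have "\<dots> = (\<integral>\<^sup>+x. ennreal (exponential_density 1 x) * (\<integral>\<^sup>+h. F (x / a) h \<partial>holding) \<partial>lborel)"
    by (subst nn_integral_density) auto
  also have "\<dots> = ennreal a * (\<integral>\<^sup>+u. ennreal (exponential_density 1 (a * u)) * (\<integral>\<^sup>+h. F u h \<partial>holding) \<partial>lborel)"
    using a by (subst nn_integral_real_affine[where c = a and t = 0]) auto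
  also have "\<dots> = (\<integral>\<^sup>+u\<in>{0..}. ennreal (a * exp (- a * u)) * (\<integral>\<^sup>+h. F u h \<partial>holding) \<partial>lborel)"
    using a by (subst nn_integral_cmult[symmetric])
      (auto intro!: nn_integral_cong simp: exponential_density_def indicator_def ennreal_mult' mult_less_0_iff mult_ac)
  finally show ?thesis .
qed

text \<open>
  Switchings occur at alternating rates a, b, while the path moves with alternating velocities p, q;
  the holding times are the exponential variables h 0, h 1, ... of rate 1 divided by a, b, a, ...  Then
  exactly n a b r h says that n switchings occur during a time r, and hold_triple n a b p q r h is the
  triple (first time of the minimum, minimum, final position); comb prepends a segment to a path.
\<close>

primrec exactly :: "nat \<Rightarrow> real \<Rightarrow> real \<Rightarrow> real \<Rightarrow> (nat \<Rightarrow> real) \<Rightarrow> bool" where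
  "exactly 0 a b r h = (r < h 0 / a)"
| "exactly (Suc n) a b r h = (h 0 / a \<le> r \<and> exactly n b a (r - h 0 / a) (tail h))"

definition comb :: "real \<Rightarrow> real \<Rightarrow> real \<times> real \<times> real \<Rightarrow> real \<times> real \<times> real" where
  "comb p u = (\<lambda>(s, y, x). if p * u + y < 0 then (u + s, p * u + y, p * u + x) else (0, 0, p * u + x))"

primrec hold_triple :: "nat \<Rightarrow> real \<Rightarrow> real \<Rightarrow> real \<Rightarrow> real \<Rightarrow> real \<Rightarrow> (nat \<Rightarrow> real) \<Rightarrow> real \<times> real \<times> real" where
  "hold_triple 0 a b p q r h = comb p r (0, 0, 0)"
| "hold_triple (Suc n) a b p q r h = comb p (h 0 / a) (hold_triple n b a q p (r - h 0 / a) (tail h))"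

lemma measurable_exactly [measurable (raw)]:
  assumes [measurable]: "r \<in> borel_measurable N" "h \<in> N \<rightarrow>\<^sub>M (\<Pi>\<^sub>M i\<in>(UNIV::nat set). borel)"
  shows "Measurable.pred N (\<lambda>x. exactly n a b (r x) (h x))"
  using assms by (induction n arbitrary: a b r h) (auto intro!: pred_intros_logic)

lemma measurable_comb [measurable (raw)]:
  assumes [measurable]: "u \<in> borel_measurable N" "z \<in> borel_measurable N"
  shows "(\<lambda>x. comb p (u x) (z x)) \<in> borel_measurable N"
proof -
  have [measurable]: "z \<in> N \<rightarrow>\<^sub>M borel \<Otimes>\<^sub>M borel \<Otimes>\<^sub>M borel"
    by (simp add: borel_prod)
  show ?thesis
    unfolding comb_def split_beta' borel_prod[symmetric] by measurable
qed

lemma measurable_hold_triple [measurable (raw)]: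
  assumes "r \<in> borel_measurable N" "h \<in> N \<rightarrow>\<^sub>M (\<Pi>\<^sub>M i\<in>(UNIV::nat set). borel)"
  shows "(\<lambda>x. hold_triple n a b p q (r x) (h x)) \<in> borel_measurable N"
  using assms
proof (induction n arbitrary: a b p q r h)
  case 0
  note [measurable] = 0
  show ?case by simp
next
  case (Suc n)
  note [measurable] = Suc.prems
  have [measurable]: "(\<lambda>x. hold_triple n b a q p (r x - h x 0 / a) (tail (h x))) \<in> borel_measurable N"
    by (rule Suc.IH; measurable)
  show ?case by simp
qed

section \<open>The law of the triple on the event of n switchings\<close>

definition W :: "nat \<Rightarrow> real \<Rightarrow> real \<Rightarrow> real \<Rightarrow> real \<Rightarrow> real \<Rightarrow> (real \<times> real \<times> real \<Rightarrow> ennreal) \<Rightarrow> ennreal" where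
  "W n a b p q r f = (\<integral>\<^sup>+h. (if exactly n a b r h then f (hold_triple n a b p q r h) else 0) \<partial>holding)"

lemma measurable_W [measurable (raw)]:
  assumes [measurable]: "r \<in> borel_measurable N" "case_prod f \<in> borel_measurable (N \<Otimes>\<^sub>M borel)"
  shows "(\<lambda>x. W n a b p q (r x) (f x)) \<in> borel_measurable N"
proof -
  interpret S: sigma_finite_measure holding by (rule sigma_finite_holding)
  show ?thesis unfolding W_def by measurable
qed

lemma emeasure_exponential_tail:
  assumes "a > 0" "r \<ge> 0"
  shows "(\<integral>\<^sup>+h. indicator {r<..} (h 0 / a) \<partial>holding) = ennreal (exp (- a * r))"
proof -
  interpret S: prob_space holding by (rule prob_space_holding)
  have "(\<integral>\<^sup>+h. indicator {r<..} (h 0 / a) \<partial>holding) =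
      (\<integral>\<^sup>+u\<in>{0..}. ennreal (a * exp (- a * u)) * (\<integral>\<^sup>+h. indicator {r<..} u \<partial>holding) \<partial>lborel)"
    using assms by (intro nn_integral_holding) (auto simp: split_beta')
  also have "\<dots> = (\<integral>\<^sup>+u. ennreal (a * exp (- a * u)) * indicator {r..} u \<partial>lborel)"
    using assms AE_lborel_singleton[of r] 
    by (intro nn_integral_cong_AE) (auto simp: indicator_def S.emeasure_space_1[simplified])
  also have "\<dots> = ennreal (0 - (- exp (- a * r)))"
  proof (rule nn_integral_FTC_atLeast)
    show "((\<lambda>u. - exp (- a * u)) \<longlongrightarrow> 0) at_top"
      using assms by real_asymp
  qed (use assms in \<open>auto intro!: derivative_eq_intros\<close>)
  finally show ?thesis by simp
qed

lemma W_0: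
  assumes "a > 0" "r \<ge> 0"
  shows "W 0 a b p q r f = ennreal (exp (- a * r)) * f (comb p r (0, 0, 0))"
proof -
  have "W 0 a b p q r f = (\<integral>\<^sup>+h. f (comb p r (0, 0, 0)) * indicator {r<..} (h 0 / a) \<partial>holding)"
    unfolding W_def by (intro nn_integral_cong) (auto simp: indicator_def)
  also have "\<dots> = f (comb p r (0, 0, 0)) * (\<integral>\<^sup>+h. indicator {r<..} (h 0 / a) \<partial>holding)"
    by (rule nn_integral_cmult) measurable
  finally show ?thesis
    by (simp add: emeasure_exponential_tail[OF assms] mult.commute)
qed

lemma W_Suc:
  assumes a: "a > 0" and [measurable]: "f \<in> borel_measurable borel"
  shows "W (Suc n) a b p q r f =
    (\<integral>\<^sup>+u\<in>{0..r}. ennreal (a * exp (- a * u)) * W n b a q p (r - u) (\<lambda>z. f (comb p u z)) \<partial>lborel)"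
proof -
  define F where "F u h = (if u \<le> r \<and> exactly n b a (r - u) h
      then f (comb p u (hold_triple n b a q p (r - u) h)) else 0)" for u h
  have "W (Suc n) a b p q r f = (\<integral>\<^sup>+h. F (h 0 / a) (tail h) \<partial>holding)"
    unfolding W_def F_def by (intro nn_integral_cong) auto
  also have "\<dots> = (\<integral>\<^sup>+u\<in>{0..}. ennreal (a * exp (- a * u)) * (\<integral>\<^sup>+h. F u h \<partial>holding) \<partial>lborel)"
    by (rule nn_integral_holding[OF a]) (unfold F_def split_beta', measurable)
  also have "\<dots> = (\<integral>\<^sup>+u\<in>{0..r}. ennreal (a * exp (- a * u)) * W n b a q p (r - u) (\<lambda>z. f (comb p u z)) \<partial>lborel)"
    by (intro nn_integral_cong) (auto simp: indicator_def F_def W_def)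
  finally show ?thesis .
qed

text \<open>The implication from \<open>y = 0\<close> to \<open>s = 0\<close> is what makes
  \<open>comb\<close> correct: if the rest of the path never drops below its start, a descending new
  segment puts the first minimum exactly at its own end.\<close>

lemma hold_triple_facts:
  assumes "exactly n a b r h" "r \<ge> 0" "\<And>i. h i \<ge> 0" "a > 0" "b > 0"
  shows "case hold_triple n a b p q r h of (s, y, x) \<Rightarrow> s \<ge> 0 \<and> y \<le> 0 \<and> (y = 0 \<longrightarrow> s = 0)"
  using assms
proof (induction n arbitrary: a b p q r h)
  case 0
  then show ?case by (auto simp: comb_def)
next
  case (Suc n)
  have tail: "0 \<le> tail h i" for i
    using Suc.prems(3) by (simp add: tail_def)
  have "case hold_triple n b a q p (r - h 0 / a) (tail h) of (s, y, x) \<Rightarrow> s \<ge> 0 \<and> y \<le> 0 \<and> (y = 0 \<longrightarrow> s = 0)"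
    by (rule Suc.IH) (use Suc.prems tail in auto)
  then show ?case using Suc.prems(3)[of 0] \<open>a > 0\<close> by (auto simp: comb_def split: prod.splits)
qed

lemma AE_holding_nonneg: "AE h in holding. \<forall>i. h i \<ge> 0"
proof -
  let ?E = "density lborel (exponential_density 1)"
  interpret E: prob_space ?E by (rule prob_space_exponential_density) simp
  interpret H: sequence_space ?E ..
  have "AE x in ?E. x \<ge> 0"
    by (subst AE_density) (auto simp: exponential_density_def split: if_splits)
  then have "AE h in holding. h i \<ge> 0" for i
    unfolding holding_def by (intro AE_PiM_component) (auto intro: E.prob_space_axioms)
  then show ?thesis by (simp add: AE_all_countable)
qed

text \<open>Functionals have to agree only on attainable triples. Case distinctions on the sign of
  \<open>y\<close> thereby replace arguments about paths.\<close>

lemma W_cong: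
  assumes "a > 0" "b > 0" "r \<ge> 0"
    and "\<And>s y x. s \<ge> 0 \<Longrightarrow> y \<le> 0 \<Longrightarrow> (y = 0 \<Longrightarrow> s = 0) \<Longrightarrow> f (s, y, x) = g (s, y, x)"
  shows "W n a b p q r f = W n a b p q r g"
  unfolding W_def
proof (rule nn_integral_cong_AE, use AE_holding_nonneg in eventually_elim)
  case (elim h)
  then show ?case
    using hold_triple_facts[of n a b r h p q] assms by (auto split: prod.splits)
qed

section \<open>Staying nonnegative, ending at the minimum, and the decomposition at the minimum\<close>

lemma W_add:
  assumes [measurable]: "f \<in> borel_measurable borel" "g \<in> borel_measurable borel"
  shows "W n a b p q r (\<lambda>z. f z + g z) = W n a b p q r f + W n a b p q r g"
  unfolding W_def by (subst nn_integral_add[symmetric]) (auto intro!: nn_integral_cong)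

lemma W_zero [simp]: "W n a b p q r (\<lambda>z. 0) = 0"
  by (simp add: W_def)

text \<open>The region \<open>u + v \<le> r\<close> is symmetric. This lets the duration of the
  first segment trade places with that of a later part of the path.\<close>

lemma nn_integral_triangle_swap:
  fixes F :: "real \<Rightarrow> real \<Rightarrow> ennreal"
  assumes [measurable]: "case_prod F \<in> borel_measurable (borel \<Otimes>\<^sub>M borel)"
  shows "(\<integral>\<^sup>+u\<in>{0..r}. (\<integral>\<^sup>+v\<in>{0..r - u}. F u v \<partial>lborel) \<partial>lborel) =
    (\<integral>\<^sup>+v\<in>{0..r}. (\<integral>\<^sup>+u\<in>{0..r - v}. F u v \<partial>lborel) \<partial>lborel)"
proof -
  have "(\<integral>\<^sup>+u\<in>{0..r}. (\<integral>\<^sup>+v\<in>{0..r - u}. F u v \<partial>lborel) \<partial>lborel) =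
      (\<integral>\<^sup>+u. (\<integral>\<^sup>+v. (if 0 \<le> u \<and> 0 \<le> v \<and> u + v \<le> r then F u v else 0) \<partial>lborel) \<partial>lborel)"
    by (subst nn_integral_multc[symmetric]) (auto intro!: nn_integral_cong simp: indicator_def)
  also have "\<dots> = (\<integral>\<^sup>+v. (\<integral>\<^sup>+u. (if 0 \<le> u \<and> 0 \<le> v \<and> u + v \<le> r then F u v else 0) \<partial>lborel) \<partial>lborel)"
    by (rule lborel_pair.Fubini') (unfold split_beta', measurable)
  also have "\<dots> = (\<integral>\<^sup>+v\<in>{0..r}. (\<integral>\<^sup>+u\<in>{0..r - v}. F u v \<partial>lborel) \<partial>lborel)"
    by (subst nn_integral_multc[symmetric]) (auto intro!: nn_integral_cong simp: indicator_def)
  finally show ?thesis .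
qed

lemma measurable_nn_integral_Icc:
  fixes F :: "'a \<Rightarrow> real \<Rightarrow> ennreal"
  assumes [measurable]: "case_prod F \<in> borel_measurable (N \<Otimes>\<^sub>M borel)" "g \<in> borel_measurable N" "k \<in> borel_measurable N"
  shows "(\<lambda>u. \<integral>\<^sup>+v\<in>{g u..k u}. F u v \<partial>lborel) \<in> borel_measurable N"
proof -
  have "(\<lambda>u. \<integral>\<^sup>+v\<in>{g u..k u}. F u v \<partial>lborel) =
      (\<lambda>u. \<integral>\<^sup>+v. (if g u \<le> v \<and> v \<le> k u then F u v else 0) \<partial>lborel)"
    by (intro ext nn_integral_cong) (auto simp: indicator_def)
  then show ?thesis by simp
qed

lemma nn_integral_reflect:
  fixes F :: "real \<Rightarrow> ennreal"
  assumes [measurable]: "F \<in> borel_measurable borel"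
  shows "(\<integral>\<^sup>+u\<in>{0..r}. F u \<partial>lborel) = (\<integral>\<^sup>+v\<in>{0..r}. F (r - v) \<partial>lborel)"
  by (subst nn_integral_real_affine[where c = "-1" and t = r])
    (auto intro!: nn_integral_cong simp: indicator_def)

section \<open>Paths above a barrier and paths that end at their minimum\<close>

definition alt :: "nat \<Rightarrow> 'a \<Rightarrow> 'a \<Rightarrow> 'a" where
  "alt n x y = (if even n then x else y)"

lemma alt_simps [simp]: "alt 0 x y = x" "alt (Suc n) x y = alt n y x"
  by (simp_all add: alt_def)

text \<open>The starting height \<open>z\<close> is a parameter because peeling off a segment
  changes the distance to the barrier 0. The condition \<open>0 \<le> z\<close> gives the value 0 as
  soon as a segment ends below the barrier.\<close>

definition surv :: "nat \<Rightarrow> real \<Rightarrow> real \<Rightarrow> real \<Rightarrow> real \<Rightarrow> real \<Rightarrow> real \<Rightarrow> (real \<Rightarrow> ennreal) \<Rightarrow> ennreal" where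
  "surv n a b p q r z \<phi> = W n a b p q r (\<lambda>(s, y, x). if 0 \<le> z \<and> 0 \<le> z + y then \<phi> (z + x) else 0)"

lemma measurable_surv [measurable (raw)]:
  assumes [measurable]: "r \<in> borel_measurable N" "z \<in> borel_measurable N"
    "case_prod \<phi> \<in> borel_measurable (N \<Otimes>\<^sub>M borel)"
  shows "(\<lambda>x. surv n a b p q (r x) (z x) (\<phi> x)) \<in> borel_measurable N"
  unfolding surv_def by (intro measurable_W) (unfold split_beta' borel_prod[symmetric], measurable)

lemma surv_0:
  assumes "a > 0" "r \<ge> 0"
  shows "surv 0 a b p q r z \<phi> =
    (if 0 \<le> z \<and> 0 \<le> z + p * r then ennreal (exp (- a * r)) * \<phi> (z + p * r) else 0)"
  using assms by (auto simp: surv_def W_0 comb_def)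

lemma surv_zero [simp]: "surv n a b p q r z (\<lambda>x. 0) = 0"
  by (simp add: surv_def split_beta' cong: if_cong)

lemma surv_neg: "z < 0 \<Longrightarrow> surv n a b p q r z \<phi> = 0"
  by (simp add: surv_def split_beta' cong: if_cong)

lemma surv_Suc:
  assumes a: "a > 0" "b > 0" and [measurable]: "\<phi> \<in> borel_measurable borel"
  shows "surv (Suc n) a b p q r z \<phi> = (if 0 \<le> z then
    (\<integral>\<^sup>+u\<in>{0..r}. ennreal (a * exp (- a * u)) * surv n b a q p (r - u) (z + p * u) \<phi> \<partial>lborel) else 0)"
proof (cases "0 \<le> z")
  case True
  have "surv (Suc n) a b p q r z \<phi> = (\<integral>\<^sup>+u\<in>{0..r}. ennreal (a * exp (- a * u)) *
      W n b a q p (r - u) (\<lambda>w. (\<lambda>(s, y, x). if 0 \<le> z \<and> 0 \<le> z + y then \<phi> (z + x) else 0) (comb p u w)) \<partial>lborel)"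
    unfolding surv_def
    by (rule W_Suc[OF a(1)]) (unfold split_beta' borel_prod[symmetric], measurable)
  also have "\<dots> = (\<integral>\<^sup>+u\<in>{0..r}. ennreal (a * exp (- a * u)) * surv n b a q p (r - u) (z + p * u) \<phi> \<partial>lborel)"
    unfolding surv_def
    by (intro nn_integral_cong) (auto intro!: W_cong arg_cong2[where f = "(*)"] a True
      simp: indicator_def comb_def add.assoc True)
  finally show ?thesis using True by simp
qed (simp add: surv_def split_beta' cong: if_cong)

text \<open>Peels off the last segment, although \<open>W\<close> recurses on the first: take off
  the first, apply the hypothesis to the rest, exchange the integrations. The last segment is
  straight and begins above the barrier, so testing its end point suffices. The integrand carries
  the rate \<open>alt n a b\<close> of the final switching and the survival at the rate of the final
  state.\<close>

lemma surv_forward: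
  assumes "a > 0" "b > 0" and [measurable]: "\<phi> \<in> borel_measurable borel"
  shows "surv (Suc n) a b p q r z \<phi> =
    (\<integral>\<^sup>+u\<in>{0..r}. surv n a b p q (r - u) z (\<lambda>w.
       if 0 \<le> w + alt n q p * u then ennreal (alt n a b * exp (- alt n b a * u)) * \<phi> (w + alt n q p * u) else 0) \<partial>lborel)"
  using assms(1,2)
proof (induction n arbitrary: a b p q r z)
  case 0
  have "surv (Suc 0) a b p q r z \<phi> = (if 0 \<le> z then
    (\<integral>\<^sup>+u\<in>{0..r}. ennreal (a * exp (- a * u)) * surv 0 b a q p (r - u) (z + p * u) \<phi> \<partial>lborel) else 0)"
    by (rule surv_Suc) (use 0 in auto)
  \<comment> \<open>With a single switching the passage from the first to the last segment is the
    substitution of \<open>r - u\<close> for \<open>u\<close>.\<close>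
  also have "\<dots> = (if 0 \<le> z then
    (\<integral>\<^sup>+u\<in>{0..r}. ennreal (a * exp (- a * (r - u))) * surv 0 b a q p u (z + p * (r - u)) \<phi> \<partial>lborel) else 0)"
    by (subst nn_integral_reflect) (auto simp: cong: if_cong)
  also have "\<dots> = (\<integral>\<^sup>+u\<in>{0..r}. surv 0 a b p q (r - u) z (\<lambda>w.
       if 0 \<le> w + q * u then ennreal (a * exp (- b * u)) * \<phi> (w + q * u) else 0) \<partial>lborel)"
    using 0 by (auto intro!: nn_integral_cong simp: indicator_def surv_0 surv_neg ennreal_mult' mult_ac add_ac)
  finally show ?case by (simp cong: if_cong)
next
  case (Suc n)
  let ?\<psi> = "\<lambda>v w. if 0 \<le> w + alt n p q * v then ennreal (alt n b a * exp (- alt n a b * v)) * \<phi> (w + alt n p q * v) else 0"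
  have "surv (Suc (Suc n)) a b p q r z \<phi> = (if 0 \<le> z then
    (\<integral>\<^sup>+u\<in>{0..r}. ennreal (a * exp (- a * u)) * surv (Suc n) b a q p (r - u) (z + p * u) \<phi> \<partial>lborel) else 0)"
    by (rule surv_Suc) (use Suc in auto)
  also have "\<dots> = (if 0 \<le> z then
    (\<integral>\<^sup>+u\<in>{0..r}. (\<integral>\<^sup>+v\<in>{0..r - u}. ennreal (a * exp (- a * u)) * surv n b a q p (r - u - v) (z + p * u) (?\<psi> v) \<partial>lborel) \<partial>lborel) else 0)"
    unfolding Suc.IH[OF Suc.prems(2,1)] mult.assoc
    by (subst nn_integral_cmult) (auto simp: mult.assoc)
  also have "\<dots> = (if 0 \<le> z then
    (\<integral>\<^sup>+v\<in>{0..r}. (\<integral>\<^sup>+u\<in>{0..r - v}. ennreal (a * exp (- a * u)) * surv n b a q p (r - u - v) (z + p * u) (?\<psi> v) \<partial>lborel) \<partial>lborel) else 0)"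
    by (subst nn_integral_triangle_swap) (auto simp: split_beta')
  also have "\<dots> = (\<integral>\<^sup>+v\<in>{0..r}. surv (Suc n) a b p q (r - v) z (?\<psi> v) \<partial>lborel)"
    by (subst surv_Suc) (use Suc.prems in \<open>auto simp: algebra_simps\<close>)
  finally show ?case by (simp cong: if_cong)
qed

definition ending :: "nat \<Rightarrow> real \<Rightarrow> real \<Rightarrow> real \<Rightarrow> real \<Rightarrow> real \<Rightarrow> (real \<Rightarrow> ennreal) \<Rightarrow> ennreal" where
  "ending n a b p q r \<phi> = W n a b p q r (\<lambda>(s, y, x). if s = r \<and> y = x \<and> y < 0 then \<phi> x else 0)"

lemma measurable_ending [measurable (raw)]:
  assumes [measurable]: "r \<in> borel_measurable N" "case_prod \<phi> \<in> borel_measurable (N \<Otimes>\<^sub>M borel)"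
  shows "(\<lambda>x. ending n a b p q (r x) (\<phi> x)) \<in> borel_measurable N"
  unfolding ending_def by (intro measurable_W) (unfold split_beta' borel_prod[symmetric], measurable)

lemma ending_0:
  assumes "a > 0" "r > 0"
  shows "ending 0 a b p q r \<phi> = (if p < 0 then ennreal (exp (- a * r)) * \<phi> (p * r) else 0)"
  using assms by (auto simp: ending_def W_0 comb_def mult_less_0_iff)

lemma ending_cong:
  assumes "\<And>x. x < 0 \<Longrightarrow> \<phi> x = \<psi> x"
  shows "ending n a b p q r \<phi> = ending n a b p q r \<psi>"
  unfolding ending_def by (rule arg_cong[where f = "W n a b p q r"]) (auto simp: assms)

lemma ending_zero [simp]: "ending n a b p q r (\<lambda>x. 0) = 0"
  by (simp add: ending_def split_beta' cong: if_cong)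

lemma ending_Suc:
  assumes a: "a > 0" "b > 0" and r: "r > 0" and [measurable]: "\<phi> \<in> borel_measurable borel"
  shows "ending (Suc n) a b p q r \<phi> =
    (\<integral>\<^sup>+u\<in>{0..r}. ennreal (a * exp (- a * u)) *
       ending n b a q p (r - u) (\<lambda>x. if p * u + x < 0 then \<phi> (p * u + x) else 0) \<partial>lborel)"
proof -
  have "ending (Suc n) a b p q r \<phi> = (\<integral>\<^sup>+u\<in>{0..r}. ennreal (a * exp (- a * u)) *
      W n b a q p (r - u) (\<lambda>w. (\<lambda>(s, y, x). if s = r \<and> y = x \<and> y < 0 then \<phi> x else 0) (comb p u w)) \<partial>lborel)"
    unfolding ending_def
    by (rule W_Suc[OF a(1)]) (unfold split_beta' borel_prod[symmetric], measurable)
  also have "\<dots> = (\<integral>\<^sup>+u\<in>{0..r}. ennreal (a * exp (- a * u)) *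
       ending n b a q p (r - u) (\<lambda>x. if p * u + x < 0 then \<phi> (p * u + x) else 0) \<partial>lborel)"
    unfolding ending_def
  \<comment> \<open>At \<open>u = r\<close> the rest of the path has length 0 and no minimum below
    its start, while the whole path may still end at its minimum; this null set is excluded.\<close>
  proof (intro nn_integral_cong_AE, use AE_lborel_singleton[of r] in eventually_elim)
    case (elim u)
    then show ?case using r
      by (cases "u \<in> {0..r}") (auto intro!: W_cong arg_cong2[where f = "(*)"] a simp: comb_def indicator_def)
  qed
  finally show ?thesis .
qed


text \<open>
  If the minimum is attained strictly inside the time interval, the path is in its down-phase
  just before and in its up-phase just after: the minimum is attained at a jump time.
\<close>

lemma W_decompose:
  assumes pos: "\<alpha> > 0" "\<beta> > 0" "U > 0" "V > 0" "r \<ge> 0"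
    and dir: "(a, b, p, q) = (\<alpha>, \<beta>, U, - V) \<or> (a, b, p, q) = (\<beta>, \<alpha>, - V, U)"
    and f: "f \<in> borel_measurable borel"
    and supp: "\<And>s y x. \<not> (s < r \<and> y < 0) \<Longrightarrow> f (s, y, x) = 0"
  shows "W n a b p q r f = (\<Sum>j<n. \<integral>\<^sup>+v\<in>{0..r}. ennreal \<beta> * ending j a b p q (r - v)
    (\<lambda>y. surv (n - 1 - j) \<alpha> \<beta> U (- V) v 0 (\<lambda>x. f (r - v, y, x + y))) \<partial>lborel)"
  using \<open>r \<ge> 0\<close> dir f supp
proof (induction n arbitrary: a b p q r f)
  case 0
  then have "comb p r (0, 0, 0) = (r, p * r, p * r) \<or> comb p r (0, 0, 0) = (0, 0, p * r)"
    by (auto simp: comb_def)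
  moreover have "a > 0" using 0 pos by auto
  ultimately show ?case
    using 0 by (auto simp: W_0)
next
  case (Suc n)
  note [measurable] = \<open>f \<in> borel_measurable borel\<close>
  have [measurable]: "f \<in> borel_measurable (borel \<Otimes>\<^sub>M borel \<Otimes>\<^sub>M borel)"
    by (simp add: borel_prod)
  have ab: "a > 0" "b > 0" using Suc.prems pos by auto
  have dir': "(b, a, q, p) = (\<alpha>, \<beta>, U, - V) \<or> (b, a, q, p) = (\<beta>, \<alpha>, - V, U)"
    using Suc.prems(2) by auto
  \<comment> \<open>The contribution of all that can follow a minimum \<open>y\<close> attained at
    time \<open>r - v\<close>: a path of duration \<open>v\<close> that starts upwards and never
    drops below \<open>y\<close>.\<close>
  define \<Psi> where "\<Psi> m v y = surv m \<alpha> \<beta> U (- V) v 0 (\<lambda>x. f (r - v, y, x + y))" for m v y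
  have [measurable]: "(\<lambda>x. \<Psi> m (g x) (k x)) \<in> borel_measurable N"
    if [measurable]: "g \<in> borel_measurable N" "k \<in> borel_measurable N" for m g k and N :: "'z measure"
    unfolding \<Psi>_def by measurable
  \<comment> \<open>\<open>f1\<close> collects the triples whose minimum lies in the rest of the
    path, \<open>f2\<close> those whose minimum is the end of the first segment; the latter means a
    descending first segment and \<open>y = 0\<close> for the rest.\<close>
  define f1 where "f1 u = (\<lambda>(s, y, x). if y < 0 \<and> p * u + y < 0 then f (u + s, p * u + y, p * u + x) else 0)" for u
  define f2 where "f2 u = (\<lambda>(s::real, y::real, x). if y = 0 \<and> p < 0 then f (u, p * u, p * u + x) else 0)" for u
  have [measurable]: "f1 u \<in> borel_measurable borel" "f2 u \<in> borel_measurable borel" for u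
    unfolding f1_def f2_def split_beta' borel_prod[symmetric] by measurable
  have [measurable]: "case_prod f1 \<in> borel_measurable (borel \<Otimes>\<^sub>M borel)"
      "case_prod f2 \<in> borel_measurable (borel \<Otimes>\<^sub>M borel)"
    unfolding f1_def f2_def split_beta' borel_prod[symmetric] by measurable
  have [measurable]: "(\<lambda>u. W n b a q p (r - u) (f1 u)) \<in> borel_measurable borel"
      "(\<lambda>u. W n b a q p (r - u) (f2 u)) \<in> borel_measurable borel"
    by (intro measurable_W; measurable)+
  have W1: "W n b a q p (r - u) (f1 u) = (\<Sum>j<n. \<integral>\<^sup>+v\<in>{0..r - u}. ennreal \<beta> *
      ending j b a q p (r - v - u) (\<lambda>y. if p * u + y < 0 then \<Psi> (n - 1 - j) v (p * u + y) else 0) \<partial>lborel)"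
    if u: "u \<in> {0..r}" for u
  proof -
    have "W n b a q p (r - u) (f1 u) = (\<Sum>j<n. \<integral>\<^sup>+v\<in>{0..r - u}. ennreal \<beta> * ending j b a q p (r - u - v)
       (\<lambda>y. surv (n - 1 - j) \<alpha> \<beta> U (- V) v 0 (\<lambda>x. f1 u (r - u - v, y, x + y))) \<partial>lborel)"
    proof (rule Suc.IH[OF _ dir'])
      show "f1 u \<in> borel_measurable borel" by measurable
    qed (use u Suc.prems(4) in \<open>auto simp: f1_def\<close>)
    also have "\<dots> = (\<Sum>j<n. \<integral>\<^sup>+v\<in>{0..r - u}. ennreal \<beta> *
      ending j b a q p (r - v - u) (\<lambda>y. if p * u + y < 0 then \<Psi> (n - 1 - j) v (p * u + y) else 0) \<partial>lborel)"
      by (intro sum.cong nn_integral_cong arg_cong2[where f = "(*)"] refl, simp add: diff_diff_eq add.commute)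
         (auto intro!: ending_cong simp: f1_def \<Psi>_def algebra_simps)
    finally show ?thesis .
  qed
  \<comment> \<open>On attainable triples \<open>y = 0\<close> is the same as
    \<open>0 \<le> 0 + y\<close>, so the rest of the path is counted by \<open>surv\<close>.\<close>
  have W2: "W n b a q p (r - u) (f2 u) = (if p < 0 then \<Psi> n (r - u) (p * u) else 0)"
    if u: "u \<in> {0..r}" for u
  proof (cases "p < 0")
    case True
    then have "(b, a, q, p) = (\<alpha>, \<beta>, U, - V)" using Suc.prems(2) pos by auto
    then show ?thesis using u True pos
      unfolding \<Psi>_def surv_def by (auto intro!: W_cong simp: f2_def add_ac)
  qed (simp add: f2_def split_beta' cong: if_cong)
  \<comment> \<open>The term \<open>j = 0\<close>: the density of the length of a first descending
    segment is \<open>\<beta>\<close> times its survival probability, which is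
    \<open>ending 0\<close>. If the first segment ascends, both sides are 0.\<close>
  have first: "(\<integral>\<^sup>+u\<in>{0..r}. ennreal (a * exp (- a * u)) * W n b a q p (r - u) (f2 u) \<partial>lborel) =
      (\<integral>\<^sup>+v\<in>{0..r}. ennreal \<beta> * ending 0 a b p q (r - v) (\<Psi> n v) \<partial>lborel)"
  proof (cases "p < 0")
    case True
    then have eq: "a = \<beta>" using Suc.prems(2) pos by auto
    have "(\<integral>\<^sup>+u\<in>{0..r}. ennreal (a * exp (- a * u)) * W n b a q p (r - u) (f2 u) \<partial>lborel) =
      (\<integral>\<^sup>+u\<in>{0..r}. ennreal (a * exp (- a * u)) * \<Psi> n (r - u) (p * u) \<partial>lborel)"
      using True by (intro nn_integral_cong) (auto simp: W2 indicator_def)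
    also have "\<dots> = (\<integral>\<^sup>+v\<in>{0..r}. ennreal (a * exp (- a * (r - v))) * \<Psi> n v (p * (r - v)) \<partial>lborel)"
      by (subst nn_integral_reflect) auto
    also have "\<dots> = (\<integral>\<^sup>+v\<in>{0..r}. ennreal \<beta> * ending 0 a b p q (r - v) (\<Psi> n v) \<partial>lborel)"
    proof (intro nn_integral_cong_AE, use AE_lborel_singleton[of r] in eventually_elim)
      case (elim v)
      then show ?case
        using True eq ab by (auto simp: ending_0 indicator_def ennreal_mult' mult_ac)
    qed
    finally show ?thesis .
  next
    case False
    then have "(\<integral>\<^sup>+u\<in>{0..r}. ennreal (a * exp (- a * u)) * W n b a q p (r - u) (f2 u) \<partial>lborel) =
       (\<integral>\<^sup>+(u::real). 0 \<partial>lborel)"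
      by (intro nn_integral_cong) (auto simp: W2 indicator_def)
    also have "\<dots> = (\<integral>\<^sup>+v\<in>{0..r}. ennreal \<beta> * ending 0 a b p q (r - v) (\<Psi> n v) \<partial>lborel)"
    proof (intro nn_integral_cong_AE, use AE_lborel_singleton[of r] in eventually_elim)
      case (elim v)
      then show ?case
        using False ab by (auto simp: ending_0 indicator_def)
    qed
    finally show ?thesis .
  qed
  \<comment> \<open>The terms \<open>Suc j\<close>: a segment put in front of an ending path with
    \<open>j\<close> switchings gives one with \<open>Suc j\<close>, by \<open>ending_Suc\<close>,
    once the duration \<open>v\<close> after the minimum is moved to the outer integral.\<close>
  have later: "(\<integral>\<^sup>+u\<in>{0..r}. ennreal (a * exp (- a * u)) * (\<integral>\<^sup>+v\<in>{0..r - u}. ennreal \<beta> *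
      ending j b a q p (r - v - u) (\<lambda>y. if p * u + y < 0 then \<Psi> m v (p * u + y) else 0) \<partial>lborel) \<partial>lborel) =
     (\<integral>\<^sup>+v\<in>{0..r}. ennreal \<beta> * ending (Suc j) a b p q (r - v) (\<Psi> m v) \<partial>lborel)" for j m
  proof -
    let ?G = "\<lambda>u v. ending j b a q p (r - v - u) (\<lambda>y. if p * u + y < 0 then \<Psi> m v (p * u + y) else 0)"
    have "(\<integral>\<^sup>+u\<in>{0..r}. ennreal (a * exp (- a * u)) * (\<integral>\<^sup>+v\<in>{0..r - u}. ennreal \<beta> * ?G u v \<partial>lborel) \<partial>lborel) =
      (\<integral>\<^sup>+u\<in>{0..r}. (\<integral>\<^sup>+v\<in>{0..r - u}. ennreal \<beta> * (ennreal (a * exp (- a * u)) * ?G u v) \<partial>lborel) \<partial>lborel)"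
      by (subst nn_integral_cmult[symmetric]) (auto intro!: nn_integral_cong simp: mult_ac)
    also have "\<dots> = (\<integral>\<^sup>+v\<in>{0..r}. (\<integral>\<^sup>+u\<in>{0..r - v}. ennreal \<beta> * (ennreal (a * exp (- a * u)) * ?G u v) \<partial>lborel) \<partial>lborel)"
      by (rule nn_integral_triangle_swap) (unfold split_beta', measurable)
    also have "\<dots> = (\<integral>\<^sup>+v\<in>{0..r}. ennreal \<beta> * ending (Suc j) a b p q (r - v) (\<Psi> m v) \<partial>lborel)"
    proof (intro nn_integral_cong_AE, use AE_lborel_singleton[of r] in eventually_elim)
      case (elim v)
      then show ?case
        by (cases "v \<in> {0..r}")
          (simp_all add: ending_Suc ab nn_integral_cmult[symmetric] mult.assoc)
    qed
    finally show ?thesis .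
  qed
  define K where "K m j u = (\<integral>\<^sup>+v\<in>{0..r - u}. ennreal \<beta> * ending j b a q p (r - v - u)
      (\<lambda>y. if p * u + y < 0 then \<Psi> m v (p * u + y) else 0) \<partial>lborel)" for m j u
  have K [measurable]: "K m j \<in> borel_measurable borel" for j m
  proof -
    have "(\<lambda>(u, v). ennreal \<beta> * ending j b a q p (r - v - u)
        (\<lambda>y. if p * u + y < 0 then \<Psi> m v (p * u + y) else 0)) \<in> borel_measurable (borel \<Otimes>\<^sub>M borel)"
      unfolding split_beta' by measurable
    from measurable_nn_integral_Icc[OF this borel_measurable_const borel_measurable_diff[OF borel_measurable_const measurable_ident]]
    show ?thesis unfolding K_def[abs_def] id_def .
  qed
  note later = later[folded K_def] and W1 = W1[folded K_def]
  have "W (Suc n) a b p q r f = (\<integral>\<^sup>+u\<in>{0..r}. ennreal (a * exp (- a * u)) *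
      W n b a q p (r - u) (\<lambda>w. f (comb p u w)) \<partial>lborel)"
    by (rule W_Suc[OF ab(1)]) measurable
  \<comment> \<open>Where \<open>comb\<close> returns the minimum 0, \<open>f\<close> vanishes by
    its support; otherwise the sign of \<open>y\<close> decides between \<open>f1\<close> and
    \<open>f2\<close>.\<close>
  also have "\<dots> = (\<integral>\<^sup>+u\<in>{0..r}. ennreal (a * exp (- a * u)) *
      W n b a q p (r - u) (\<lambda>w. f1 u w + f2 u w) \<partial>lborel)"
  proof (intro nn_integral_cong_AE, use AE_lborel_singleton[of 0] in eventually_elim)
    case (elim u)
    have "W n b a q p (r - u) (\<lambda>w. f (comb p u w)) = W n b a q p (r - u) (\<lambda>w. f1 u w + f2 u w)"
      if u: "u \<in> {0..r}"
      using u elim Suc.prems(4)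
      by (intro W_cong) (auto simp: ab f1_def f2_def comb_def mult_less_0_iff)
    then show ?case by (auto simp: indicator_def)
  qed
  also have "\<dots> = (\<integral>\<^sup>+u\<in>{0..r}. ennreal (a * exp (- a * u)) * W n b a q p (r - u) (f1 u) \<partial>lborel) +
      (\<integral>\<^sup>+u\<in>{0..r}. ennreal (a * exp (- a * u)) * W n b a q p (r - u) (f2 u) \<partial>lborel)"
    by (subst nn_integral_add[symmetric])
      (auto simp: W_add distrib_left distrib_right)
  also have "(\<integral>\<^sup>+u\<in>{0..r}. ennreal (a * exp (- a * u)) * W n b a q p (r - u) (f1 u) \<partial>lborel) =
     (\<integral>\<^sup>+u. (\<Sum>j<n. ennreal (a * exp (- a * u)) * K (n - 1 - j) j u * indicator {0..r} u) \<partial>lborel)"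
    by (intro nn_integral_cong) (auto simp: W1 indicator_def sum_distrib_left)
  also have "\<dots> = (\<Sum>j<n. \<integral>\<^sup>+v\<in>{0..r}. ennreal \<beta> * ending (Suc j) a b p q (r - v) (\<Psi> (n - 1 - j) v) \<partial>lborel)"
    by (subst nn_integral_sum) (measurable, simp only: later)
  finally show ?case
    unfolding first by (subst sum.lessThan_Suc_shift) (simp add: \<Psi>_def[abs_def] add.commute)
qed

section \<open>Ballot densities\<close>

text \<open>The volume of the n - 1 free holding times of a path with n switchings, time
  \<open>A\<close> up and \<open>D\<close> down, that stays nonnegative; \<open>c\<close> is the
  ratio of the speeds. For \<open>c = 0\<close> it is a product of two simplex volumes. For
  \<open>c > 0\<close> the factors \<open>1 - c * D / A\<close> (n even) and
  \<open>1 - m / (m + 1) * c * D / A\<close> (n odd) are the ballot corrections. For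
  \<open>m = 0\<close> the exponent \<open>m - 1\<close> is harmless because of the factor
  \<open>real m\<close>.\<close>

definition ballot :: "real \<Rightarrow> nat \<Rightarrow> real \<Rightarrow> real \<Rightarrow> real" where
  "ballot c n A D =
    (if odd n then let m = n div 2 in
       A ^ m * D ^ m / (fact m)\<^sup>2 - real m * c * A ^ (m - 1) * D ^ (m + 1) / (fact m * fact (m + 1))
     else let m = n div 2 - 1 in
       (A ^ (m + 1) * D ^ m - c * A ^ m * D ^ (m + 1)) / (fact m * fact (m + 1)))"

lemma ballot_odd:
  "ballot c (Suc (2 * m)) A D =
     A ^ m * D ^ m / (fact m)\<^sup>2 - real m * c * A ^ (m - 1) * D ^ (m + 1) / (fact m * fact (m + 1))"
  by (simp add: ballot_def Let_def)

lemma ballot_even: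
  "ballot c (Suc (Suc (2 * m))) A D = (A ^ (m + 1) * D ^ m - c * A ^ m * D ^ (m + 1)) / (fact m * fact (m + 1))"
  by (simp add: ballot_def Let_def)

lemma odd_cases: "odd n \<Longrightarrow> (\<And>m. n = Suc (2 * m) \<Longrightarrow> P) \<Longrightarrow> P"
  by (auto elim: oddE)

lemma even_pos_cases: "even n \<Longrightarrow> n > 0 \<Longrightarrow> (\<And>m. n = Suc (Suc (2 * m)) \<Longrightarrow> P) \<Longrightarrow> P"
  by (metis Suc_pred even_Suc odd_cases)

text \<open>After an odd number of switchings the path descends, so the next segment ascends: it
  adds to \<open>A\<close> and leaves \<open>D\<close> alone. With the initial value of
  \<open>ballot_diagonal\<close> this determines \<open>ballot c (Suc n)\<close> from
  \<open>ballot c n\<close>.\<close>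

lemma ballot_deriv_up:
  assumes "odd n"
  shows "((\<lambda>A. ballot c (Suc n) A D) has_real_derivative ballot c n A D) (at A)"
proof -
  obtain m where n: "n = Suc (2 * m)" using assms by (rule odd_cases)
  have "((\<lambda>A. ballot c (Suc n) A D) has_real_derivative
      (real (m + 1) * A ^ m * D ^ m - c * (real m * A ^ (m - 1)) * D ^ (m + 1)) / (fact m * fact (m + 1))) (at A)"
    unfolding n ballot_even
    using DERIV_cdivide[OF DERIV_diff[OF DERIV_cmult_right[OF DERIV_pow[of "m + 1" A]]
      DERIV_cmult_right[OF DERIV_cmult[OF DERIV_pow[of m A], of c]], of "D ^ m" "D ^ (m + 1)"], of "fact m * fact (m + 1)"]
    by simp
  also have "(real (m + 1) * A ^ m * D ^ m - c * (real m * A ^ (m - 1)) * D ^ (m + 1)) / (fact m * fact (m + 1)) = ballot c n A D"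
  proof -
    have "real (m + 1) * x / (fact m * fact (m + 1)) = x / (fact m)\<^sup>2" for x :: real
    proof -
      have "N \<noteq> 0 \<Longrightarrow> F \<noteq> 0 \<Longrightarrow> N * x / (F * (N * F)) = x / F\<^sup>2" for N F :: real
        by (simp add: power2_eq_square)
      from this[of "real (m + 1)" "fact m"] show ?thesis by simp
    qed
    from this[of "A ^ m * D ^ m"] show ?thesis
      unfolding n ballot_odd diff_divide_distrib by (simp add: mult_ac)
  qed
  finally show ?thesis .
qed

text \<open>The dual step, in which the next segment adds to \<open>D\<close>; its initial value is
  that of \<open>ballot_axis\<close>. It starts at \<open>n = 2\<close>, as the position has no
  density without switchings.\<close>

lemma ballot_deriv_down:
  assumes "even n" "n > 0"
  shows "((\<lambda>D. ballot c (Suc n) A D) has_real_derivative ballot c n A D) (at D)"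
proof -
  obtain m where n: "n = Suc (Suc (2 * m))" using assms by (rule even_pos_cases)
  have n': "Suc n = Suc (2 * Suc m)" using n by simp
  define k1 k2 where "k1 = A ^ Suc m / (fact (Suc m))\<^sup>2"
    and "k2 = real (Suc m) * c * A ^ m / (fact (Suc m) * fact (m + 2))"
  have "ballot c (Suc n) A D = k1 * D ^ Suc m - k2 * D ^ (m + 2)" for D
    unfolding n' ballot_odd k1_def k2_def by (simp add: mult_ac)
  moreover have "((\<lambda>D. k1 * D ^ Suc m - k2 * D ^ (m + 2)) has_real_derivative
      k1 * (real (Suc m) * D ^ m) - k2 * (real (m + 2) * D ^ (m + 1))) (at D)"
    using DERIV_diff[OF DERIV_cmult[OF DERIV_pow[of "Suc m" D]] DERIV_cmult[OF DERIV_pow[of "m + 2" D]], of k1 k2]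
    by simp
  moreover have "k1 * (real (Suc m) * D ^ m) - k2 * (real (m + 2) * D ^ (m + 1)) = ballot c n A D"
  proof -
    have "real (Suc m) * x / (fact (Suc m))\<^sup>2 = x / (fact m * fact (m + 1))"
      "real (Suc m) * (real (m + 2) * x) / (fact (Suc m) * fact (m + 2)) = x / (fact m * fact (m + 1))" for x :: real
      by (simp_all add: field_simps power2_eq_square del: of_nat_Suc)
    from this(1)[of "A ^ Suc m * D ^ m"] this(2)[of "c * A ^ m * D ^ (m + 1)"]
    show ?thesis
      unfolding n ballot_even diff_divide_distrib k1_def k2_def by (simp add: mult_ac)
  qed
  ultimately show ?thesis by simp
qed

text \<open>The cone \<open>c * D \<le> A\<close> describes the occupation times whose end point is
  nonnegative. Nonnegativity of the derivative there is what the fundamental theorem for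
  \<open>nn_integral\<close> asks for.\<close>

lemma ballot_nonneg:
  assumes "n > 0" "0 \<le> c" "0 \<le> D" "c * D \<le> A"
  shows "0 \<le> ballot c n A D"
proof -
  have A: "0 \<le> A" using assms by (meson mult_nonneg_nonneg order_trans)
  show ?thesis
  proof (cases "odd n")
    case True
    then obtain m where n: "n = Suc (2 * m)" by (rule odd_cases)
    show ?thesis
    proof (cases m)
      case 0
      then show ?thesis by (simp add: n ballot_def)
    next
      case (Suc k)
      have "real (k + 1) * c * D \<le> real (k + 2) * A"
        using mult_mono[of "real (k + 1)" "real (k + 2)" "c * D" A] assms A by (simp add: mult.assoc)
      then have "0 \<le> A ^ k * D ^ Suc k * (real (k + 2) * A - real (k + 1) * c * D)"
        using A assms by (intro mult_nonneg_nonneg) auto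
      also have "\<dots> = real (k + 2) * (A ^ m * D ^ m) - real m * c * A ^ (m - 1) * D ^ (m + 1)"
        by (simp add: Suc algebra_simps)
      finally have "0 \<le> (real (k + 2) * (A ^ m * D ^ m) - real m * c * A ^ (m - 1) * D ^ (m + 1)) / (fact m * fact (m + 1))"
        by simp
      also have "\<dots> = ballot c n A D"
      proof -
        have "fact (m + 1) = real (k + 2) * fact m" by (simp add: Suc)
        then show ?thesis
          unfolding n ballot_odd by (simp add: diff_divide_distrib power2_eq_square)
      qed
      finally show ?thesis .
    qed
  next
    case False
    then obtain m where n: "n = Suc (Suc (2 * m))" using assms even_pos_cases by blast
    have "0 \<le> A ^ m * D ^ m * (A - c * D)"
      using A assms by (intro mult_nonneg_nonneg) auto
    also have "\<dots> = A ^ (m + 1) * D ^ m - c * A ^ m * D ^ (m + 1)"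
      by (simp add: algebra_simps)
    finally show ?thesis unfolding n ballot_even by simp
  qed
qed

lemma ballot_Suc_0 [simp]: "ballot c (Suc 0) A D = 1"
  by (simp add: ballot_def)

text \<open>On this line the path ends at height 0, which leaves no room for a final ascending
  segment.\<close>

lemma ballot_diagonal: "odd n \<Longrightarrow> ballot c (Suc n) (c * D) D = 0"
  by (erule odd_cases) (simp add: ballot_def power_mult_distrib)

lemma ballot_axis: "even n \<Longrightarrow> n > 0 \<Longrightarrow> ballot c (Suc n) A 0 = 0"
  by (erule (1) even_pos_cases) (simp add: ballot_def)

lemma measurable_ballot [measurable (raw)]:
  assumes [measurable]: "f \<in> borel_measurable N" "g \<in> borel_measurable N"
  shows "(\<lambda>x. ballot c n (f x) (g x)) \<in> borel_measurable N"
  unfolding ballot_def by (cases "odd n") (auto simp: Let_def)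

text \<open>The two quotients are the solution \<open>A\<close>, \<open>D\<close> of
  \<open>A + D = r\<close> and \<open>U * A - V * D = x\<close>, and the divisor
  \<open>U + V\<close> is the Jacobian of the passage from \<open>D\<close> to \<open>x\<close> at
  fixed \<open>r\<close>.\<close>

definition dens :: "nat \<Rightarrow> real \<Rightarrow> real \<Rightarrow> real \<Rightarrow> real \<Rightarrow> real \<Rightarrow> real \<Rightarrow> real" where
  "dens n a b U V r x = (if 0 < x \<and> x < U * r then
     ballot (V / U) n ((x + V * r) / (U + V)) ((U * r - x) / (U + V)) *
     exp (- a * ((x + V * r) / (U + V)) - b * ((U * r - x) / (U + V))) / (U + V) else 0)"

lemma measurable_dens [measurable (raw)]:
  assumes [measurable]: "f \<in> borel_measurable N" "g \<in> borel_measurable N"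
  shows "(\<lambda>x. dens n a b U V (f x) (g x)) \<in> borel_measurable N"
  unfolding dens_def by measurable

section \<open>The ballot recursion in terms of time and position\<close>

lemma time_up_minus:
  fixes U V x r :: real
  assumes "U > 0" "V > 0"
  shows "(x + V * r) / (U + V) - x / U = V / U * ((U * r - x) / (U + V))"
proof -
  have "U * ((x + V * r) / (U + V)) - V * ((U * r - x) / (U + V)) = (U * (x + V * r) - V * (U * r - x)) / (U + V)"
  proof -
    have "U * (X / S) - V * (Y / S) = (U * X - V * Y) / S" for X Y S
      by (simp add: diff_divide_distrib)
    then show ?thesis .
  qed
  also have "\<dots> = x * (U + V) / (U + V)" by (simp add: algebra_simps)
  finally have "U * ((x + V * r) / (U + V)) - V * ((U * r - x) / (U + V)) = x" using assms by simp
  moreover have "A - x / U = V / U * D" if "U * A - V * D = x" for A D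
    using assms that by (simp add: field_simps)
  ultimately show ?thesis by blast
qed

text \<open>Along the backward ray \<open>(r - u, x - U * u)\<close> only \<open>A\<close> changes,
  so the exponentials combine to the constant \<open>K\<close> and the integrand is a derivative.
  The ray leaves the cone at \<open>u = x / U\<close>, where the primitive vanishes by
  \<open>ballot_diagonal\<close>.\<close>

lemma dens_step_up:
  assumes n: "odd n" and pos: "U > 0" "V > 0"
  shows "(\<integral>\<^sup>+u\<in>{0..r}. ennreal (dens n a b U V (r - u) (x - U * u) * exp (- a * u)) \<partial>lborel) =
    ennreal (dens (Suc n) a b U V r x)"
proof (cases "0 < x \<and> x < U * r")
  case True
  define A where "A = (x + V * r) / (U + V)"
  define D where "D = (U * r - x) / (U + V)"
  define K where "K = exp (- a * A - b * D) / (U + V)"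
  have n0: "n > 0" using n by (cases n) auto
  have AD: "A - x / U = V / U * D" unfolding A_def D_def using pos by (intro time_up_minus)
  have D: "D \<ge> 0" using True pos by (simp add: D_def)
  have K: "K \<ge> 0" using pos by (simp add: K_def)
  have xr: "x / U \<le> r" using True pos by (simp add: field_simps)
  have "(\<integral>\<^sup>+u\<in>{0..r}. ennreal (dens n a b U V (r - u) (x - U * u) * exp (- a * u)) \<partial>lborel) =
    (\<integral>\<^sup>+u. ennreal (ballot (V / U) n (A - u) D * K) * indicator {0..x / U} u \<partial>lborel)"
  proof (intro nn_integral_cong_AE, use AE_lborel_singleton[of "x / U"] in eventually_elim)
    case (elim u)
    show ?case
    proof (cases "0 \<le> u \<and> u < x / U")
      case u: True
      then have "0 < x - U * u" "x - U * u < U * (r - u)"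
        using True pos by (simp_all add: pos_less_divide_eq mult.commute right_diff_distrib)
      then have "dens n a b U V (r - u) (x - U * u) =
          ballot (V / U) n ((x - U * u + V * (r - u)) / (U + V)) ((U * (r - u) - (x - U * u)) / (U + V)) *
     exp (- a * ((x - U * u + V * (r - u)) / (U + V)) - b * ((U * (r - u) - (x - U * u)) / (U + V))) / (U + V)"
        by (simp add: dens_def)
      also have "(x - U * u + V * (r - u)) / (U + V) = A - u"
        using pos by (simp add: A_def field_simps)
      also have "(U * (r - u) - (x - U * u)) / (U + V) = D"
        using pos by (simp add: D_def field_simps)
      finally have "dens n a b U V (r - u) (x - U * u) * exp (- a * u) = ballot (V / U) n (A - u) D * K"
        by (simp add: K_def exp_add[symmetric] algebra_simps)
      then show ?thesis using u xr by (auto simp: indicator_def)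
    next
      case False
      then have "dens n a b U V (r - u) (x - U * u) = 0" if "0 \<le> u"
        using that pos by (simp add: dens_def pos_divide_le_eq not_less mult.commute)
      then show ?thesis using False elim by (auto simp: indicator_def)
    qed
  qed
  also have "\<dots> = ennreal (- (ballot (V / U) (Suc n) (A - x / U) D * K) - (- (ballot (V / U) (Suc n) (A - 0) D * K)))"
  proof (rule nn_integral_FTC_Icc[where F = "\<lambda>u. - (ballot (V / U) (Suc n) (A - u) D * K)"])
    fix u assume u: "u \<in> {0..x / U}"
    have "((\<lambda>u. ballot (V / U) (Suc n) (A - u) D) has_real_derivative ballot (V / U) n (A - u) D * (- 1)) (at u)"
    proof (rule DERIV_chain2[OF ballot_deriv_up[OF n]])
      show "((\<lambda>u. A - u) has_real_derivative - 1) (at u)"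
        using DERIV_diff[OF DERIV_const DERIV_ident] by simp
    qed
    from DERIV_cmult[OF this, of "- K"]
    show "((\<lambda>u. - (ballot (V / U) (Suc n) (A - u) D * K)) has_real_derivative ballot (V / U) n (A - u) D * K) (at u)"
      by (simp add: mult.commute)
    have "V / U * D \<le> A - u" using u AD by auto
    then have "0 \<le> ballot (V / U) n (A - u) D"
      using D pos n0 by (intro ballot_nonneg) auto
    then show "0 \<le> ballot (V / U) n (A - u) D * K" using K by simp
  qed (use True pos in auto)
  also have "\<dots> = ennreal (dens (Suc n) a b U V r x)"
    using True unfolding AD ballot_diagonal[OF n] by (simp add: dens_def A_def D_def K_def)
  finally show ?thesis .
next
  case False
  have "dens n a b U V (r - u) (x - U * u) = 0" if "0 \<le> u" for u
  proof -
    have "0 \<le> U * u" using that pos by simp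
    then have "\<not> (0 < x - U * u \<and> x - U * u < U * (r - u))"
      using False unfolding right_diff_distrib by linarith
    then show ?thesis unfolding dens_def by (rule if_not_P)
  qed
  then have "(\<integral>\<^sup>+u\<in>{0..r}. ennreal (dens n a b U V (r - u) (x - U * u) * exp (- a * u)) \<partial>lborel) =
      (\<integral>\<^sup>+(u::real). 0 \<partial>lborel)"
    by (intro nn_integral_cong) (auto simp: indicator_def)
  then show ?thesis using False by (auto simp: dens_def)
qed

text \<open>Along \<open>(r - u, x + V * u)\<close> only \<open>D\<close> changes, until it is used
  up at \<open>u = D\<close>, where \<open>ballot_axis\<close> applies. A ray from a negative
  \<open>x\<close> would enter the cone, hence the indicator. At \<open>x = 0\<close> the integral
  need not vanish whereas \<open>dens\<close> does, hence the exclusion.\<close>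

lemma dens_step_down:
  assumes n: "even n" "n > 0" and pos: "U > 0" "V > 0" and x: "x \<noteq> 0"
  shows "(\<integral>\<^sup>+u\<in>{0..r}. ennreal (dens n a b U V (r - u) (x + V * u) * exp (- b * u)) \<partial>lborel) * indicator {0..} x =
    ennreal (dens (Suc n) a b U V r x)"
proof (cases "0 < x \<and> x < U * r")
  case True
  define A where "A = (x + V * r) / (U + V)"
  define D where "D = (U * r - x) / (U + V)"
  define K where "K = exp (- a * A - b * D) / (U + V)"
  have AD: "A = x / U + V / U * D" unfolding A_def D_def using time_up_minus[OF pos, of x r] by linarith
  have D: "D \<ge> 0" using True pos by (simp add: D_def)
  have K: "K \<ge> 0" using pos by (simp add: K_def)
  have r: "r > 0" using True pos by (meson less_trans zero_less_mult_pos)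
  have Dr: "D \<le> r" using True pos r mult_nonneg_nonneg[of V r] by (simp add: D_def field_simps)
  have "(\<integral>\<^sup>+u\<in>{0..r}. ennreal (dens n a b U V (r - u) (x + V * u) * exp (- b * u)) \<partial>lborel) =
    (\<integral>\<^sup>+u. ennreal (ballot (V / U) n A (D - u) * K) * indicator {0..D} u \<partial>lborel)"
  proof (intro nn_integral_cong_AE, use AE_lborel_singleton[of D] in eventually_elim)
    case (elim u)
    show ?case
    proof (cases "0 \<le> u \<and> u < D")
      case u: True
      then have "x + V * u < U * (r - u)" using pos by (simp add: D_def pos_less_divide_eq algebra_simps)
      then have "dens n a b U V (r - u) (x + V * u) =
          ballot (V / U) n ((x + V * u + V * (r - u)) / (U + V)) ((U * (r - u) - (x + V * u)) / (U + V)) *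
     exp (- a * ((x + V * u + V * (r - u)) / (U + V)) - b * ((U * (r - u) - (x + V * u)) / (U + V))) / (U + V)"
        using True u pos by (auto simp: dens_def add_pos_nonneg)
      also have "(x + V * u + V * (r - u)) / (U + V) = A"
        using pos by (simp add: A_def field_simps)
      also have "(U * (r - u) - (x + V * u)) / (U + V) = D - u"
        using pos by (simp add: D_def field_simps)
      finally have "dens n a b U V (r - u) (x + V * u) * exp (- b * u) = ballot (V / U) n A (D - u) * K"
        by (simp add: K_def exp_add[symmetric] algebra_simps)
      then show ?thesis using u Dr by (auto simp: indicator_def)
    next
      case False
      then have "dens n a b U V (r - u) (x + V * u) = 0" if "0 \<le> u"
        using that pos by (simp add: dens_def D_def pos_divide_le_eq not_less algebra_simps)
      then show ?thesis using False elim by (auto simp: indicator_def)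
    qed
  qed
  also have "\<dots> = ennreal (- (ballot (V / U) (Suc n) A (D - D) * K) - (- (ballot (V / U) (Suc n) A (D - 0) * K)))"
  proof (rule nn_integral_FTC_Icc[where F = "\<lambda>u. - (ballot (V / U) (Suc n) A (D - u) * K)"])
    fix u assume u: "u \<in> {0..D}"
    have "((\<lambda>u. ballot (V / U) (Suc n) A (D - u)) has_real_derivative ballot (V / U) n A (D - u) * (- 1)) (at u)"
    proof (rule DERIV_chain2[OF ballot_deriv_down[OF n]])
      show "((\<lambda>u. D - u) has_real_derivative - 1) (at u)"
        using DERIV_diff[OF DERIV_const DERIV_ident] by simp
    qed
    from DERIV_cmult[OF this, of "- K"]
    show "((\<lambda>u. - (ballot (V / U) (Suc n) A (D - u) * K)) has_real_derivative ballot (V / U) n A (D - u) * K) (at u)"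
      by (simp add: mult.commute)
    have "V / U * (D - u) \<le> V / U * D" using u pos by (intro mult_left_mono) auto
    then have "V / U * (D - u) \<le> A"
      using AD divide_pos_pos[of x U] True pos by linarith
    then have "0 \<le> ballot (V / U) n A (D - u)"
      using u pos n by (intro ballot_nonneg) auto
    then show "0 \<le> ballot (V / U) n A (D - u) * K" using K by simp
  qed (use D in auto)
  also have "\<dots> = ennreal (dens (Suc n) a b U V r x)"
    using True by (simp add: dens_def A_def D_def K_def ballot_axis[OF n])
  finally show ?thesis using True by simp
next
  case False
  have "dens n a b U V (r - u) (x + V * u) = 0" if "0 \<le> u" "x \<ge> 0" for u
  proof -
    have "U * r \<le> x" using that x False by auto
    moreover have "0 \<le> U * u" "0 \<le> V * u" using that pos by auto
    ultimately have "\<not> x + V * u < U * (r - u)" unfolding right_diff_distrib by linarith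
    then show ?thesis unfolding dens_def by (intro if_not_P) blast
  qed
  then have "(\<integral>\<^sup>+u\<in>{0..r}. ennreal (dens n a b U V (r - u) (x + V * u) * exp (- b * u)) \<partial>lborel) =
      (\<integral>\<^sup>+(u::real). 0 \<partial>lborel)" if "0 \<le> x"
    using that by (intro nn_integral_cong) (auto simp: indicator_def)
  then have "(\<integral>\<^sup>+u\<in>{0..r}. ennreal (dens n a b U V (r - u) (x + V * u) * exp (- b * u)) \<partial>lborel) * indicator {0..} x = 0"
    by (cases "0 \<le> x") auto
  then show ?thesis using False by (auto simp: dens_def)
qed

text \<open>Substituting the new end point for \<open>w\<close> and exchanging the integrals leaves
  the kernel computed in the two preceding lemmas; the position 0, where it may fail, is a null
  set.\<close>

lemma dens_step:
  assumes n: "n > 0" and pos: "U > 0" "V > 0" and [measurable]: "\<phi> \<in> borel_measurable borel"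
  shows "(\<integral>\<^sup>+u\<in>{0..r}. (\<integral>\<^sup>+w. ennreal (dens n a b U V (r - u) w) *
      (if 0 \<le> w + alt n (- V) U * u then ennreal (exp (- alt n b a * u)) * \<phi> (w + alt n (- V) U * u) else 0) \<partial>lborel) \<partial>lborel) =
    (\<integral>\<^sup>+x. ennreal (dens (Suc n) a b U V r x) * \<phi> x \<partial>lborel)"
proof -
  define v where "v = alt n (- V) U"
  define k where "k = alt n b a"
  have kernel: "(\<integral>\<^sup>+u\<in>{0..r}. ennreal (dens n a b U V (r - u) (x - v * u) * exp (- k * u)) \<partial>lborel) * indicator {0..} x =
      ennreal (dens (Suc n) a b U V r x)" if "x \<noteq> 0" for x
  proof (cases "odd n")
    case True
    then show ?thesis
      using dens_step_up[OF True pos, of a b r x] by (auto simp: v_def k_def alt_def indicator_def dens_def)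
  next
    case False
    then show ?thesis
      using dens_step_down[OF _ n pos that, of a b r] by (simp add: v_def k_def alt_def)
  qed
  have "(\<integral>\<^sup>+u\<in>{0..r}. (\<integral>\<^sup>+w. ennreal (dens n a b U V (r - u) w) *
      (if 0 \<le> w + v * u then ennreal (exp (- k * u)) * \<phi> (w + v * u) else 0) \<partial>lborel) \<partial>lborel) =
    (\<integral>\<^sup>+u\<in>{0..r}. (\<integral>\<^sup>+x. ennreal (dens n a b U V (r - u) (x - v * u)) *
      (if 0 \<le> x then ennreal (exp (- k * u)) * \<phi> x else 0) \<partial>lborel) \<partial>lborel)"
  proof (rule nn_integral_cong, rule arg_cong2[where f = "(*)", OF _ refl])
    fix u
    show "(\<integral>\<^sup>+w. ennreal (dens n a b U V (r - u) w) *
        (if 0 \<le> w + v * u then ennreal (exp (- k * u)) * \<phi> (w + v * u) else 0) \<partial>lborel) =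
      (\<integral>\<^sup>+x. ennreal (dens n a b U V (r - u) (x - v * u)) *
        (if 0 \<le> x then ennreal (exp (- k * u)) * \<phi> x else 0) \<partial>lborel)"
      by (subst nn_integral_real_affine[where c = 1 and t = "- v * u"]) (auto simp: add.commute cong: if_cong)
  qed
  also have "\<dots> = (\<integral>\<^sup>+u. (\<integral>\<^sup>+x. (ennreal (dens n a b U V (r - u) (x - v * u) * exp (- k * u)) * indicator {0..r} u) *
      indicator {0..} x * \<phi> x \<partial>lborel) \<partial>lborel)"
    by (subst nn_integral_multc[symmetric])
      (auto intro!: nn_integral_cong simp: indicator_def ennreal_mult' mult_ac)
  also have "\<dots> = (\<integral>\<^sup>+x. (\<integral>\<^sup>+u. (ennreal (dens n a b U V (r - u) (x - v * u) * exp (- k * u)) * indicator {0..r} u) *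
      indicator {0..} x * \<phi> x \<partial>lborel) \<partial>lborel)"
    by (rule lborel_pair.Fubini') (unfold split_beta', measurable)
  also have "\<dots> = (\<integral>\<^sup>+x. ennreal (dens (Suc n) a b U V r x) * \<phi> x \<partial>lborel)"
  proof (intro nn_integral_cong_AE, use AE_lborel_singleton[of 0] in eventually_elim)
    case (elim x)
    show ?case
      unfolding kernel[OF elim, symmetric] by (simp add: nn_integral_multc)
  qed
  finally show ?thesis unfolding v_def k_def .
qed

text \<open>The density recursion has to start at one switching, because without switching the
  position is the atom \<open>U * r\<close>. The length \<open>u\<close> of the descending segment
  determines \<open>x = U * r - (U + V) * u\<close>, and the Jacobian cancels the divisor in
  \<open>dens\<close>.\<close>

lemma dens_first:
  assumes pos: "U > 0" "V > 0" and [measurable]: "\<phi> \<in> borel_measurable borel"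
  shows "(\<integral>\<^sup>+u\<in>{0..r}. ennreal (exp (- a * (r - u))) *
      (if 0 \<le> U * (r - u) - V * u then ennreal (exp (- b * u)) * \<phi> (U * (r - u) - V * u) else 0) \<partial>lborel) =
    (\<integral>\<^sup>+x. ennreal (dens (Suc 0) a b U V r x) * \<phi> x \<partial>lborel)"
proof -
  have "(\<integral>\<^sup>+x. ennreal (dens (Suc 0) a b U V r x) * \<phi> x \<partial>lborel) =
    ennreal (U + V) * (\<integral>\<^sup>+u. ennreal (dens (Suc 0) a b U V r (U * r + - (U + V) * u)) * \<phi> (U * r + - (U + V) * u) \<partial>lborel)"
    using pos by (subst nn_integral_real_affine[where c = "- (U + V)" and t = "U * r"]) (auto simp: add.commute simp del: ennreal_plus)
  also have "\<dots> = (\<integral>\<^sup>+u. ennreal (U + V) * (ennreal (dens (Suc 0) a b U V r (U * r + - (U + V) * u)) * \<phi> (U * r + - (U + V) * u)) \<partial>lborel)"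
    by (rule nn_integral_cmult[symmetric]) measurable
  also have "\<dots> = (\<integral>\<^sup>+u\<in>{0..r}. ennreal (exp (- a * (r - u))) *
      (if 0 \<le> U * (r - u) - V * u then ennreal (exp (- b * u)) * \<phi> (U * (r - u) - V * u) else 0) \<partial>lborel)"
  proof (intro nn_integral_cong_AE, use AE_lborel_singleton[of 0] AE_lborel_singleton[of "U * r / (U + V)"] in eventually_elim)
    case (elim u)
    have x: "U * r + - (U + V) * u = U * (r - u) - V * u" by (simp add: algebra_simps)
    have ne: "U * (r - u) - V * u \<noteq> 0"
      using elim(2) pos by (auto simp: field_simps)
    show ?case
    proof (cases "0 \<le> u \<and> 0 \<le> U * (r - u) - V * u")
      case True
      then have u: "0 < u" "0 < U * (r - u) - V * u" using elim ne by auto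
      then have "0 < U * (r - u)" using pos by (smt (verit) mult_pos_pos)
      then have "u < r" using pos by (simp add: zero_less_mult_iff)
      have A: "(U * (r - u) - V * u + V * r) / (U + V) = r - u" and D: "(U * r - (U * (r - u) - V * u)) / (U + V) = u"
        using pos by (simp_all add: field_simps)
      have "U * (r - u) - V * u < U * r"
      proof -
        have "0 < U * u" "0 < V * u" using pos u by auto
        then show ?thesis unfolding right_diff_distrib by linarith
      qed
      then have "(U + V) * dens (Suc 0) a b U V r (U * (r - u) - V * u) = exp (- a * (r - u)) * exp (- b * u)"
        using u pos unfolding dens_def A D by (simp add: exp_add[symmetric])
      then have "ennreal (U + V) * ennreal (dens (Suc 0) a b U V r (U * (r - u) - V * u)) =
          ennreal (exp (- a * (r - u))) * ennreal (exp (- b * u))"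
        using pos by (simp add: ennreal_mult'[symmetric] del: ennreal_plus)
      then show ?thesis
        using True \<open>u < r\<close> unfolding x by (simp add: mult.assoc[symmetric])
    next
      case False
      have "dens (Suc 0) a b U V r (U * (r - u) - V * u) = 0"
      proof -
        have "\<not> U * (r - u) - V * u < U * r" if "\<not> 0 \<le> u"
        proof -
          have "U * u < 0" "V * u < 0" using pos that by (auto simp: mult_less_0_iff)
          then show ?thesis unfolding right_diff_distrib by linarith
        qed
        then have "\<not> (0 < U * (r - u) - V * u \<and> U * (r - u) - V * u < U * r)" using False by fastforce
        then show ?thesis unfolding dens_def by (intro if_not_P)
      qed
      then show ?thesis using False unfolding x by (auto simp: indicator_def)
    qed
  qed
  finally show ?thesis by simp
qed

text \<open>Kept apart from \<open>dens\<close> because time reversal exchanges the arguments of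
  \<open>dens\<close>, while every switching keeps the rate of the state that it leaves in forward
  time.\<close>

definition rates :: "nat \<Rightarrow> real \<Rightarrow> real \<Rightarrow> real" where
  "rates n a b = a ^ ((n + 1) div 2) * b ^ (n div 2)"

lemma rates_Suc_0 [simp]: "rates (Suc 0) a b = a"
  by (simp add: rates_def)

lemma rates_Suc: "rates (Suc n) a b = alt n a b * rates n a b"
  by (simp add: rates_def alt_def)

lemma rates_nonneg: "a > 0 \<Longrightarrow> b > 0 \<Longrightarrow> 0 \<le> rates n a b"
  by (simp add: rates_def)

lemma alt_pos: "a > 0 \<Longrightarrow> b > 0 \<Longrightarrow> alt n a b > (0::real)"
  by (simp add: alt_def)

lemma surv_density:
  assumes pos: "a > 0" "b > 0" "U > 0" "V > 0" and n: "n > 0" and \<phi>: "\<phi> \<in> borel_measurable borel"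
  shows "surv n a b U (- V) r 0 \<phi> = ennreal (rates n a b) * (\<integral>\<^sup>+x. ennreal (dens n a b U V r x) * \<phi> x \<partial>lborel)"
  using n \<phi>
proof (induction n arbitrary: r \<phi> rule: nat_induct_non_zero)
  case 1
  note [measurable] = 1
  have "surv (Suc 0) a b U (- V) r 0 \<phi> = (\<integral>\<^sup>+u\<in>{0..r}. surv 0 a b U (- V) (r - u) 0 (\<lambda>w.
       if 0 \<le> w + - V * u then ennreal (a * exp (- b * u)) * \<phi> (w + - V * u) else 0) \<partial>lborel)"
    using surv_forward[OF pos(1,2) 1, of 0 U "- V" r 0] by (simp cong: if_cong)
  also have "\<dots> = (\<integral>\<^sup>+u. ennreal a * (ennreal (exp (- a * (r - u))) *
      (if 0 \<le> U * (r - u) - V * u then ennreal (exp (- b * u)) * \<phi> (U * (r - u) - V * u) else 0) * indicator {0..r} u) \<partial>lborel)"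
    using pos by (intro nn_integral_cong) (auto simp: surv_0 indicator_def ennreal_mult' mult_ac)
  also have "\<dots> = ennreal a * (\<integral>\<^sup>+x. ennreal (dens (Suc 0) a b U V r x) * \<phi> x \<partial>lborel)"
    by (subst nn_integral_cmult) (measurable, simp only: dens_first[OF pos(3,4) 1])
  finally show ?case by simp
next
  case (Suc n)
  note [measurable] = Suc.prems
  have "surv (Suc n) a b U (- V) r 0 \<phi> = (\<integral>\<^sup>+u\<in>{0..r}. surv n a b U (- V) (r - u) 0 (\<lambda>w.
       if 0 \<le> w + alt n (- V) U * u then ennreal (alt n a b * exp (- alt n b a * u)) * \<phi> (w + alt n (- V) U * u) else 0) \<partial>lborel)"
    by (rule surv_forward) (use pos in auto)
  also have "\<dots> = (\<integral>\<^sup>+u. ennreal (alt n a b * rates n a b) * ((\<integral>\<^sup>+w. ennreal (dens n a b U V (r - u) w) *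
      (if 0 \<le> w + alt n (- V) U * u then ennreal (exp (- alt n b a * u)) * \<phi> (w + alt n (- V) U * u) else 0) \<partial>lborel) * indicator {0..r} u) \<partial>lborel)"
  proof (intro nn_integral_cong)
    fix u
    have "(\<integral>\<^sup>+w. ennreal (dens n a b U V (r - u) w) * (if 0 \<le> w + alt n (- V) U * u then
        ennreal (alt n a b * exp (- alt n b a * u)) * \<phi> (w + alt n (- V) U * u) else 0) \<partial>lborel) =
      (\<integral>\<^sup>+w. ennreal (alt n a b) * (ennreal (dens n a b U V (r - u) w) * (if 0 \<le> w + alt n (- V) U * u then
        ennreal (exp (- alt n b a * u)) * \<phi> (w + alt n (- V) U * u) else 0)) \<partial>lborel)"
      using alt_pos[OF pos(1,2), of n] by (intro nn_integral_cong) (auto simp: ennreal_mult' mult_ac)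
    also have "\<dots> = ennreal (alt n a b) * (\<integral>\<^sup>+w. ennreal (dens n a b U V (r - u) w) * (if 0 \<le> w + alt n (- V) U * u then
        ennreal (exp (- alt n b a * u)) * \<phi> (w + alt n (- V) U * u) else 0) \<partial>lborel)"
      by (rule nn_integral_cmult) measurable
    finally show "surv n a b U (- V) (r - u) 0 (\<lambda>w.
       if 0 \<le> w + alt n (- V) U * u then ennreal (alt n a b * exp (- alt n b a * u)) * \<phi> (w + alt n (- V) U * u) else 0) * indicator {0..r} u =
      ennreal (alt n a b * rates n a b) * ((\<integral>\<^sup>+w. ennreal (dens n a b U V (r - u) w) *
      (if 0 \<le> w + alt n (- V) U * u then ennreal (exp (- alt n b a * u)) * \<phi> (w + alt n (- V) U * u) else 0) \<partial>lborel) * indicator {0..r} u)"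
      using alt_pos[OF pos(1,2), of n] by (subst Suc.IH) (auto simp: ennreal_mult' mult_ac)
  qed
  also have "\<dots> = ennreal (alt n a b * rates n a b) * (\<integral>\<^sup>+x. ennreal (dens (Suc n) a b U V r x) * \<phi> x \<partial>lborel)"
    by (subst nn_integral_cmult) (measurable, simp only: dens_step[OF Suc.hyps pos(3,4) Suc.prems])
  finally show ?case by (simp add: rates_Suc)
qed

text \<open>
  Read backwards in time, a path that ends at its strict minimum is a path that stays below its
  starting point; so the densities reappear with the roles of the two velocities exchanged.
\<close>

lemma ending_density:
  assumes pos: "a > 0" "b > 0" "U > 0" "V > 0" and n: "n > 0" and \<phi>: "\<phi> \<in> borel_measurable borel" and r: "r > 0"
  shows "ending n (alt n b a) (alt n a b) (alt n (- V) U) (alt n U (- V)) r \<phi> =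
    ennreal (rates n a b) * (\<integral>\<^sup>+x. ennreal (dens n b a V U r x) * \<phi> (- x) \<partial>lborel)"
  using n \<phi> r
proof (induction n arbitrary: r \<phi> rule: nat_induct_non_zero)
  case 1
  note [measurable] = 1(1)
  \<comment> \<open>\<open>ending\<close> asks for an end strictly below the start,
    \<open>dens_first\<close> for a nonnegative position. The cut-off at 0 reconciles them at no
    cost, since \<open>dens\<close> vanishes for \<open>x \<le> 0\<close>.\<close>
  let ?\<phi> = "\<lambda>x. if 0 < x then \<phi> (- x) else 0"
  have "ending (Suc 0) a b U (- V) r \<phi> = (\<integral>\<^sup>+u\<in>{0..r}. ennreal (a * exp (- a * u)) *
       ending 0 b a (- V) U (r - u) (\<lambda>x. if U * u + x < 0 then \<phi> (U * u + x) else 0) \<partial>lborel)"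
    by (rule ending_Suc) (use 1 pos in auto)
  \<comment> \<open>\<open>dens_first\<close> is read in reversed time: the final descending
    segment, of length \<open>r - u\<close>, comes first and the initial ascending one, of length
    \<open>u\<close>, second. The factor \<open>a\<close> still belongs to the state left in forward
    time.\<close>
  also have "\<dots> = (\<integral>\<^sup>+u. ennreal a * (ennreal (exp (- b * (r - u))) *
      (if 0 \<le> V * (r - u) - U * u then ennreal (exp (- a * u)) * ?\<phi> (V * (r - u) - U * u) else 0) * indicator {0..r} u) \<partial>lborel)"
  proof (intro nn_integral_cong_AE, use AE_lborel_singleton[of r] in eventually_elim)
    case (elim u)
    show ?case
    proof (cases "u \<in> {0..r}")
      case True
      show ?thesis using True elim pos
        by (auto simp: ending_0 ennreal_mult' mult_ac)
    qed simp
  qed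
  also have "\<dots> = ennreal a * (\<integral>\<^sup>+x. ennreal (dens (Suc 0) b a V U r x) * ?\<phi> x \<partial>lborel)"
    by (subst nn_integral_cmult) (measurable, subst dens_first[OF pos(4,3)], auto)
  also have "(\<integral>\<^sup>+x. ennreal (dens (Suc 0) b a V U r x) * ?\<phi> x \<partial>lborel) = (\<integral>\<^sup>+x. ennreal (dens (Suc 0) b a V U r x) * \<phi> (- x) \<partial>lborel)"
    by (intro nn_integral_cong) (auto simp: dens_def)
  finally show ?case by simp
next
  case (Suc n)
  note [measurable] = Suc.prems(1)
  let ?\<phi> = "\<lambda>x. if 0 < x then \<phi> (- x) else 0"
  let ?k = "alt n a b" and ?v = "alt n (- U) V"
  have v: "alt n U (- V) = - ?v" by (simp add: alt_def)
  have k: "?k > 0" using pos by (simp add: alt_def)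
  have "ending (Suc n) ?k (alt n b a) (- ?v) (alt n (- V) U) r \<phi> = (\<integral>\<^sup>+u\<in>{0..r}. ennreal (?k * exp (- ?k * u)) *
       ending n (alt n b a) ?k (alt n (- V) U) (- ?v) (r - u) (\<lambda>x. if - ?v * u + x < 0 then \<phi> (- ?v * u + x) else 0) \<partial>lborel)"
    by (rule ending_Suc) (use Suc pos in \<open>auto simp: alt_def\<close>)
  also have "\<dots> = (\<integral>\<^sup>+u. ennreal (?k * rates n a b) * ((\<integral>\<^sup>+w. ennreal (dens n b a V U (r - u) w) *
      (if 0 \<le> w + ?v * u then ennreal (exp (- ?k * u)) * ?\<phi> (w + ?v * u) else 0) \<partial>lborel) * indicator {0..r} u) \<partial>lborel)"
  proof (intro nn_integral_cong_AE, use AE_lborel_singleton[of r] in eventually_elim)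
    case (elim u)
    show ?case
    proof (cases "u \<in> {0..r}")
      case True
      let ?I = "\<integral>\<^sup>+w. ennreal (dens n b a V U (r - u) w) * (if 0 < w + ?v * u then \<phi> (- (w + ?v * u)) else 0) \<partial>lborel"
      have "ending n (alt n b a) ?k (alt n (- V) U) (- ?v) (r - u) (\<lambda>x. if - ?v * u + x < 0 then \<phi> (- ?v * u + x) else 0) =
          ennreal (rates n a b) * ?I"
        unfolding v[symmetric]
        by (subst Suc.IH) (use True elim in \<open>auto simp: v algebra_simps intro!: nn_integral_cong arg_cong2[where f = "(*)"]\<close>)
      moreover have "(\<integral>\<^sup>+w. ennreal (dens n b a V U (r - u) w) *
          (if 0 \<le> w + ?v * u then ennreal (exp (- ?k * u)) * ?\<phi> (w + ?v * u) else 0) \<partial>lborel) =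
        (\<integral>\<^sup>+w. ennreal (exp (- ?k * u)) * (ennreal (dens n b a V U (r - u) w) * (if 0 < w + ?v * u then \<phi> (- (w + ?v * u)) else 0)) \<partial>lborel)"
        by (intro nn_integral_cong) (auto simp: mult_ac)
      moreover have "\<dots> = ennreal (exp (- ?k * u)) * ?I"
        by (rule nn_integral_cmult) measurable
      ultimately show ?thesis using True k by (simp add: ennreal_mult' mult_ac)
    qed simp
  qed
  also have "\<dots> = ennreal (?k * rates n a b) * (\<integral>\<^sup>+x. ennreal (dens (Suc n) b a V U r x) * ?\<phi> x \<partial>lborel)"
    by (subst nn_integral_cmult) (measurable, subst dens_step[OF Suc.hyps pos(4,3)], auto)
  also have "(\<integral>\<^sup>+x. ennreal (dens (Suc n) b a V U r x) * ?\<phi> x \<partial>lborel) = (\<integral>\<^sup>+x. ennreal (dens (Suc n) b a V U r x) * \<phi> (- x) \<partial>lborel)"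
    by (intro nn_integral_cong) (auto simp: dens_def)
  finally show ?case by (simp add: rates_Suc v)
qed

text \<open>The arguments are arranged so that the last segment ascends, and its end cannot be a
  minimum. Peeling from the front reduces this to the case without switching.\<close>

lemma ending_impossible:
  assumes pos: "a > 0" "b > 0" "U > 0" "V > 0" and \<phi>: "\<phi> \<in> borel_measurable borel" and r: "r > 0"
  shows "ending n (alt n a b) (alt n b a) (alt n U (- V)) (alt n (- V) U) r \<phi> = 0"
  using \<phi> r
proof (induction n arbitrary: r \<phi>)
  case 0
  then show ?case using pos by (simp add: ending_0)
next
  case (Suc n)
  note [measurable] = Suc.prems(1)
  have "ending (Suc n) (alt n b a) (alt n a b) (alt n (- V) U) (alt n U (- V)) r \<phi> = (\<integral>\<^sup>+u\<in>{0..r}. ennreal (alt n b a * exp (- alt n b a * u)) *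
       ending n (alt n a b) (alt n b a) (alt n U (- V)) (alt n (- V) U) (r - u)
         (\<lambda>x. if alt n (- V) U * u + x < 0 then \<phi> (alt n (- V) U * u + x) else 0) \<partial>lborel)"
    by (rule ending_Suc) (use Suc pos in \<open>auto simp: alt_def\<close>)
  also have "\<dots> = (\<integral>\<^sup>+(u::real). 0 \<partial>lborel)"
  proof (intro nn_integral_cong_AE, use AE_lborel_singleton[of r] in eventually_elim)
    case (elim u)
    then show ?case by (cases "u \<in> {0..r}") (auto simp: Suc.IH)
  qed
  finally show ?case by simp
qed

section \<open>No switching and one switching in an interval\<close>

text \<open>\<open>ln (1 - x)\<close> differs from \<open>- x\<close> by at most
  \<open>2 * x ^ 2\<close> for small \<open>x\<close>, and \<open>N m * x m ^ 2\<close> tends to 0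
  because \<open>N m * x m\<close> converges and \<open>x m\<close> tends to 0.\<close>

lemma tendsto_power_exp:
  fixes x :: "nat \<Rightarrow> real" and N :: "nat \<Rightarrow> nat"
  assumes N: "filterlim N at_top sequentially" and L: "(\<lambda>m. real (N m) * x m) \<longlonglongrightarrow> L"
  shows "(\<lambda>m. (1 - x m) ^ N m) \<longlonglongrightarrow> exp (- L)"
proof -
  have inv: "(\<lambda>m. inverse (real (N m))) \<longlonglongrightarrow> 0"
    by (rule tendsto_inverse_0_at_top) (rule filterlim_compose[OF filterlim_real_sequentially N])
  have "(\<lambda>m. real (N m) * x m * inverse (real (N m))) \<longlonglongrightarrow> L * 0"
    by (intro tendsto_mult L inv)
  moreover have "\<forall>\<^sub>F m in sequentially. real (N m) * x m * inverse (real (N m)) = x m"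
    using filterlim_at_top[THEN iffD1, OF N, THEN spec, of 1] by eventually_elim auto
  ultimately have x0: "x \<longlonglongrightarrow> 0"
    by (auto intro: Lim_transform_eventually)
  have small: "\<forall>\<^sub>F m in sequentially. \<bar>x m\<bar> < 1 / 2"
    using x0 by (auto simp: tendsto_iff dest!: spec[of _ "1 / 2"])
  have "(\<lambda>m. 2 * (real (N m) * x m) * x m) \<longlonglongrightarrow> 2 * L * 0"
    by (intro tendsto_mult tendsto_const L x0)
  then have err: "(\<lambda>m. \<bar>2 * (real (N m) * x m) * x m\<bar>) \<longlonglongrightarrow> 0"
    by (simp add: tendsto_rabs_zero)
  have "(\<lambda>m. real (N m) * ln (1 - x m) + real (N m) * x m) \<longlonglongrightarrow> 0"
  proof (rule tendsto_rabs_zero_cancel, rule tendsto_sandwich[OF _ _ tendsto_const err])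
    show "\<forall>\<^sub>F m in sequentially. \<bar>real (N m) * ln (1 - x m) + real (N m) * x m\<bar> \<le> \<bar>2 * (real (N m) * x m) * x m\<bar>"
      using small
    proof eventually_elim
      case (elim m)
      have "\<bar>real (N m) * ln (1 - x m) + real (N m) * x m\<bar> = real (N m) * \<bar>ln (1 + - x m) - (- x m)\<bar>"
        by (simp add: abs_mult distrib_left[symmetric])
      also have "\<dots> \<le> real (N m) * (2 * (- x m)\<^sup>2)"
        using elim by (intro mult_left_mono abs_ln_one_plus_x_minus_x_bound) auto
      also have "\<dots> = \<bar>2 * (real (N m) * x m) * x m\<bar>"
        by (simp add: power2_eq_square abs_mult)
      finally show ?case .
    qed
  qed auto
  from tendsto_diff[OF this L] have "(\<lambda>m. real (N m) * ln (1 - x m)) \<longlonglongrightarrow> - L"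
    by simp
  from tendsto_exp[OF this] show ?thesis
  proof (rule Lim_transform_eventually)
    show "\<forall>\<^sub>F m in sequentially. exp (real (N m) * ln (1 - x m)) = (1 - x m) ^ N m"
      using small by eventually_elim (simp add: exp_of_nat_mult)
  qed
qed

text \<open>The probability that exactly one switching, at rate a, occurs during a time h, when the rate after it is b.\<close>

definition one_jump :: "real \<Rightarrow> real \<Rightarrow> real \<Rightarrow> real" where
  "one_jump a b h = (if a = b then a * h * exp (- a * h) else a * (exp (- b * h) - exp (- a * h)) / (a - b))"

text \<open>The Chapman-Kolmogorov relation for one switching, which falls into the second part or
  into the first.\<close>

lemma one_jump_add: "one_jump a b (h + k) = exp (- a * h) * one_jump a b k + one_jump a b h * exp (- b * k)"
proof (cases "a = b")
  case True
  then show ?thesis by (simp add: one_jump_def exp_add[symmetric] algebra_simps)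
next
  case False
  have "exp (- b * (h + k)) - exp (- a * (h + k)) =
      exp (- a * h) * (exp (- b * k) - exp (- a * k)) + (exp (- b * h) - exp (- a * h)) * exp (- b * k)"
    by (simp add: algebra_simps exp_add[symmetric])
  then show ?thesis using False
    by (simp add: one_jump_def add_divide_distrib[symmetric] distrib_left[symmetric] mult.assoc mult.left_commute)
qed

lemma one_jump_0 [simp]: "one_jump a b 0 = 0"
  by (simp add: one_jump_def)

text \<open>The sum is the one over the mesh cells in \<open>prob_one_switch\<close>. This exact
  value spares a passage from Riemann sums to an integral.\<close>

lemma one_jump_sum:
  "one_jump a b (real k * d) = one_jump a b d * (\<Sum>l<k. exp (- a * (real l * d)) * exp (- b * (real (k - Suc l) * d)))"
proof (induction k)
  case (Suc k)
  have "one_jump a b (real (Suc k) * d) = one_jump a b (real k * d + d)"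
    by (simp add: algebra_simps)
  also have "\<dots> = exp (- a * (real k * d)) * one_jump a b d + one_jump a b (real k * d) * exp (- b * d)"
    by (rule one_jump_add)
  also have "\<dots> = one_jump a b d * (exp (- a * (real k * d)) +
      (\<Sum>l<k. exp (- a * (real l * d)) * exp (- b * (real (k - Suc l) * d))) * exp (- b * d))"
    unfolding Suc.IH by (simp only: algebra_simps)
  also have "(\<Sum>l<k. exp (- a * (real l * d)) * exp (- b * (real (k - Suc l) * d))) * exp (- b * d) =
      (\<Sum>l<k. exp (- a * (real l * d)) * exp (- b * (real (Suc k - Suc l) * d)))"
  proof (subst sum_distrib_right, rule sum.cong[OF refl])
    fix l assume "l \<in> {..<k}"
    then have "k - l = Suc (k - Suc l)" by auto
    then show "exp (- a * (real l * d)) * exp (- b * (real (k - Suc l) * d)) * exp (- b * d) =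
        exp (- a * (real l * d)) * exp (- b * (real (Suc k - Suc l) * d))"
      by (simp add: exp_add[symmetric] algebra_simps)
  qed
  finally show ?case by (simp add: add.commute)
qed simp

lemma one_jump_deriv: "(one_jump a b has_real_derivative a * exp (- a * h) - b * one_jump a b h) (at h)"
proof (cases "a = b")
  case True
  then show ?thesis unfolding one_jump_def[abs_def]
    by (auto intro!: derivative_eq_intros simp: algebra_simps)
next
  case False
  have "((\<lambda>h. a * (exp (- b * h) - exp (- a * h)) / (a - b)) has_real_derivative
      a * (a * exp (- a * h) - b * exp (- b * h)) / (a - b)) (at h)"
    using False by (auto intro!: derivative_eq_intros simp: divide_simps)
  moreover have "a * x - b * (a * (y - x) / (a - b)) = a * (a * x - b * y) / (a - b)" for x y
    using False by (simp add: field_simps)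
  ultimately show ?thesis unfolding one_jump_def[abs_def] using False by simp
qed

lemma one_jump_rate: "((\<lambda>h. one_jump a b h / h) \<longlongrightarrow> a) (at_right 0)"
proof -
  have "((\<lambda>h. (one_jump a b (0 + h) - one_jump a b 0) / h) \<longlongrightarrow> a) (at 0)"
    using one_jump_deriv[of a b 0] by (simp add: DERIV_def)
  then show ?thesis by (auto intro: tendsto_mono[OF at_le])
qed

lemma one_jump_pos: "a > 0 \<Longrightarrow> h > 0 \<Longrightarrow> one_jump a b h > 0"
  by (cases a b rule: linorder_cases) (auto simp: one_jump_def zero_less_mult_iff zero_less_divide_iff divide_neg_neg mult_neg_neg mult_pos_neg)

lemma nn_integral_one_jump:
  assumes "a > 0" "h \<ge> 0"
  shows "(\<integral>\<^sup>+u\<in>{0..h}. ennreal (a * exp (- a * u)) * ennreal (exp (- b * (h - u))) \<partial>lborel) = ennreal (one_jump a b h)"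
proof -
  have "(\<integral>\<^sup>+u\<in>{0..h}. ennreal (a * exp (- a * u)) * ennreal (exp (- b * (h - u))) \<partial>lborel) =
      (\<integral>\<^sup>+u. ennreal (a * exp (- a * u) * exp (- b * (h - u))) * indicator {0..h} u \<partial>lborel)"
    using assms by (intro nn_integral_cong) (auto simp: ennreal_mult' ennreal_mult'')
  also have "\<dots> = ennreal (one_jump a b h * exp (- b * (h - h)) - one_jump a b 0 * exp (- b * (h - 0)))"
  \<comment> \<open>In the derivative of the product, the loss term
    \<open>- b * one_jump a b u\<close> from \<open>one_jump_deriv\<close> cancels against the
    derivative of the second factor.\<close>
  proof (rule nn_integral_FTC_Icc[where F = "\<lambda>u. one_jump a b u * exp (- b * (h - u))"])
    show "((\<lambda>u. one_jump a b u * exp (- b * (h - u))) has_real_derivative a * exp (- a * u) * exp (- b * (h - u))) (at u)" for u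
      by (auto intro!: derivative_eq_intros one_jump_deriv simp: algebra_simps)
  qed (use assms in auto)
  finally show ?thesis by simp
qed

section \<open>The Markov process on dyadic grids\<close>

locale switching = two_state_markov +
  assumes lam0: "lam 0 > 0" and lam1: "lam 1 > 0"
begin

lemma lam_pos: "j \<in> {0, 1} \<Longrightarrow> lam j > 0"
  using lam0 lam1 by auto

definition trans :: "real \<Rightarrow> nat \<Rightarrow> nat \<Rightarrow> real" where
  "trans = (SOME p.
        (\<forall>h\<ge>0. \<forall>i\<in>{0, 1}. (\<forall>j\<in>{0, 1}. 0 \<le> p h i j) \<and> p h i 0 + p h i 1 = 1) \<and>
        (\<forall>s\<ge>0. \<forall>h\<ge>0. \<forall>A\<in>past M eps s. \<forall>i\<in>{0, 1}. \<forall>j\<in>{0, 1}.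
           prob (A \<inter> {\<omega> \<in> space M. eps s \<omega> = i \<and> eps (s + h) \<omega> = j}) =
           prob (A \<inter> {\<omega> \<in> space M. eps s \<omega> = i}) * p h i j) \<and>
        (\<forall>i\<in>{0, 1}. ((\<lambda>h. p h i (1 - i) / h) \<longlongrightarrow> lam i) (at_right 0)))"

lemmas trans_props = someI_ex[OF markov, folded trans_def]

lemma trans_sum: "h \<ge> 0 \<Longrightarrow> i \<in> {0, 1} \<Longrightarrow> trans h i i = 1 - trans h i (1 - i)"
  using trans_props by fastforce

lemma trans_markov:
  assumes "s \<ge> 0" "h \<ge> 0" "A \<in> past M eps s" "i \<in> {0, 1}" "j \<in> {0, 1}"
  shows "prob (A \<inter> {\<omega> \<in> space M. eps s \<omega> = i \<and> eps (s + h) \<omega> = j}) =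
           prob (A \<inter> {\<omega> \<in> space M. eps s \<omega> = i}) * trans h i j"
  using trans_props assms by blast

lemma trans_rate: "i \<in> {0, 1} \<Longrightarrow> ((\<lambda>h. trans h i (1 - i) / h) \<longlongrightarrow> lam i) (at_right 0)"
  using trans_props by blast

lemma past_algebra: "sigma_algebra (space M) (past M eps s)"
  unfolding past_def by (rule sigma_algebra_sigma_sets) auto

lemma past_basic: "0 \<le> r \<Longrightarrow> r \<le> s \<Longrightarrow> {\<omega> \<in> space M. eps r \<omega> = j} \<in> past M eps s"
  unfolding past_def by (rule sigma_sets.Basic) auto

lemma past_mono: "s \<le> t \<Longrightarrow> A \<in> past M eps s \<Longrightarrow> A \<in> past M eps t"
  unfolding past_def by (erule rev_subsetD, rule sigma_sets_mono') fastforce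

lemma past_events: "A \<in> past M eps s \<Longrightarrow> A \<in> events"
  unfolding past_def
proof (erule rev_subsetD, rule sets.sigma_sets_subset, safe)
  fix r j assume "0 \<le> (r::real)"
  from measurable_sets[OF measurable_eps[OF this], of "{j}"]
  show "{\<omega> \<in> space M. eps r \<omega> = j} \<in> events"
    by (simp add: vimage_def Int_def conj_commute)
qed

lemma past_Int: "A \<in> past M eps s \<Longrightarrow> B \<in> past M eps s \<Longrightarrow> A \<inter> B \<in> past M eps s"
proof -
  interpret P: sigma_algebra "space M" "past M eps s" by (rule past_algebra)
  show "A \<in> past M eps s \<Longrightarrow> B \<in> past M eps s \<Longrightarrow> A \<inter> B \<in> past M eps s" by blast
qed

definition hold :: "real \<Rightarrow> real \<Rightarrow> nat \<Rightarrow> 'a set" where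
  "hold s c j = {\<omega> \<in> space M. \<forall>r\<in>{s..c}. eps r \<omega> = j}"

definition hold_grid :: "real \<Rightarrow> real \<Rightarrow> nat \<Rightarrow> nat \<Rightarrow> 'a set" where
  "hold_grid s d k j = {\<omega> \<in> space M. \<forall>i\<le>k. eps (s + real i * d) \<omega> = j}"

lemma hold_grid_Suc:
  "hold_grid s d (Suc k) j = hold_grid s d k j \<inter> {\<omega> \<in> space M. eps (s + real k * d) \<omega> = j \<and> eps (s + real k * d + d) \<omega> = j}"
  by (auto simp: hold_grid_def le_Suc_eq algebra_simps)

lemma hold_grid_past:
  assumes "s \<ge> 0" "d \<ge> 0"
  shows "hold_grid s d k j \<in> past M eps (s + real k * d)"
proof (induction k)
  case 0
  then show ?case using assms past_basic[of s s j] by (simp add: hold_grid_def)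
next
  case (Suc k)
  have eq: "hold_grid s d (Suc k) j = hold_grid s d k j \<inter> {\<omega> \<in> space M. eps (s + real (Suc k) * d) \<omega> = j}"
    by (auto simp: hold_grid_def le_Suc_eq)
  show ?case unfolding eq
    using assms Suc by (intro past_Int past_mono[OF _ Suc] past_basic) (auto simp: algebra_simps)
qed

text \<open>An arbitrary past event \<open>A\<close> is carried along here and in all later
  formulas, because restarts condition on what has happened before.\<close>

lemma prob_hold_grid:
  assumes "s \<ge> 0" "d \<ge> 0" "A \<in> past M eps s" "j \<in> {0, 1}"
  shows "prob (A \<inter> hold_grid s d k j) = prob (A \<inter> {\<omega> \<in> space M. eps s \<omega> = j}) * trans d j j ^ k"
proof (induction k)
  case 0
  then show ?case by (simp add: hold_grid_def)
next
  case (Suc k)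
  have "A \<inter> hold_grid s d k j \<in> past M eps (s + real k * d)"
    using assms by (intro past_Int past_mono[OF _ assms(3)] hold_grid_past) auto
  from trans_markov[OF _ assms(2) this assms(4) assms(4)]
  have "prob (A \<inter> hold_grid s d (Suc k) j) =
      prob (A \<inter> hold_grid s d k j \<inter> {\<omega> \<in> space M. eps (s + real k * d) \<omega> = j}) * trans d j j"
    using assms by (simp add: hold_grid_Suc Int_assoc)
  also have "A \<inter> hold_grid s d k j \<inter> {\<omega> \<in> space M. eps (s + real k * d) \<omega> = j} = A \<inter> hold_grid s d k j"
    by (auto simp: hold_grid_def)
  finally show ?case using Suc by simp
qed

text \<open>By right continuity, a state other than \<open>j\<close> at a time before
  \<open>c\<close> persists up to a point of some fine enough dyadic grid; the end point
  \<open>c\<close> belongs to every grid.\<close>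

lemma hold_eq_grid:
  assumes "0 \<le> s" "s \<le> c"
  shows "hold s c j = (\<Inter>m. hold_grid s ((c - s) / 2 ^ m) (2 ^ m) j)"
proof (intro equalityI subsetI)
  fix \<omega> assume w: "\<omega> \<in> hold s c j"
  show "\<omega> \<in> (\<Inter>m. hold_grid s ((c - s) / 2 ^ m) (2 ^ m) j)"
  proof
    fix m :: nat
    have "s + real i * ((c - s) / 2 ^ m) \<in> {s..c}" if "i \<le> 2 ^ m" for i
    proof -
      have "real i \<le> 2 ^ m" using that by (metis of_nat_le_iff of_nat_numeral of_nat_power)
      then have "real i * (c - s) \<le> 2 ^ m * (c - s)" using assms by (intro mult_right_mono) auto
      then have "real i * ((c - s) / 2 ^ m) \<le> c - s" by (simp add: pos_divide_le_eq mult.commute)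
      moreover have "0 \<le> real i * ((c - s) / 2 ^ m)" using assms by simp
      ultimately show ?thesis by auto
    qed
    then show "\<omega> \<in> hold_grid s ((c - s) / 2 ^ m) (2 ^ m) j"
      using w by (auto simp: hold_def hold_grid_def)
  qed
next
  fix \<omega> assume w: "\<omega> \<in> (\<Inter>m. hold_grid s ((c - s) / 2 ^ m) (2 ^ m) j)"
  then have sp: "\<omega> \<in> space M" and g: "\<And>m i. i \<le> 2 ^ m \<Longrightarrow> eps (s + real i * ((c - s) / 2 ^ m)) \<omega> = j"
    by (auto simp: hold_grid_def)
  have "eps r \<omega> = j" if r: "r \<in> {s..c}" for r
  proof (rule ccontr)
    assume ne: "eps r \<omega> \<noteq> j"
    have "r \<noteq> c" using g[of 1 0] ne by auto
    then have rc: "r < c" using r by auto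
    obtain \<delta> where \<delta>: "\<delta> > r" "\<And>x. r < x \<Longrightarrow> x < \<delta> \<Longrightarrow> eps x \<omega> = eps r \<omega>"
      using right_continuous[of r \<omega>] sp r assms by (auto simp: eventually_at_right_field)
    obtain m where m: "(1 / 2) ^ m < min (\<delta> - r) (c - r) / (c - s)"
      using real_arch_pow_inv[of "min (\<delta> - r) (c - r) / (c - s)" "1 / 2"] \<delta> rc r by auto
    define d where "d = (c - s) / 2 ^ m"
    have d: "d > 0" "d < \<delta> - r" "d < c - r"
    proof -
      have "(1 / 2) ^ m * (c - s) < min (\<delta> - r) (c - r)"
        using m rc r by (simp add: pos_less_divide_eq)
      then have "d < min (\<delta> - r) (c - r)" by (simp add: d_def power_divide)
      then show "d < \<delta> - r" "d < c - r" by auto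
    qed (use rc r in \<open>simp add: d_def\<close>)
    \<comment> \<open>The first grid point strictly after \<open>r\<close>; the mesh has been chosen
      so small that it still lies before \<open>\<delta>\<close> and before
      \<open>c\<close>.\<close>
    define i where "i = nat \<lfloor>(r - s) / d\<rfloor> + 1"
    have "0 \<le> (r - s) / d" using r d by simp
    then have i: "real i - 1 \<le> (r - s) / d" "(r - s) / d < real i"
      unfolding i_def by linarith+
    then have "r < s + real i * d" "s + real i * d \<le> r + d"
      using d by (auto simp: field_simps)
    moreover have "i \<le> 2 ^ m"
    proof -
      have "s + real i * d < c" using calculation d by simp
      then have "real i * d < 2 ^ m * d" by (simp add: d_def)
      then have "real i < 2 ^ m" using d by simp
      then show ?thesis by (metis less_imp_le of_nat_less_numeral_power_cancel_iff)
    qed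
    ultimately show False using \<delta>(2)[of "s + real i * d"] g[of i m] d ne by (simp add: d_def)
  qed
  then show "\<omega> \<in> hold s c j" using sp by (auto simp: hold_def)
qed

lemma hold_past:
  assumes "0 \<le> s" "s \<le> c"
  shows "hold s c j \<in> past M eps c"
proof -
  interpret P: sigma_algebra "space M" "past M eps c" by (rule past_algebra)
  show ?thesis unfolding hold_eq_grid[OF assms]
    using hold_grid_past[of s "(c - s) / 2 ^ m" "2 ^ m" j for m] assms
    by (intro P.countable_INT) auto
qed

lemma hold_grid_antimono:
  "hold_grid s (h / 2 ^ Suc m) (2 ^ Suc m) j \<subseteq> hold_grid s (h / 2 ^ m) (2 ^ m) j"
proof
  fix \<omega> assume w: "\<omega> \<in> hold_grid s (h / 2 ^ Suc m) (2 ^ Suc m) j"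
  have "eps (s + real i * (h / 2 ^ m)) \<omega> = j" if "i \<le> 2 ^ m" for i
  proof -
    have "\<forall>i\<le>2 ^ Suc m. eps (s + real i * (h / 2 ^ Suc m)) \<omega> = j"
      using w unfolding hold_grid_def by blast
    moreover have "2 * i \<le> 2 ^ Suc m" using that by simp
    ultimately have "eps (s + real (2 * i) * (h / 2 ^ Suc m)) \<omega> = j" by blast
    moreover have "real (2 * i) * (h / 2 ^ Suc m) = real i * (h / 2 ^ m)" by simp
    ultimately show ?thesis by metis
  qed
  then show "\<omega> \<in> hold_grid s (h / 2 ^ m) (2 ^ m) j" using w by (auto simp: hold_grid_def)
qed

lemma dyadic_at_right: "h > 0 \<Longrightarrow> filterlim (\<lambda>m. h / 2 ^ m) (at_right (0::real)) sequentially"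
  by real_asymp

text \<open>The grid events decrease to \<open>hold s c j\<close>, and their probabilities contain
  \<open>(1 - x) ^ 2 ^ m\<close> with \<open>2 ^ m * x\<close> tending to
  \<open>lam j * h\<close>.\<close>

lemma prob_hold:
  assumes "0 \<le> s" "s \<le> c" "A \<in> past M eps s" and j: "j \<in> {0, 1}"
  shows "prob (A \<inter> hold s c j) = prob (A \<inter> {\<omega> \<in> space M. eps s \<omega> = j}) * exp (- lam j * (c - s))"
proof (cases "s = c")
  case True
  then show ?thesis by (simp add: hold_def)
next
  case False
  define h where "h = c - s"
  have h: "h > 0" using False assms by (simp add: h_def)
  let ?G = "\<lambda>m. A \<inter> hold_grid s (h / 2 ^ m) (2 ^ m) j"
  have "(\<lambda>m. prob (?G m)) \<longlonglongrightarrow> prob (\<Inter>m. ?G m)"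
  proof (rule finite_Lim_measure_decseq)
    show "range ?G \<subseteq> events"
      using h assms by (auto intro!: past_events[OF past_Int[OF past_mono[OF _ assms(3)] hold_grid_past]])
    show "decseq ?G"
    proof (rule decseq_SucI)
      show "?G (Suc m) \<le> ?G m" for m using hold_grid_antimono[of s h m j] by blast
    qed
  qed
  also have "(\<Inter>m. ?G m) = A \<inter> hold s c j"
    unfolding hold_eq_grid[OF assms(1,2)] h_def by auto
  finally have "(\<lambda>m. prob (?G m)) \<longlonglongrightarrow> prob (A \<inter> hold s c j)" .
  moreover have "(\<lambda>m. prob (?G m)) \<longlonglongrightarrow> prob (A \<inter> {\<omega> \<in> space M. eps s \<omega> = j}) * exp (- lam j * h)"
  proof -
    have "(\<lambda>m. real (2 ^ m) * trans (h / 2 ^ m) j (1 - j)) \<longlonglongrightarrow> lam j * h"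
    proof -
      have "(\<lambda>m. trans (h / 2 ^ m) j (1 - j) / (h / 2 ^ m)) \<longlonglongrightarrow> lam j"
        by (rule filterlim_compose[OF trans_rate[OF j] dyadic_at_right[OF h]])
      from tendsto_mult[OF this tendsto_const[of h]] show ?thesis using h by (simp add: mult.commute)
    qed
    then have "(\<lambda>m. (1 - trans (h / 2 ^ m) j (1 - j)) ^ 2 ^ m) \<longlonglongrightarrow> exp (- (lam j * h))"
      by (intro tendsto_power_exp) (auto intro!: filterlim_at_top_mono[OF filterlim_ident] always_eventually less_imp_le)
    moreover have "prob (?G m) = prob (A \<inter> {\<omega> \<in> space M. eps s \<omega> = j}) * (1 - trans (h / 2 ^ m) j (1 - j)) ^ 2 ^ m" for m
      using h assms trans_sum[of "h / 2 ^ m" j] by (simp add: prob_hold_grid)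
    ultimately show ?thesis by (auto intro!: tendsto_intros)
  qed
  ultimately show ?thesis unfolding h_def by (rule LIMSEQ_unique)
qed

section \<open>Exactly one switching in an interval\<close>

definition one_switch :: "real \<Rightarrow> real \<Rightarrow> nat \<Rightarrow> 'a set" where
  "one_switch s c j = {\<omega> \<in> space M. \<exists>u. s < u \<and> u \<le> c \<and>
     (\<forall>r\<in>{s..<u}. eps r \<omega> = j) \<and> (\<forall>r\<in>{u..c}. eps r \<omega> = 1 - j)}"

text \<open>Nothing is required inside the mesh interval, so several switchings there are still
  allowed; they disappear in the intersection over all meshes. Leaving this gap open makes the
  probability computable from the Markov property at the two grid points.\<close>

definition cell :: "real \<Rightarrow> real \<Rightarrow> nat \<Rightarrow> nat \<Rightarrow> nat \<Rightarrow> 'a set" where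
  "cell s c j m l = hold s (s + real l * ((c - s) / 2 ^ m)) j \<inter> hold (s + real (Suc l) * ((c - s) / 2 ^ m)) c (1 - j)"

lemma grid_point:
  assumes "s \<le> c" "l \<le> 2 ^ m"
  shows "s + real l * ((c - s) / 2 ^ m) \<le> c" "c - (s + real l * ((c - s) / 2 ^ m)) = real (2 ^ m - l) * ((c - s) / 2 ^ m)"
proof -
  have "real (2 ^ m - l) * ((c - s) / 2 ^ m) = (2 ^ m - real l) * ((c - s) / 2 ^ m)"
    using assms by (simp add: of_nat_diff)
  also have "\<dots> = c - (s + real l * ((c - s) / 2 ^ m))"
  proof -
    have "2 ^ m * ((c - s) / 2 ^ m) = c - s" by simp
    then show ?thesis unfolding left_diff_distrib by linarith
  qed
  finally show eq: "c - (s + real l * ((c - s) / 2 ^ m)) = real (2 ^ m - l) * ((c - s) / 2 ^ m)" ..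
  have "0 \<le> real (2 ^ m - l) * ((c - s) / 2 ^ m)" using assms by simp
  then show "s + real l * ((c - s) / 2 ^ m) \<le> c" unfolding eq[symmetric] by simp
qed

lemma cell_past:
  assumes "0 \<le> s" "s \<le> c" "l < 2 ^ m"
  shows "cell s c j m l \<in> past M eps c"
  unfolding cell_def using assms grid_point(1)[of s c l m] grid_point(1)[of s c "Suc l" m]
  by (intro past_Int past_mono[OF _ hold_past] hold_past) auto

text \<open>Three factors from three uses of the Markov property: state \<open>j\<close> is held up
  to the left grid point, the mesh interval is crossed by one transition, and state
  \<open>1 - j\<close> is held from the right grid point on.\<close>

lemma prob_cell:
  assumes "0 \<le> s" "s < c" "l < 2 ^ m" "A \<in> past M eps s" and j: "j \<in> {0, 1}"
  defines "d \<equiv> (c - s) / 2 ^ m"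
  shows "prob (A \<inter> cell s c j m l) = prob (A \<inter> {\<omega> \<in> space M. eps s \<omega> = j}) * trans d j (1 - j) *
    (exp (- lam j * (real l * d)) * exp (- lam (1 - j) * (real (2 ^ m - Suc l) * d)))"
proof -
  have d: "d > 0" using assms by (simp add: d_def)
  define g where "g l = s + real l * d" for l
  have g: "s \<le> g l" "g (Suc l) = g l + d" using d by (simp_all add: g_def algebra_simps)
  have c: "g (Suc l) \<le> c" "c - g (Suc l) = real (2 ^ m - Suc l) * d"
    using grid_point[of s c "Suc l" m] assms unfolding g_def d_def by auto
  have j': "1 - j \<in> {0, 1}" using j by auto
  define B where "B = A \<inter> hold s (g l) j"
  have B: "B \<in> past M eps (g l)"
    unfolding B_def using assms g by (intro past_Int past_mono[OF g(1)] hold_past) auto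
  have Bj: "B = B \<inter> {\<omega> \<in> space M. eps (g l) \<omega> = j}"
    using g by (auto simp: B_def hold_def)
  define C where "C = B \<inter> {\<omega> \<in> space M. eps (g l) \<omega> = j \<and> eps (g (Suc l)) \<omega> = 1 - j}"
  have C: "C = B \<inter> {\<omega> \<in> space M. eps (g (Suc l)) \<omega> = 1 - j}"
    using Bj by (auto simp: C_def)
  have Cp: "C \<in> past M eps (g (Suc l))"
    unfolding C using assms g d by (intro past_Int past_mono[OF _ B] past_basic) auto
  have "A \<inter> cell s c j m l = C \<inter> hold (g (Suc l)) c (1 - j)"
    using c unfolding C B_def cell_def g_def d_def by (auto simp: hold_def)
  moreover have "0 \<le> g (Suc l)" using assms g d by simp
  ultimately have "prob (A \<inter> cell s c j m l) = prob (C \<inter> {\<omega> \<in> space M. eps (g (Suc l)) \<omega> = 1 - j}) * exp (- lam (1 - j) * (c - g (Suc l)))"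
    using prob_hold[OF _ c(1) Cp j'] by metis
  also have "C \<inter> {\<omega> \<in> space M. eps (g (Suc l)) \<omega> = 1 - j} = C" by (auto simp: C)
  also have "prob C = prob (B \<inter> {\<omega> \<in> space M. eps (g l) \<omega> = j}) * trans d j (1 - j)"
    unfolding C_def g(2) using assms(1) g d by (intro trans_markov[OF _ _ B j j']) auto
  also have "prob (B \<inter> {\<omega> \<in> space M. eps (g l) \<omega> = j}) = prob (A \<inter> {\<omega> \<in> space M. eps s \<omega> = j}) * exp (- lam j * (g l - s))"
    unfolding Bj[symmetric] unfolding B_def using assms g by (intro prob_hold) auto
  also have "g l - s = real l * d" by (simp add: g_def)
  also note c(2)
  finally show ?thesis by (simp add: mult_ac)
qed

lemma disjoint_cells: assumes "s \<le> c" "j \<in> {0, 1}" shows "disjoint_family_on (cell s c j m) {..<2 ^ m}"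
proof -
  have *: "cell s c j m l \<inter> cell s c j m l' = {}" if "l < l'" "l' < 2 ^ m" for l l'
  proof -
    let ?g = "\<lambda>l. s + real l * ((c - s) / 2 ^ m)"
    have "real (Suc l) * ((c - s) / 2 ^ m) \<le> real l' * ((c - s) / 2 ^ m)"
      using that assms by (intro mult_right_mono) auto
    then have "?g (Suc l) \<in> {s..?g l'}" "?g (Suc l) \<in> {?g (Suc l)..c}"
      using assms grid_point(1)[of s c "Suc l" m] that by auto
    then have "eps (?g (Suc l)) \<omega> = j" "eps (?g (Suc l)) \<omega> = 1 - j" if "\<omega> \<in> cell s c j m l \<inter> cell s c j m l'" for \<omega>
      using that unfolding cell_def hold_def by blast+
    then show ?thesis using assms by fastforce
  qed
  show ?thesis unfolding disjoint_family_on_def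
    using * by (metis Int_commute lessThan_iff linorder_neqE_nat)
qed

text \<open>Cell \<open>l\<close> of the finer mesh is contained in cell \<open>l div 2\<close> of
  the coarser one.\<close>

lemma cells_antimono: assumes "s \<le> c" shows "(\<Union>l<2 ^ Suc m. cell s c j (Suc m) l) \<subseteq> (\<Union>l<2 ^ m. cell s c j m l)"
proof
  fix \<omega> assume "\<omega> \<in> (\<Union>l<2 ^ Suc m. cell s c j (Suc m) l)"
  then obtain l where l: "l < 2 ^ Suc m" "\<omega> \<in> cell s c j (Suc m) l" by auto
  let ?d = "(c - s) / 2 ^ Suc m"
  have "(c - s) / 2 ^ m = 2 * ?d" by (simp add: field_simps)
  then have e: "real k * ((c - s) / 2 ^ m) = real (2 * k) * ?d" for k
    by (simp only: of_nat_mult of_nat_numeral mult_ac)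
  have d: "0 \<le> ?d" using assms by simp
  have "real (2 * (l div 2)) * ?d \<le> real l * ?d" "real (Suc l) * ?d \<le> real (2 * Suc (l div 2)) * ?d"
    using d by (intro mult_right_mono; simp only: of_nat_le_iff; simp)+
  then have "\<omega> \<in> cell s c j m (l div 2)"
    using l(2) unfolding cell_def hold_def e by auto
  then show "\<omega> \<in> (\<Union>l<2 ^ m. cell s c j m l)" using l by auto
qed

text \<open>A path that lies in a cell of every mesh has its switching squeezed between the left and
  the right grid points, whose distance tends to 0; the common limit is the switching time.\<close>

lemma one_switch_eq_cells:
  assumes "0 \<le> s" "s < c" and j: "j \<in> {0, 1}"
  shows "one_switch s c j = (\<Inter>m. \<Union>l<2 ^ m. cell s c j m l)"
proof (intro equalityI subsetI INT_I)
  fix \<omega> m assume w: "\<omega> \<in> one_switch s c j"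
  then obtain u where u: "s < u" "u \<le> c" "\<And>r. s \<le> r \<Longrightarrow> r < u \<Longrightarrow> eps r \<omega> = j" "\<And>r. u \<le> r \<Longrightarrow> r \<le> c \<Longrightarrow> eps r \<omega> = 1 - j"
    by (auto simp: one_switch_def)
  define d where "d = (c - s) / 2 ^ m"
  have d: "d > 0" using assms by (simp add: d_def)
  \<comment> \<open>Mesh intervals are open on the left and closed on the right: this
    \<open>l\<close> satisfies \<open>s + l * d < u \<le> s + (l + 1) * d\<close>, also if
    \<open>u\<close> is a grid point.\<close>
  define l where "l = nat (\<lceil>(u - s) / d\<rceil> - 1)"
  have "(u - s) / d > 0" using u d by simp
  then have l: "real l < (u - s) / d" "(u - s) / d \<le> real (Suc l)"
    unfolding l_def by linarith+
  then have lu: "s + real l * d < u" "u \<le> s + real (Suc l) * d"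
    using d by (simp_all add: field_simps)
  have "real l * d < c - s" using lu u by simp
  also have "c - s = 2 ^ m * d" by (simp add: d_def)
  finally have "real l < 2 ^ m" using d by simp
  then have "l < 2 ^ m" by (metis of_nat_less_numeral_power_cancel_iff)
  moreover have "\<omega> \<in> cell s c j m l"
    using w u lu by (auto simp: cell_def hold_def one_switch_def d_def)
  ultimately show "\<omega> \<in> (\<Union>l<2 ^ m. cell s c j m l)" by auto
next
  fix \<omega> assume "\<omega> \<in> (\<Inter>m. \<Union>l<2 ^ m. cell s c j m l)"
  then have "\<forall>m. \<exists>l<2 ^ m. \<omega> \<in> cell s c j m l" by auto
  then obtain l where l: "\<And>m. l m < 2 ^ m" "\<And>m. \<omega> \<in> cell s c j m (l m)" by metis
  have sp: "\<omega> \<in> space M" using l(2)[of 0] by (auto simp: cell_def hold_def)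
  define x where "x m = s + real (l m) * ((c - s) / 2 ^ m)" for m
  define y where "y m = s + real (Suc (l m)) * ((c - s) / 2 ^ m)" for m
  have yx: "y m = x m + (c - s) / 2 ^ m" for m
    by (simp only: x_def y_def of_nat_Suc distrib_right mult_1 add_ac)
  have x: "eps r \<omega> = j" if "s \<le> r" "r \<le> x m" for r m
    using l(2)[of m] that by (auto simp: cell_def hold_def x_def)
  have y: "eps r \<omega> = 1 - j" if "y m \<le> r" "r \<le> c" for r m
    using l(2)[of m] that by (auto simp: cell_def hold_def y_def)
  have yc: "y m \<le> c" for m
    using grid_point(1)[of s c "Suc (l m)" m] assms l(1)[of m] by (simp add: y_def Suc_le_eq)
  have xs: "s \<le> x m" for m using assms by (simp add: x_def)
  have jj: "j \<noteq> 1 - j" using j by auto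
  \<comment> \<open>Otherwise the time \<open>y k\<close> would belong to state \<open>j\<close> by
    the cell of mesh \<open>m\<close> and to state \<open>1 - j\<close> by that of mesh
    \<open>k\<close>.\<close>
  have xy: "x m \<le> y k" for m k
  proof (rule ccontr)
    assume "\<not> x m \<le> y k"
    moreover have "x k \<le> y k" using yx assms by simp
    ultimately have "s \<le> y k" "y k \<le> x m" using xs[of k] by auto
    then show False using x[of "y k" m] y[of k "y k"] yc[of k] jj by auto
  qed
  define u where "u = (SUP m. x m)"
  have bdd: "bdd_above (range x)" using xy by (auto intro!: bdd_aboveI[of _ "y 0"])
  have xu: "x m \<le> u" for m unfolding u_def by (rule cSUP_upper[OF _ bdd]) auto
  have uy: "u \<le> y m" for m unfolding u_def by (rule cSUP_least) (auto intro: xy)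
  have before: "eps r \<omega> = j" if "s \<le> r" "r < u" for r
  proof -
    note r = that
    obtain m where "r < x m" using r(2) unfolding u_def by (auto simp: less_cSUP_iff[OF _ bdd])
    then show ?thesis using x[of r m] r by auto
  qed
  have after: "eps r \<omega> = 1 - j" if "u < r" "r \<le> c" for r
  proof -
    have "(\<lambda>m. (c - s) / 2 ^ m) \<longlonglongrightarrow> 0" by real_asymp
    then have "\<forall>\<^sub>F m in sequentially. (c - s) / 2 ^ m < r - u"
      using that by (intro order_tendstoD) auto
    then obtain m where "(c - s) / 2 ^ m < r - u" by (auto simp: eventually_sequentially)
    then have "y m \<le> r" using yx[of m] xu[of m] by simp
    then show ?thesis using y that by auto
  qed
  have uc: "u \<le> c" using uy[of 0] yc[of 0] by simp
  have us: "s \<le> u" using xs[of 0] xu[of 0] by simp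
  \<comment> \<open>Neither \<open>before\<close> nor \<open>after\<close> speaks about
    \<open>u\<close> itself. Right continuity carries the state over from later times; if
    \<open>u = c\<close>, it is known from the cell.\<close>
  have at: "eps u \<omega> = 1 - j"
  proof (cases "u = c")
    case True
    then show ?thesis using y[of 0 c] yc[of 0] by auto
  next
    case False
    then have "u < c" using uc by simp
    obtain \<delta> where \<delta>: "\<delta> > u" "\<And>x. u < x \<Longrightarrow> x < \<delta> \<Longrightarrow> eps x \<omega> = eps u \<omega>"
      using right_continuous[of u \<omega>] sp us assms by (auto simp: eventually_at_right_field)
    obtain r where "u < r" "r < min \<delta> c" using dense[of u "min \<delta> c"] \<delta>(1) \<open>u < c\<close> by auto
    then show ?thesis using \<delta>(2)[of r] after[of r] by auto
  qed
  have "u \<noteq> s"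
    using at x[of s 0] xs[of 0] jj by auto
  then have "s < u" using us by simp
  moreover have "eps r \<omega> = 1 - j" if "r \<in> {u..c}" for r
    using that at after[of r] by (cases "r = u") auto
  ultimately show "\<omega> \<in> one_switch s c j"
    using sp uc before unfolding one_switch_def by (auto intro!: exI[of _ u] simp del: One_nat_def)
qed

lemma one_switch_past:
  assumes "0 \<le> s" "s < c" "j \<in> {0, 1}"
  shows "one_switch s c j \<in> past M eps c"
proof -
  interpret P: sigma_algebra "space M" "past M eps c" by (rule past_algebra)
  show ?thesis unfolding one_switch_eq_cells[OF assms] using assms
    by (intro P.countable_INT P.finite_UN image_subsetI) (auto intro!: cell_past)
qed

text \<open>The cells contribute \<open>trans d j (1 - j)\<close> times a sum \<open>S\<close>, and
  \<open>one_jump_sum\<close> expresses \<open>one_jump\<close> at \<open>h\<close> as its value at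
  the mesh \<open>d\<close> times the same \<open>S\<close>. The probability is thus
  \<open>one_jump\<close> at \<open>h\<close> times a quotient of two quantities with the same rate
  \<open>lam j\<close> at 0, which tends to 1.\<close>

lemma prob_one_switch:
  assumes "0 \<le> s" "s < c" "A \<in> past M eps s" and j: "j \<in> {0, 1}"
  shows "prob (A \<inter> one_switch s c j) = prob (A \<inter> {\<omega> \<in> space M. eps s \<omega> = j}) * one_jump (lam j) (lam (1 - j)) (c - s)"
proof -
  define h where "h = c - s"
  have h: "h > 0" using assms by (simp add: h_def)
  let ?p = "prob (A \<inter> {\<omega> \<in> space M. eps s \<omega> = j})" and ?J = "one_jump (lam j) (lam (1 - j))"
  let ?D = "\<lambda>m. A \<inter> (\<Union>l<2 ^ m. cell s c j m l)"
  have A: "A \<in> events" using assms past_events by auto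
  have ev: "cell s c j m l \<in> events" if "l < 2 ^ m" for m l
    using assms that by (intro past_events[OF cell_past]) auto
  have lp: "lam j > 0" using lam_pos j by auto
  have "(\<lambda>m. prob (?D m)) \<longlonglongrightarrow> prob (\<Inter>m. ?D m)"
  proof (rule finite_Lim_measure_decseq)
    show "range ?D \<subseteq> events" using A ev by auto
    show "decseq ?D"
    proof (rule decseq_SucI)
      show "?D (Suc m) \<le> ?D m" for m using cells_antimono[of s c j m] assms by auto
    qed
  qed
  also have "(\<Inter>m. ?D m) = A \<inter> one_switch s c j"
    unfolding one_switch_eq_cells[OF assms(1,2,4)] by auto
  finally have "(\<lambda>m. prob (?D m)) \<longlonglongrightarrow> prob (A \<inter> one_switch s c j)" .
  moreover have "(\<lambda>m. prob (?D m)) \<longlonglongrightarrow> ?p * (lam j / lam j * ?J h)"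
  proof (rule Lim_transform_eventually)
    have "(\<lambda>m. trans (h / 2 ^ m) j (1 - j) / (h / 2 ^ m)) \<longlonglongrightarrow> lam j"
      by (rule filterlim_compose[OF trans_rate[OF j] dyadic_at_right[OF h]])
    moreover have "(\<lambda>m. ?J (h / 2 ^ m) / (h / 2 ^ m)) \<longlonglongrightarrow> lam j"
      by (rule filterlim_compose[OF one_jump_rate dyadic_at_right[OF h]])
    ultimately show "(\<lambda>m. ?p * ((trans (h / 2 ^ m) j (1 - j) / (h / 2 ^ m)) / (?J (h / 2 ^ m) / (h / 2 ^ m)) * ?J h)) \<longlonglongrightarrow> ?p * (lam j / lam j * ?J h)"
      using lp by (intro tendsto_intros) auto
    show "\<forall>\<^sub>F m in sequentially. ?p * ((trans (h / 2 ^ m) j (1 - j) / (h / 2 ^ m)) / (?J (h / 2 ^ m) / (h / 2 ^ m)) * ?J h) = prob (?D m)"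
    proof (rule always_eventually, rule allI)
      fix m :: nat
      define d where "d = h / 2 ^ m"
      have d: "d > 0" using h by (simp add: d_def)
      have Jd: "?J d > 0" using one_jump_pos lp d by simp
      let ?S = "\<Sum>l<2 ^ m. exp (- lam j * (real l * d)) * exp (- lam (1 - j) * (real (2 ^ m - Suc l) * d))"
      have "prob (?D m) = prob (\<Union>l<2 ^ m. A \<inter> cell s c j m l)" by (simp only: Int_UN_distrib)
      also have "\<dots> = (\<Sum>l<2 ^ m. prob (A \<inter> cell s c j m l))"
        using A ev disjoint_cells[of s c j m] assms
      proof (intro finite_measure_finite_Union)
        show "disjoint_family_on (\<lambda>l. A \<inter> cell s c j m l) {..<2 ^ m}"
          by (rule disjoint_family_on_bisimulation[OF disjoint_cells[of s c j m]]) (use assms in auto)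
      qed (use A ev in auto)
      also have "\<dots> = (\<Sum>l<2 ^ m. ?p * trans d j (1 - j) * (exp (- lam j * (real l * d)) * exp (- lam (1 - j) * (real (2 ^ m - Suc l) * d))))"
        unfolding d_def h_def using assms by (intro sum.cong prob_cell) auto
      also have "\<dots> = ?p * trans d j (1 - j) * ?S" by (simp only: sum_distrib_left)
      finally have P: "prob (?D m) = ?p * trans d j (1 - j) * ?S" .
      have "h = real (2 ^ m) * d" by (simp add: d_def)
      then have "?J h = ?J (real (2 ^ m) * d)" by (rule arg_cong)
      also have "\<dots> = ?J d * ?S" by (rule one_jump_sum)
      finally have J: "?J h = ?J d * ?S" .
      have "p * ((x / d) / (y / d) * (y * S)) = p * x * S" if "y \<noteq> 0" for p x y S
        using d that by simp
      then show "?p * ((trans (h / 2 ^ m) j (1 - j) / (h / 2 ^ m)) / (?J (h / 2 ^ m) / (h / 2 ^ m)) * ?J h) = prob (?D m)"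
        unfolding P J d_def[symmetric] using Jd by fastforce
    qed
  qed
  ultimately show ?thesis using lp LIMSEQ_unique unfolding h_def by fastforce
qed

end

section \<open>The law of the switching times\<close>

abbreviation seqs :: "(nat \<Rightarrow> real) measure" where
  "seqs \<equiv> (\<Pi>\<^sub>M i\<in>UNIV. borel)"

text \<open>
  A finite increasing list of switching times in (s, t] is coded as a sequence by appending t + 1 forever,
  so that each switching time is followed by a strictly larger entry.
\<close>

primrec jump_times :: "nat \<Rightarrow> real \<Rightarrow> real \<Rightarrow> real \<Rightarrow> real \<Rightarrow> (nat \<Rightarrow> real) \<Rightarrow> nat \<Rightarrow> real" where
  "jump_times 0 a b s t h = (\<lambda>_. t + 1)"
| "jump_times (Suc n) a b s t h = case_nat (s + h 0 / a) (jump_times n b a (s + h 0 / a) t (tail h))"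

lemma measurable_jump_times [measurable (raw)]:
  assumes "s \<in> borel_measurable N" "h \<in> N \<rightarrow>\<^sub>M seqs"
  shows "(\<lambda>x. jump_times n a b (s x) t (h x)) \<in> N \<rightarrow>\<^sub>M seqs"
  using assms
proof (induction n arbitrary: a b s h)
  case 0
  show ?case by (auto intro!: measurable_const simp: space_PiM)
next
  case (Suc n)
  note [measurable] = Suc.prems
  have [measurable]: "(\<lambda>x. jump_times n b a (s x + h x 0 / a) t (tail (h x))) \<in> N \<rightarrow>\<^sub>M seqs"
    by (rule Suc.IH; measurable)
  show ?case by simp
qed

definition jump_law :: "nat \<Rightarrow> real \<Rightarrow> real \<Rightarrow> real \<Rightarrow> real \<Rightarrow> ((nat \<Rightarrow> real) \<Rightarrow> ennreal) \<Rightarrow> ennreal" where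
  "jump_law n a b s t \<phi> = (\<integral>\<^sup>+h. (if exactly n a b (t - s) h then \<phi> (jump_times n a b s t h) else 0) \<partial>holding)"

lemma measurable_jump_law [measurable (raw)]:
  assumes [measurable]: "s \<in> borel_measurable N" "case_prod \<phi> \<in> borel_measurable (N \<Otimes>\<^sub>M seqs)"
  shows "(\<lambda>x. jump_law n a b (s x) t (\<phi> x)) \<in> borel_measurable N"
proof -
  interpret S: sigma_finite_measure holding by (rule sigma_finite_holding)
  show ?thesis unfolding jump_law_def by measurable
qed

lemma jump_law_0:
  assumes "a > 0" "s \<le> t"
  shows "jump_law 0 a b s t \<phi> = ennreal (exp (- a * (t - s))) * \<phi> (\<lambda>_. t + 1)"
proof -
  have "jump_law 0 a b s t \<phi> = (\<integral>\<^sup>+h. \<phi> (\<lambda>_. t + 1) * indicator {t - s<..} (h 0 / a) \<partial>holding)"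
    unfolding jump_law_def by (intro nn_integral_cong) (auto simp: indicator_def)
  also have "\<dots> = \<phi> (\<lambda>_. t + 1) * (\<integral>\<^sup>+h. indicator {t - s<..} (h 0 / a) \<partial>holding)"
    by (rule nn_integral_cmult) measurable
  finally show ?thesis
    using emeasure_exponential_tail[of a "t - s"] assms by (simp add: mult.commute)
qed

lemma jump_law_Suc:
  assumes a: "a > 0" and [measurable]: "\<phi> \<in> borel_measurable seqs"
  shows "jump_law (Suc n) a b s t \<phi> =
    (\<integral>\<^sup>+u\<in>{0..t - s}. ennreal (a * exp (- a * u)) * jump_law n b a (s + u) t (\<lambda>w. \<phi> (case_nat (s + u) w)) \<partial>lborel)"
proof -
  define F where "F u h = (if u \<le> t - s \<and> exactly n b a (t - (s + u)) h
      then \<phi> (case_nat (s + u) (jump_times n b a (s + u) t h)) else 0)" for u h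
  have "jump_law (Suc n) a b s t \<phi> = (\<integral>\<^sup>+h. F (h 0 / a) (tail h) \<partial>holding)"
    unfolding jump_law_def F_def by (intro nn_integral_cong) (auto simp: diff_diff_eq)
  also have "\<dots> = (\<integral>\<^sup>+u\<in>{0..}. ennreal (a * exp (- a * u)) * (\<integral>\<^sup>+h. F u h \<partial>holding) \<partial>lborel)"
    by (rule nn_integral_holding[OF a]) (unfold F_def split_beta', measurable)
  also have "\<dots> = (\<integral>\<^sup>+u\<in>{0..t - s}. ennreal (a * exp (- a * u)) * jump_law n b a (s + u) t (\<lambda>w. \<phi> (case_nat (s + u) w)) \<partial>lborel)"
    by (intro nn_integral_cong) (auto simp: indicator_def F_def jump_law_def)
  finally show ?thesis .
qed

text \<open>Memorylessness: since \<open>\<phi>\<close> ignores paths that switch up to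
  \<open>c\<close>, a start at \<open>u\<close> instead of \<open>c\<close> costs just the
  probability of no switching in between.\<close>

lemma jump_law_shift:
  assumes "a > 0" "b > 0" "u \<le> c" "c \<le> t" and [measurable]: "\<phi> \<in> borel_measurable seqs"
    and late: "\<And>w. w 0 \<le> c \<Longrightarrow> \<phi> w = 0"
  shows "jump_law n a b u t \<phi> = ennreal (exp (- a * (c - u))) * jump_law n a b c t \<phi>"
proof (cases n)
  case 0
  have "exp (- a * (t - u)) = exp (- a * (c - u)) * exp (- a * (t - c))"
    by (simp add: exp_add[symmetric] algebra_simps)
  then show ?thesis using assms by (simp add: 0 jump_law_0 ennreal_mult' mult.assoc)
next
  case (Suc m)
  define g where "g v = jump_law m b a v t (\<lambda>w. \<phi> (case_nat v w))" for v
  have [measurable]: "g \<in> borel_measurable borel" unfolding g_def by measurable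
  have g0: "g v = 0" if "v \<le> c" for v
    using late that by (simp add: g_def jump_law_def)
  have "jump_law n a b u t \<phi> = (\<integral>\<^sup>+v\<in>{0..t - u}. ennreal (a * exp (- a * v)) * g (u + v) \<partial>lborel)"
    unfolding Suc g_def by (rule jump_law_Suc) (use assms in auto)
  also have "\<dots> = (\<integral>\<^sup>+v. ennreal (a * exp (- a * (c - u + v))) * g (c + v) * indicator {0..t - u} (c - u + v) \<partial>lborel)"
    by (subst nn_integral_real_affine[where c = 1 and t = "c - u"]) auto
  also have "\<dots> = (\<integral>\<^sup>+v. ennreal (exp (- a * (c - u))) * (ennreal (a * exp (- a * v)) * g (c + v) * indicator {0..t - c} v) \<partial>lborel)"
  proof (intro nn_integral_cong)
    fix v
    show "ennreal (a * exp (- a * (c - u + v))) * g (c + v) * indicator {0..t - u} (c - u + v) =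
        ennreal (exp (- a * (c - u))) * (ennreal (a * exp (- a * v)) * g (c + v) * indicator {0..t - c} v)"
    proof (cases "v \<le> 0")
      case True
      then show ?thesis using g0[of "c + v"] by simp
    next
      case False
      have "a * exp (- a * (c - u + v)) = exp (- a * (c - u)) * (a * exp (- a * v))"
        by (simp add: exp_add[symmetric] algebra_simps)
      then show ?thesis using False assms by (auto simp: indicator_def ennreal_mult' mult_ac)
    qed
  qed
  also have "\<dots> = ennreal (exp (- a * (c - u))) * jump_law n a b c t \<phi>"
    unfolding Suc using assms by (subst nn_integral_cmult) (auto simp: jump_law_Suc g_def)
  finally show ?thesis .
qed

lemma jump_law_cong:
  assumes "a > 0" "b > 0" "s \<le> t" and [measurable]: "\<phi> \<in> borel_measurable seqs" "\<psi> \<in> borel_measurable seqs"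
    and eq: "\<And>w. s < w 0 \<Longrightarrow> \<phi> w = \<psi> w"
  shows "jump_law n a b s t \<phi> = jump_law n a b s t \<psi>"
proof (cases n)
  case 0
  then show ?thesis using assms by (simp add: jump_law_0)
next
  case (Suc m)
  show ?thesis unfolding Suc jump_law_Suc[OF assms(1,4)] jump_law_Suc[OF assms(1,5)]
  proof (intro nn_integral_cong_AE, use AE_lborel_singleton[of 0] in eventually_elim)
    case (elim u)
    then show ?case using eq by (auto simp: indicator_def)
  qed
qed

section \<open>Switching times of a path as a list\<close>

primrec switches :: "(real \<Rightarrow> nat) \<Rightarrow> nat \<Rightarrow> real \<Rightarrow> real \<Rightarrow> real list \<Rightarrow> bool" where
  "switches e j s t [] = (\<forall>r\<in>{s..t}. e r = j)"
| "switches e j s t (u # us) = (s < u \<and> u \<le> t \<and> (\<forall>r\<in>{s..<u}. e r = j) \<and> switches e (1 - j) u t us)"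

primrec pad :: "real \<Rightarrow> real list \<Rightarrow> nat \<Rightarrow> real" where
  "pad t [] = (\<lambda>_. t + 1)"
| "pad t (u # us) = case_nat u (pad t us)"

lemma switches_start: "switches e j s t us \<Longrightarrow> s \<le> t \<Longrightarrow> e s = j"
  by (cases us) auto

lemma switches_pad_0: "switches e j s t us \<Longrightarrow> s \<le> t \<Longrightarrow> s < pad t us 0"
  by (cases us) auto

lemma switches_unique:
  assumes "switches e j s t us" "switches e j s t vs" "s \<le> t" "j \<in> {0, 1}"
  shows "us = vs"
  using assms
proof (induction us arbitrary: j s vs)
  case Nil
  show ?case
  proof (cases vs)
    case (Cons v vs')
    then have "e v = 1 - j" "v \<in> {s..t}" using Nil switches_start[of e "1 - j" v t vs'] by auto
    then show ?thesis using Nil by auto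
  qed simp
next
  case (Cons u us)
  have eu: "e u = 1 - j" "u \<in> {s..t}" "s < u" using Cons.prems switches_start[of e "1 - j" u t us] by auto
  show ?case
  proof (cases vs)
    case Nil
    then show ?thesis using eu Cons.prems by auto
  next
    case (Cons v vs')
    then have ev: "e v = 1 - j" "v \<in> {s..t}" "s < v" using Cons.prems switches_start[of e "1 - j" v t vs'] by auto
    have "u = v"
    proof (rule linorder_cases[of u v])
      assume "u < v" then show ?thesis using eu \<open>vs = _\<close> Cons.prems by auto
    next
      assume "v < u" then show ?thesis using ev Cons.prems by auto
    qed
    then show ?thesis using Cons.IH[of "1 - j" u vs'] Cons.prems \<open>vs = _\<close> eu by auto
  qed
qed

lemma switches_later:
  assumes "switches e j u t us" "u \<le> c" "c \<le> t" "c < pad t us 0"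
  shows "switches e j c t us" "\<forall>r\<in>{u..c}. e r = j"
  using assms by (cases us; auto)+

lemma switches_earlier:
  assumes "switches e j c t us" "u \<le> c" "c \<le> t" "\<forall>r\<in>{u..c}. e r = j"
  shows "switches e j u t us"
proof (cases us)
  case Nil
  then show ?thesis using assms by (auto; metis linear)
next
  case (Cons v vs)
  then have "e r = j" if "u \<le> r" "r < v" for r
    using assms that by (cases "r \<le> c") auto
  then show ?thesis using Cons assms by auto
qed

definition first_window :: "real \<Rightarrow> real \<Rightarrow> (nat \<Rightarrow> real) set \<Rightarrow> (nat \<Rightarrow> real) set" where
  "first_window s c D = {w. s < w 0 \<and> w 0 \<le> c \<and> tail w \<in> D}"

context switching
begin

definition path_event :: "nat \<Rightarrow> real \<Rightarrow> real \<Rightarrow> nat \<Rightarrow> (nat \<Rightarrow> real) set \<Rightarrow> 'a set" where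
  "path_event n s t j D = {\<omega> \<in> space M. \<exists>us. length us = n \<and> switches (\<lambda>r. eps r \<omega>) j s t us \<and> pad t us \<in> D}"

text \<open>All entries after the first exceed \<open>c\<close>, so the first is the only switching
  in (s, c], and the two parts are linked by nothing but the state at \<open>c\<close>.\<close>

lemma path_event_first_window:
  assumes "s < c" "c \<le> t" and D: "\<And>w. w \<in> D \<Longrightarrow> c < w 0"
  shows "path_event (Suc n) s t j (first_window s c D) = one_switch s c j \<inter> path_event n c t (1 - j) D"
proof (intro equalityI subsetI)
  fix \<omega> assume "\<omega> \<in> path_event (Suc n) s t j (first_window s c D)"
  then obtain us where sp: "\<omega> \<in> space M" and us: "length us = Suc n" "switches (\<lambda>r. eps r \<omega>) j s t us" "pad t us \<in> first_window s c D"
    by (auto simp: path_event_def)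
  then obtain u vs where [simp]: "us = u # vs" by (cases us) auto
  have u: "s < u" "u \<le> c" "pad t vs \<in> D" "switches (\<lambda>r. eps r \<omega>) (1 - j) u t vs" "\<forall>r\<in>{s..<u}. eps r \<omega> = j" "length vs = n"
    using us by (auto simp: first_window_def)
  from switches_later[OF u(4,2) assms(2) D[OF u(3)]] u sp
  show "\<omega> \<in> one_switch s c j \<inter> path_event n c t (1 - j) D"
    unfolding one_switch_def path_event_def by blast
next
  fix \<omega> assume w: "\<omega> \<in> one_switch s c j \<inter> path_event n c t (1 - j) D"
  then obtain u where sp: "\<omega> \<in> space M" and u: "s < u" "u \<le> c" "\<forall>r\<in>{s..<u}. eps r \<omega> = j" "\<forall>r\<in>{u..c}. eps r \<omega> = 1 - j"
    unfolding one_switch_def by blast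
  obtain vs where vs: "length vs = n" "switches (\<lambda>r. eps r \<omega>) (1 - j) c t vs" "pad t vs \<in> D"
    using w by (auto simp: path_event_def)
  have "switches (\<lambda>r. eps r \<omega>) j s t (u # vs)"
    using switches_earlier[OF vs(2) u(2) assms(2) u(4)] u assms by auto
  then show "\<omega> \<in> path_event (Suc n) s t j (first_window s c D)"
    using sp vs u unfolding path_event_def
    by (auto intro!: exI[of _ "u # vs"] simp: first_window_def)
qed

end

section \<open>A generating class of sets of switching sequences\<close>

definition ordered_seqs :: "real \<Rightarrow> real \<Rightarrow> (nat \<Rightarrow> real) set" where
  "ordered_seqs s t = {w. s < w 0 \<and> w 0 \<le> t \<and> w 0 < w (Suc 0)}"

text \<open>
  Sets of this form are stable under intersection, and the Markov property at the fixed time c computes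
  their probability: exactly one switching up to c, then a path starting afresh at c.
\<close>

definition windows :: "real \<Rightarrow> real \<Rightarrow> (nat \<Rightarrow> real) set set" where
  "windows s t = {first_window s c D |c D. s < c \<and> c \<le> t \<and> D \<in> sets seqs \<and> (\<forall>w\<in>D. c < w 0)}"

lemma late_sets [measurable]: "{w. (c::real) < w 0} \<in> sets seqs"
proof -
  have "{w \<in> space seqs. c < w 0} \<in> sets seqs" by measurable
  then show ?thesis by (simp add: space_PiM)
qed

lemma first_window_sets [measurable]:
  assumes [measurable]: "D \<in> sets seqs"
  shows "first_window s c D \<in> sets seqs"
proof -
  have "{w \<in> space seqs. s < w 0 \<and> w 0 \<le> c \<and> tail w \<in> D} \<in> sets seqs" by measurable
  then show ?thesis by (simp add: space_PiM first_window_def)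
qed

lemma windows_subset: "windows s t \<subseteq> Pow (ordered_seqs s t)"
  by (force simp: windows_def ordered_seqs_def first_window_def tail_def)

lemma Int_stable_windows: "Int_stable (windows s t)"
proof (rule Int_stableI)
  fix X Y assume "X \<in> windows s t" "Y \<in> windows s t"
  then obtain c D c' D' where X: "X = first_window s c D" "s < c" "c \<le> t" "D \<in> sets seqs" "\<forall>w\<in>D. c < w 0"
    and Y: "Y = first_window s c' D'" "s < c'" "c' \<le> t" "D' \<in> sets seqs" "\<forall>w\<in>D'. c' < w 0"
    unfolding windows_def by blast
  have "X \<inter> Y = first_window s (min c c') (D \<inter> D')"
    unfolding X Y by (auto simp: first_window_def)
  moreover have "D \<inter> D' \<in> sets seqs" using X(4) Y(4) by (rule sets.Int)
  ultimately show "X \<inter> Y \<in> windows s t"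
    unfolding windows_def using X Y by (intro CollectI exI[of _ "min c c'"] exI[of _ "D \<inter> D'"]) auto
qed

text \<open>The point \<open>t\<close> is added to the rationals for sequences with
  \<open>w 0 = t\<close>: a cut between \<open>w 0\<close> and \<open>t\<close> can then only be
  \<open>t\<close>.\<close>

definition cuts :: "real \<Rightarrow> real \<Rightarrow> real set" where
  "cuts s t = {q. (q = t \<or> q \<in> \<rat>) \<and> s < q \<and> q \<le> t}"

lemma countable_cuts: "countable (cuts s t)"
  by (rule countable_subset[of _ "insert t \<rat>"]) (auto simp: cuts_def countable_rat)

lemma obtain_cut:
  assumes "w \<in> ordered_seqs s t"
  obtains q where "q \<in> cuts s t" "w 0 \<le> q" "q < w (Suc 0)"
proof (cases "w 0 = t")
  case True
  then show ?thesis using assms that[of t] by (auto simp: ordered_seqs_def cuts_def)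
next
  case False
  then have "w 0 < min t (w (Suc 0))" using assms by (auto simp: ordered_seqs_def)
  from Rats_dense_in_real[OF this] obtain q where "q \<in> \<rat>" "w 0 < q" "q < min t (w (Suc 0))" by blast
  then show ?thesis using assms that[of q] by (auto simp: ordered_seqs_def cuts_def)
qed

text \<open>A single window also restricts \<open>w 0\<close>. The union over countably many cuts
  removes this restriction, because each sequence has a cut between its first two entries.\<close>

lemma tail_generated:
  assumes "D \<in> sets seqs"
  shows "{w \<in> ordered_seqs s t. tail w \<in> D} \<in> sigma_sets (ordered_seqs s t) (windows s t)"
proof -
  have "{w \<in> ordered_seqs s t. tail w \<in> D} = (\<Union>q\<in>cuts s t. first_window s q ({w. q < w 0} \<inter> D))"
  proof (intro equalityI subsetI)
    fix w assume w: "w \<in> {w \<in> ordered_seqs s t. tail w \<in> D}"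
    then obtain q where "q \<in> cuts s t" "w 0 \<le> q" "q < w (Suc 0)" using obtain_cut by blast
    then show "w \<in> (\<Union>q\<in>cuts s t. first_window s q ({w. q < w 0} \<inter> D))"
      using w by (auto simp: first_window_def tail_def ordered_seqs_def)
  qed (auto simp: first_window_def tail_def ordered_seqs_def cuts_def)
  moreover have "first_window s q ({w. q < w 0} \<inter> D) \<in> windows s t" if "q \<in> cuts s t" for q
    unfolding windows_def using that assms
    by (intro CollectI exI[of _ q] exI[of _ "{w. q < w 0} \<inter> D"]) (auto simp: cuts_def)
  ultimately show ?thesis
    by (auto intro!: sigma_sets_UNION countable_image countable_cuts simp: image_image)
qed

lemma head_generated: "{w \<in> ordered_seqs s t. w 0 \<le> c} \<in> sigma_sets (ordered_seqs s t) (windows s t)"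
proof (cases "s < c")
  case True
  \<comment> \<open>If \<open>q\<close> separates the first two entries and
    \<open>w 0 \<le> c\<close>, then \<open>min q c\<close> separates them as well and keeps
    \<open>w 0\<close> below \<open>c\<close>.\<close>
  have "{w \<in> ordered_seqs s t. w 0 \<le> c} = (\<Union>q\<in>cuts s t. first_window s (min q c) {w. min q c < w 0})"
  proof (intro equalityI subsetI)
    fix w assume w: "w \<in> {w \<in> ordered_seqs s t. w 0 \<le> c}"
    then obtain q where "q \<in> cuts s t" "w 0 \<le> q" "q < w (Suc 0)" using obtain_cut by blast
    then show "w \<in> (\<Union>q\<in>cuts s t. first_window s (min q c) {w. min q c < w 0})"
      using w by (auto simp: first_window_def tail_def ordered_seqs_def)
  qed (auto simp: first_window_def tail_def ordered_seqs_def cuts_def)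
  moreover have "first_window s (min q c) {w. min q c < w 0} \<in> windows s t" if "q \<in> cuts s t" for q
    unfolding windows_def using that True
    by (intro CollectI exI[of _ "min q c"] exI[of _ "{w. min q c < w 0}"]) (auto simp: cuts_def)
  ultimately show ?thesis
    by (auto intro!: sigma_sets_UNION countable_image countable_cuts simp: image_image)
next
  case False
  then have "{w \<in> ordered_seqs s t. w 0 \<le> c} = {}" by (auto simp: ordered_seqs_def)
  then show ?thesis by (metis sigma_sets.Empty)
qed

lemma sigma_windows:
  shows "space (sigma (ordered_seqs s t) (windows s t)) = ordered_seqs s t"
    and "sets (sigma (ordered_seqs s t) (windows s t)) = sigma_sets (ordered_seqs s t) (windows s t)"
  using windows_subset by (auto simp: space_measure_of sets_measure_of)

lemma measurable_windows: "(\<lambda>w. w) \<in> sigma (ordered_seqs s t) (windows s t) \<rightarrow>\<^sub>M seqs"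
proof (rule measurable_PiM_single')
  let ?N = "sigma (ordered_seqs s t) (windows s t)"
  show "(\<lambda>w. w i) \<in> borel_measurable ?N" for i
  proof (cases i)
    case 0
    show ?thesis unfolding 0
      by (rule borel_measurableI_le) (simp add: sigma_windows head_generated)
  next
    case (Suc k)
    have "{w \<in> ordered_seqs s t. w i \<le> c} \<in> sets ?N" for c
    proof -
      have "{w \<in> space seqs. w k \<le> c} \<in> sets seqs" by measurable
      from tail_generated[OF this, of s t] show ?thesis
        unfolding Suc by (simp add: sigma_windows space_PiM tail_def)
    qed
    then show ?thesis by (intro borel_measurableI_le) (simp add: sigma_windows)
  qed
qed (auto simp: space_PiM)

lemma generated_ordered: "D \<in> sets seqs \<Longrightarrow> D \<inter> ordered_seqs s t \<in> sigma_sets (ordered_seqs s t) (windows s t)"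
  using measurable_sets[OF measurable_windows, of D s t] by (simp add: sigma_windows)

lemma ordered_seqs_cover: "ordered_seqs s t = (\<Union>q\<in>cuts s t. first_window s q {w. q < w 0})"
proof (intro equalityI subsetI)
  fix w assume w: "w \<in> ordered_seqs s t"
  then obtain q where "q \<in> cuts s t" "w 0 \<le> q" "q < w (Suc 0)" using obtain_cut by blast
  then show "w \<in> (\<Union>q\<in>cuts s t. first_window s q {w. q < w 0})"
    using w by (auto simp: first_window_def tail_def ordered_seqs_def)
qed (auto simp: first_window_def tail_def ordered_seqs_def cuts_def)

lemma ordered_seqs_sets [measurable]: "ordered_seqs s t \<in> sets seqs"
  unfolding ordered_seqs_cover by (intro sets.countable_UN'' countable_cuts) auto

text \<open>The rest of the path depends on the first switching at \<open>s + u\<close> only through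
  the survival from there to \<open>c\<close>. Hence the integral over \<open>u\<close> splits off,
  and its value is \<open>one_jump\<close>, just as for the process.\<close>

lemma jump_law_window:
  assumes "a > 0" "b > 0" "s < c" "c \<le> t" and D [measurable]: "D \<in> sets seqs" and late: "\<And>w. w \<in> D \<Longrightarrow> c < w 0"
  shows "jump_law (Suc n) a b s t (indicator (first_window s c D)) =
    ennreal (one_jump a b (c - s)) * jump_law n b a c t (indicator D)"
proof -
  have "jump_law (Suc n) a b s t (indicator (first_window s c D)) = (\<integral>\<^sup>+u\<in>{0..t - s}. ennreal (a * exp (- a * u)) *
      jump_law n b a (s + u) t (\<lambda>w. indicator (first_window s c D) (case_nat (s + u) w)) \<partial>lborel)"
    by (rule jump_law_Suc) (use assms in auto)
  also have "\<dots> = (\<integral>\<^sup>+u. ennreal (a * exp (- a * u)) * ennreal (exp (- b * (c - s - u))) * indicator {0..c - s} u *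
      jump_law n b a c t (indicator D) \<partial>lborel)"
  proof (intro nn_integral_cong_AE, use AE_lborel_singleton[of 0] in eventually_elim)
    case (elim u)
    show ?case
    proof (cases "0 < u \<and> s + u \<le> c")
      case True
      then have "(\<lambda>w. indicator (first_window s c D) (case_nat (s + u) w)) = (indicator D :: _ \<Rightarrow> ennreal)"
        by (auto simp: first_window_def indicator_def fun_eq_iff)
      moreover have "jump_law n b a (s + u) t (indicator D) = ennreal (exp (- b * (c - (s + u)))) * jump_law n b a c t (indicator D)"
        using True assms by (intro jump_law_shift) (auto simp: indicator_def dest: late)
      ultimately show ?thesis using True assms by (auto simp: mult_ac diff_diff_eq)
    next
      case False
      then have "(\<lambda>w. indicator (first_window s c D) (case_nat (s + u) w)) = (\<lambda>w. 0 :: ennreal)"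
        by (auto simp: first_window_def indicator_def fun_eq_iff)
      then show ?thesis using False elim by (auto simp: jump_law_def indicator_def)
    qed
  qed
  also have "\<dots> = (\<integral>\<^sup>+u\<in>{0..c - s}. ennreal (a * exp (- a * u)) * ennreal (exp (- b * (c - s - u))) \<partial>lborel) *
      jump_law n b a c t (indicator D)"
    by (rule nn_integral_multc) measurable
  also have "\<dots> = ennreal (one_jump a b (c - s)) * jump_law n b a c t (indicator D)"
    using nn_integral_one_jump[of a "c - s" b] assms by simp
  finally show ?thesis .
qed

section \<open>Agreement of the two laws\<close>

context switching
begin

lemma path_event_empty: "s \<ge> t \<Longrightarrow> path_event (Suc n) s t j D = {}"
  by (auto simp: path_event_def length_Suc_conv)

lemma path_event_ordered: "path_event (Suc n) s t j (D \<inter> ordered_seqs s t) = path_event (Suc n) s t j D"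
proof -
  have "pad t us \<in> ordered_seqs s t" if "length us = Suc n" "switches (\<lambda>r. eps r \<omega>) j s t us" for us \<omega>
  proof -
    note us = that
    obtain u vs where "us = u # vs" using us(1) by (cases us) auto
    then show ?thesis
      using us switches_pad_0[of "\<lambda>r. eps r \<omega>" "1 - j" u t vs] by (auto simp: ordered_seqs_def)
  qed
  then show ?thesis unfolding path_event_def by blast
qed

definition switch_seq :: "nat \<Rightarrow> real \<Rightarrow> real \<Rightarrow> nat \<Rightarrow> 'a \<Rightarrow> nat \<Rightarrow> real" where
  "switch_seq n s t j \<omega> = pad t (SOME us. length us = n \<and> switches (\<lambda>r. eps r \<omega>) j s t us)"

lemma path_event_iff:
  assumes "s \<le> t" "j \<in> {0, 1}" "\<omega> \<in> path_event n s t j D"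
  shows "\<omega> \<in> path_event n s t j D' \<longleftrightarrow> switch_seq n s t j \<omega> \<in> D'"
proof -
  obtain us where us: "\<omega> \<in> space M" "length us = n" "switches (\<lambda>r. eps r \<omega>) j s t us"
    using assms by (auto simp: path_event_def)
  have unique: "vs = us" if "switches (\<lambda>r. eps r \<omega>) j s t vs" for vs
    by (rule switches_unique[OF that us(3) assms(1,2)])
  have "(SOME us. length us = n \<and> switches (\<lambda>r. eps r \<omega>) j s t us) = us"
  proof (rule some_equality)
    show "length us = n \<and> switches (\<lambda>r. eps r \<omega>) j s t us" using us by blast
  qed (use unique in blast)
  then have seq: "switch_seq n s t j \<omega> = pad t us" by (simp add: switch_seq_def)
  show ?thesis
  proof
    assume "\<omega> \<in> path_event n s t j D'"
    then obtain vs where "switches (\<lambda>r. eps r \<omega>) j s t vs" "pad t vs \<in> D'"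
      unfolding path_event_def by blast
    with unique seq show "switch_seq n s t j \<omega> \<in> D'" by metis
  next
    assume "switch_seq n s t j \<omega> \<in> D'"
    then show "\<omega> \<in> path_event n s t j D'"
      using us unfolding seq path_event_def by blast
  qed
qed

text \<open>Both sides are finite measures in the set of sequences. On windows they agree by
  \<open>prob_one_switch\<close> and the hypothesis for a restart at \<open>c\<close>; there it is
  used with the past event \<open>A \<inter> one_switch s c j\<close>, and therefore it has to hold
  for all past events and all starting times.\<close>

lemma jump_law_step:
  assumes st: "0 \<le> s" "s < t" and A: "A \<in> past M eps s" and j: "j \<in> {0, 1}" and D: "D \<in> sets seqs"
    and IH: "\<And>s j A D. 0 \<le> s \<Longrightarrow> s \<le> t \<Longrightarrow> A \<in> past M eps s \<Longrightarrow> j \<in> {0, 1} \<Longrightarrow> D \<in> sets seqs \<Longrightarrow>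
      path_event n s t j D \<in> events \<and> emeasure M (A \<inter> path_event n s t j D) =
        emeasure M (A \<inter> {\<omega> \<in> space M. eps s \<omega> = j}) * jump_law n (lam j) (lam (1 - j)) s t (indicator D)"
  shows "path_event (Suc n) s t j D \<in> events \<and> emeasure M (A \<inter> path_event (Suc n) s t j D) =
        emeasure M (A \<inter> {\<omega> \<in> space M. eps s \<omega> = j}) * jump_law (Suc n) (lam j) (lam (1 - j)) s t (indicator D)"
proof -
  let ?\<Omega> = "ordered_seqs s t" and ?E = "windows s t"
  let ?c = "emeasure M (A \<inter> {\<omega> \<in> space M. eps s \<omega> = j})"
  define a b where "a = lam j" and "b = lam (1 - j)"
  have j': "1 - j \<in> {0, 1}" "1 - (1 - j) = j" using j by auto
  have ab: "a > 0" "b > 0" using lam_pos j j' by (auto simp: a_def b_def)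
  have Aev: "A \<in> events" using A past_events by auto
  have win: "path_event (Suc n) s t j X \<in> events \<and>
      emeasure M (A \<inter> path_event (Suc n) s t j X) = ?c * jump_law (Suc n) a b s t (indicator X)" if XE: "X \<in> ?E" for X
  proof -
    obtain c D where X: "X = first_window s c D" and c: "s < c" "c \<le> t" and D: "D \<in> sets seqs" "\<forall>w\<in>D. c < w 0"
      using XE unfolding windows_def by blast
    define B where "B = A \<inter> one_switch s c j"
    have B: "B \<in> past M eps c"
      unfolding B_def using st c j by (intro past_Int past_mono[OF _ A] one_switch_past) auto
    have Bc: "B \<inter> {\<omega> \<in> space M. eps c \<omega> = 1 - j} = B"
      by (auto simp: B_def one_switch_def)
    have one: "one_switch s c j \<in> events" using st c j by (intro past_events[OF one_switch_past]) auto
    note ih = IH[of c B "1 - j" D, OF _ c(2) B j'(1) D(1)]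
    have eq: "path_event (Suc n) s t j X = one_switch s c j \<inter> path_event n c t (1 - j) D"
      unfolding X using c D by (intro path_event_first_window) auto
    have "emeasure M (A \<inter> path_event (Suc n) s t j X) = emeasure M (B \<inter> path_event n c t (1 - j) D)"
      unfolding eq B_def by (simp add: Int_assoc)
    also have "\<dots> = emeasure M B * jump_law n b a c t (indicator D)"
      using ih st c unfolding Bc j'(2) a_def b_def by simp
    also have "emeasure M B = ?c * ennreal (one_jump a b (c - s))"
      unfolding B_def emeasure_eq_measure a_def b_def
      using st c A j one_jump_pos[of "lam j" "c - s" "lam (1 - j)"] lam_pos[OF j]
      by (simp add: prob_one_switch ennreal_mult'')
    finally show ?thesis
      using ih st c one D ab unfolding eq[symmetric] X
      by (simp add: jump_law_window mult.assoc) (simp add: eq[unfolded X] sets.Int)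
  qed
  have ev_all: "path_event (Suc n) s t j ?\<Omega> \<in> events"
  proof -
    have "path_event (Suc n) s t j ?\<Omega> = (\<Union>q\<in>cuts s t. path_event (Suc n) s t j (first_window s q {w. q < w 0}))"
      unfolding ordered_seqs_cover path_event_def by blast
    moreover have "first_window s q {w. q < w 0} \<in> ?E" if "q \<in> cuts s t" for q
      unfolding windows_def using that by (intro CollectI exI[of _ q] exI[of _ "{w. q < w 0}"]) (auto simp: cuts_def)
    ultimately show ?thesis using win by (auto intro!: sets.countable_UN'' countable_cuts)
  qed
  have in_space: "path_event (Suc n) s t j X \<subseteq> space M" for X
    by (auto simp: path_event_def)
  let ?S = "sigma ?\<Omega> ?E"
  let ?\<tau> = "switch_seq (Suc n) s t j"
  have \<tau>: "\<omega> \<in> path_event (Suc n) s t j X \<longleftrightarrow> ?\<tau> \<omega> \<in> X" if "\<omega> \<in> path_event (Suc n) s t j ?\<Omega>" for \<omega> X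
    using path_event_iff[OF _ j that] st by auto
  have sub: "path_event (Suc n) s t j X \<subseteq> path_event (Suc n) s t j ?\<Omega>" for X
    using path_event_ordered[of n s t j X] unfolding path_event_def by blast
  \<comment> \<open>\<open>?\<tau>\<close> has a meaning only on paths with the right number of
    switchings, and measurability is known so far only for windows; hence the restricted space and
    the generated sigma-algebra as target.\<close>
  have meas: "?\<tau> \<in> restrict_space M (C \<inter> path_event (Suc n) s t j ?\<Omega>) \<rightarrow>\<^sub>M ?S" if C: "C \<in> events" for C
  proof (rule measurable_measure_of[OF windows_subset])
    show "?\<tau> \<in> space (restrict_space M (C \<inter> path_event (Suc n) s t j ?\<Omega>)) \<rightarrow> ?\<Omega>"
      using \<tau> by (auto simp: space_restrict_space)
    fix X assume X: "X \<in> ?E"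
    have "?\<tau> -` X \<inter> space (restrict_space M (C \<inter> path_event (Suc n) s t j ?\<Omega>)) = C \<inter> path_event (Suc n) s t j X"
      using \<tau> sub[of X] in_space[of X] by (auto simp: space_restrict_space)
    then show "?\<tau> -` X \<inter> space (restrict_space M (C \<inter> path_event (Suc n) s t j ?\<Omega>)) \<in>
        sets (restrict_space M (C \<inter> path_event (Suc n) s t j ?\<Omega>))"
      using win[OF X] C ev_all sub[of X] by (auto simp: sets_restrict_space_iff)
  qed
  have \<tau>_event: "path_event (Suc n) s t j X = ?\<tau> -` X \<inter> space (restrict_space M (space M \<inter> path_event (Suc n) s t j ?\<Omega>))" for X
    using \<tau> sub[of X] in_space[of X] by (auto simp: space_restrict_space)
  define N1 where "N1 = distr (restrict_space M (A \<inter> path_event (Suc n) s t j ?\<Omega>)) ?S ?\<tau>"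
  \<comment> \<open>Holding times that are not positive can lead out of \<open>?\<Omega>\<close>.
    They are cut off here so that the map takes values in \<open>?\<Omega>\<close>; that nothing is
    lost is shown at the end, when \<open>X\<close> is replaced by \<open>D\<close>.\<close>
  define V where "V = {h. exactly (Suc n) a b (t - s) h \<and> jump_times (Suc n) a b s t h \<in> ?\<Omega>}"
  have V: "V \<in> sets holding"
  proof -
    have "{h \<in> space holding. exactly (Suc n) a b (t - s) h \<and> jump_times (Suc n) a b s t h \<in> ?\<Omega>} \<in> sets holding"
      by measurable
    then show ?thesis by (simp add: V_def)
  qed
  have times: "jump_times (Suc n) a b s t \<in> restrict_space holding V \<rightarrow>\<^sub>M ?S"
  proof (rule measurable_measure_of[OF windows_subset])
    show "jump_times (Suc n) a b s t \<in> space (restrict_space holding V) \<rightarrow> ?\<Omega>"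
      by (auto simp: space_restrict_space V_def)
    fix X assume "X \<in> ?E"
    then have [measurable]: "X \<in> sets seqs" unfolding windows_def by auto
    have "jump_times (Suc n) a b s t -` X \<inter> space (restrict_space holding V) =
        {h \<in> space holding. jump_times (Suc n) a b s t h \<in> X} \<inter> V"
      by (auto simp: space_restrict_space)
    moreover have "{h \<in> space holding. jump_times (Suc n) a b s t h \<in> X} \<in> sets holding" by measurable
    ultimately show "jump_times (Suc n) a b s t -` X \<inter> space (restrict_space holding V) \<in> sets (restrict_space holding V)"
      using V by (auto simp: sets_restrict_space_iff)
  qed
  define N2 where "N2 = scale_measure ?c (distr (restrict_space holding V) ?S (jump_times (Suc n) a b s t))"
  have N1: "emeasure N1 X = emeasure M (A \<inter> path_event (Suc n) s t j X)" if "X \<in> sets ?S" for X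
  proof -
    have "emeasure N1 X = emeasure (restrict_space M (A \<inter> path_event (Suc n) s t j ?\<Omega>))
        (?\<tau> -` X \<inter> space (restrict_space M (A \<inter> path_event (Suc n) s t j ?\<Omega>)))"
      unfolding N1_def by (rule emeasure_distr[OF meas[OF Aev] that])
    also have "?\<tau> -` X \<inter> space (restrict_space M (A \<inter> path_event (Suc n) s t j ?\<Omega>)) = A \<inter> path_event (Suc n) s t j X"
      using \<tau> sub[of X] in_space[of X] by (auto simp: space_restrict_space)
    also have "emeasure (restrict_space M (A \<inter> path_event (Suc n) s t j ?\<Omega>)) (A \<inter> path_event (Suc n) s t j X) =
        emeasure M (A \<inter> path_event (Suc n) s t j X)"
      using sub[of X] Aev ev_all by (intro emeasure_restrict_space) auto
    finally show ?thesis .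
  qed
  have N2: "emeasure N2 X = ?c * jump_law (Suc n) a b s t (indicator X)"
    if X: "X \<in> sets ?S" "X \<in> sets seqs" for X
  proof -
    note [measurable] = X(2)
    have XO: "X \<subseteq> ?\<Omega>" using sets.sets_into_space[OF X(1)] by (simp add: sigma_windows)
    have "emeasure N2 X = ?c * emeasure (restrict_space holding V) (jump_times (Suc n) a b s t -` X \<inter> space (restrict_space holding V))"
      unfolding N2_def by (simp add: emeasure_distr[OF times X(1)] del: jump_times.simps)
    also have "jump_times (Suc n) a b s t -` X \<inter> space (restrict_space holding V) =
        {h. exactly (Suc n) a b (t - s) h \<and> jump_times (Suc n) a b s t h \<in> X}" (is "_ = ?H")
      using XO by (auto simp: space_restrict_space V_def simp del: exactly.simps jump_times.simps)
    also have "emeasure (restrict_space holding V) ?H = emeasure holding ?H"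
      using V XO by (intro emeasure_restrict_space) (auto simp: V_def simp del: exactly.simps jump_times.simps)
    also have "\<dots> = jump_law (Suc n) a b s t (indicator X)"
    proof -
      have "?H = {h \<in> space holding. exactly (Suc n) a b (t - s) h \<and> jump_times (Suc n) a b s t h \<in> X}" by simp
      also have "\<dots> \<in> sets holding" by measurable
      finally have "emeasure holding ?H = (\<integral>\<^sup>+h. indicator ?H h \<partial>holding)"
        by (rule nn_integral_indicator[symmetric])
      also have "\<dots> = jump_law (Suc n) a b s t (indicator X)"
        unfolding jump_law_def by (intro nn_integral_cong) (auto simp: indicator_def)
      finally show ?thesis .
    qed
    finally show ?thesis .
  qed
  have window_seqs: "X \<in> sets seqs" if "X \<in> ?E" for X using that unfolding windows_def by auto
  have "N1 = N2"
  proof (rule measure_eqI_generator_eq[OF Int_stable_windows windows_subset])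
    show "emeasure N1 X = emeasure N2 X" if "X \<in> ?E" for X
      using win[OF that] N1[of X] N2[of X] window_seqs[OF that] that by (simp add: sigma_windows sigma_sets.Basic)
    show "sets N1 = sigma_sets ?\<Omega> ?E" "sets N2 = sigma_sets ?\<Omega> ?E"
      by (simp_all add: N1_def N2_def sigma_windows)
    let ?q = "from_nat_into (cuts s t)"
    have ne: "cuts s t \<noteq> {}" using st by (auto simp: cuts_def)
    show "range (\<lambda>i. first_window s (?q i) {w. ?q i < w 0}) \<subseteq> ?E"
    proof safe
      fix i
      have "?q i \<in> cuts s t" by (rule from_nat_into[OF ne])
      then show "first_window s (?q i) {w. ?q i < w 0} \<in> ?E"
        unfolding windows_def by (intro CollectI exI[of _ "?q i"] exI[of _ "{w. ?q i < w 0}"]) (auto simp: cuts_def)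
    qed
    show "(\<Union>i. first_window s (?q i) {w. ?q i < w 0}) = ?\<Omega>"
    proof -
      have "(\<Union>i. first_window s (?q i) {w. ?q i < w 0}) = (\<Union>q\<in>range ?q. first_window s q {w. q < w 0})"
        by simp
      also have "range ?q = cuts s t" by (rule range_from_nat_into[OF ne countable_cuts])
      finally show ?thesis by (simp only: ordered_seqs_cover)
    qed
    have "emeasure N1 X < \<infinity>" for X
    proof (cases "X \<in> sets N1")
      case True
      then have "emeasure N1 X \<le> emeasure M (A \<inter> path_event (Suc n) s t j X)"
        using N1[of X] by (simp add: N1_def)
      also have "\<dots> \<le> 1" by (rule emeasure_le_1)
      finally show ?thesis by (auto simp: less_top[symmetric] top_unique)
    qed (simp add: emeasure_notin_sets)
    then show "emeasure N1 (first_window s (?q i) {w. ?q i < w 0}) \<noteq> \<infinity>" for i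
      by (auto simp: less_top)
  qed
  define X where "X = D \<inter> ?\<Omega>"
  have X: "X \<in> sets ?S" "X \<in> sets seqs"
    using generated_ordered[OF D] D by (auto simp: sigma_windows X_def)
  have "path_event (Suc n) s t j X \<in> events"
  proof -
    have "space M \<in> events" by simp
    from measurable_sets[OF meas[OF this] X(1)] show ?thesis
      using ev_all unfolding \<tau>_event[of X, symmetric] by (auto simp: sets_restrict_space_iff)
  qed
  moreover have "emeasure M (A \<inter> path_event (Suc n) s t j X) = ?c * jump_law (Suc n) a b s t (indicator X)"
    using N1[OF X(1)] N2[OF X] \<open>N1 = N2\<close> by simp
  moreover have "jump_law (Suc n) a b s t (indicator X) = jump_law (Suc n) a b s t (indicator D)"
  proof -
    have "jump_law (Suc n) a b s t (indicator X) =
        (\<integral>\<^sup>+u\<in>{0..t - s}. ennreal (a * exp (- a * u)) * jump_law n b a (s + u) t (\<lambda>w. indicator X (case_nat (s + u) w)) \<partial>lborel)"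
      by (rule jump_law_Suc[OF ab(1)]) (use X in auto)
    also have "\<dots> = (\<integral>\<^sup>+u\<in>{0..t - s}. ennreal (a * exp (- a * u)) * jump_law n b a (s + u) t (\<lambda>w. indicator D (case_nat (s + u) w)) \<partial>lborel)"
    proof (intro nn_integral_cong_AE, use AE_lborel_singleton[of 0] in eventually_elim)
      case (elim u)
      note [measurable] = D X(2)
      show ?case
      proof (cases "u \<in> {0..t - s}")
        case True
        then have "jump_law n b a (s + u) t (\<lambda>w. indicator X (case_nat (s + u) w)) =
            jump_law n b a (s + u) t (\<lambda>w. indicator D (case_nat (s + u) w))"
          using ab elim by (intro jump_law_cong) (auto simp: X_def ordered_seqs_def indicator_def)
        then show ?thesis by simp
      qed simp
    qed
    also have "\<dots> = jump_law (Suc n) a b s t (indicator D)"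
      by (rule jump_law_Suc[OF ab(1), symmetric]) (use D in auto)
    finally show ?thesis .
  qed
  ultimately show ?thesis unfolding X_def path_event_ordered a_def b_def by simp
qed

theorem path_event_law:
  assumes "0 \<le> s" "s \<le> t" "A \<in> past M eps s" "j \<in> {0, 1}" "D \<in> sets seqs"
  shows "path_event n s t j D \<in> events \<and> emeasure M (A \<inter> path_event n s t j D) =
        emeasure M (A \<inter> {\<omega> \<in> space M. eps s \<omega> = j}) * jump_law n (lam j) (lam (1 - j)) s t (indicator D)"
  using assms
proof (induction n arbitrary: s A j D)
  case 0
  have "path_event 0 s t j D = (if (\<lambda>_. t + 1) \<in> D then hold s t j else {})"
    by (auto simp: path_event_def hold_def)
  then show ?case
    using 0 past_events[OF hold_past[of s t j]] prob_hold[of s t A j] lam_pos[of j]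
    by (auto simp: jump_law_0 emeasure_eq_measure ennreal_mult'')
next
  case (Suc n)
  show ?case
  proof (cases "s = t")
    \<comment> \<open>No switching fits into an interval of length 0, so both sides vanish.\<close>
    case True
    have "jump_law (Suc n) (lam j) (lam (1 - j)) t t (indicator D) = 0"
    proof -
      have "jump_law (Suc n) (lam j) (lam (1 - j)) t t (indicator D) = (\<integral>\<^sup>+u\<in>{0..t - t}. ennreal (lam j * exp (- lam j * u)) *
          jump_law n (lam (1 - j)) (lam j) (t + u) t (\<lambda>w. indicator D (case_nat (t + u) w)) \<partial>lborel)"
        by (rule jump_law_Suc) (use Suc.prems lam_pos in auto)
      also have "\<dots> = (\<integral>\<^sup>+(u::real). 0 \<partial>lborel)"
        by (intro nn_integral_cong_AE, use AE_lborel_singleton[of 0] in eventually_elim) auto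
      finally show ?thesis by simp
    qed
    then show ?thesis using True path_event_empty[of t s n j D] by simp
  next
    case False
    then show ?thesis using Suc by (intro jump_law_step) auto
  qed
qed

end

section \<open>Paths of the telegraph process\<close>

text \<open>The triple of \<open>hold_triple\<close> computed from absolute switching times, which
  is the form in which a path of the process presents them.\<close>

primrec seq_triple :: "nat \<Rightarrow> real \<Rightarrow> real \<Rightarrow> real \<Rightarrow> real \<Rightarrow> (nat \<Rightarrow> real) \<Rightarrow> real \<times> real \<times> real" where
  "seq_triple 0 p q s t w = comb p (t - s) (0, 0, 0)"
| "seq_triple (Suc n) p q s t w = comb p (w 0 - s) (seq_triple n q p (w 0) t (tail w))"

lemma measurable_seq_triple [measurable (raw)]:
  assumes "s \<in> borel_measurable N" "w \<in> N \<rightarrow>\<^sub>M seqs"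
  shows "(\<lambda>x. seq_triple n p q (s x) t (w x)) \<in> borel_measurable N"
  using assms
proof (induction n arbitrary: p q s w)
  case 0
  note [measurable] = 0
  show ?case by simp
next
  case (Suc n)
  note [measurable] = Suc.prems
  have [measurable]: "(\<lambda>x. seq_triple n q p (w x 0) t (tail (w x))) \<in> borel_measurable N"
    by (rule Suc.IH; measurable)
  show ?case by simp
qed

lemma seq_triple_jump_times: "seq_triple n p q s t (jump_times n a b s t h) = hold_triple n a b p q (t - s) h"
  by (induction n arbitrary: p q s a b h) (auto simp: diff_diff_eq)

lemma jump_law_seq_triple: "jump_law n a b s t (\<lambda>w. f (seq_triple n p q s t w)) = W n a b p q (t - s) f"
  by (simp add: jump_law_def W_def seq_triple_jump_times cong: if_cong)

text \<open>The first component is the time elapsed since \<open>s\<close>, to match the recursion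
  of \<open>comb\<close>.\<close>

definition first_min :: "(real \<Rightarrow> real) \<Rightarrow> real \<Rightarrow> real \<Rightarrow> real \<times> real \<times> real \<Rightarrow> bool" where
  "first_min Y s t = (\<lambda>(a, y, x). Y t = x \<and> 0 \<le> a \<and> s + a \<le> t \<and> Y (s + a) = y \<and>
     (\<forall>r\<in>{s..t}. y \<le> Y r) \<and> (\<forall>r\<in>{s..<s + a}. y < Y r))"

text \<open>At the right end \<open>u\<close> the velocity is already that of the next state; one
  point does not affect the integral.\<close>

lemma has_integral_const_before:
  fixes f :: "real \<Rightarrow> real"
  assumes "s \<le> u" "\<And>r. s \<le> r \<Longrightarrow> r < u \<Longrightarrow> f r = p"
  shows "(f has_integral p * (u - s)) {s..u}"
proof (rule has_integral_spike_finite[of "{u}"])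
  show "((\<lambda>_. p) has_integral p * (u - s)) {s..u}"
    using has_integral_const_real[of p s u] assms by (simp add: mult.commute)
qed (use assms in auto)

text \<open>\<open>comb\<close> is the rule by which the first minimum changes when a linear piece
  is put in front of a path. Nonzero velocities make each piece strictly monotone, so that the time
  of the minimum is the first one.\<close>

lemma switches_first_min:
  assumes "switches e j s t us" "s \<le> t" "j \<in> {0, 1}" "gam 0 \<noteq> 0" "gam 1 \<noteq> 0"
  shows "(\<lambda>r. gam (e r)) integrable_on {s..t} \<and>
    first_min (\<lambda>r. integral {s..r} (\<lambda>x. gam (e x))) s t (seq_triple (length us) (gam j) (gam (1 - j)) s t (pad t us))"
  using assms(1-3)
proof (induction us arbitrary: j s)
  case Nil
  let ?p = "gam j"
  have p: "?p \<noteq> 0" using Nil assms by auto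
  have I: "((\<lambda>x. gam (e x)) has_integral ?p * (r - s)) {s..r}" if "s \<le> r" "r \<le> t" for r
    using that Nil by (intro has_integral_const_before) auto
  have "?p * (r - s) > ?p * (t - s)" if "?p * (t - s) < 0" "r < t" for r
    using that Nil by (auto simp: mult_less_0_iff)
  moreover have "0 \<le> ?p * (r - s)" if "\<not> ?p * (t - s) < 0" "r \<in> {s..t}" for r
    using that p Nil by (auto simp: mult_less_0_iff not_less zero_le_mult_iff)
  ultimately show ?case
    using I[of t] I Nil integral_unique[OF I]
    by (auto simp: first_min_def comb_def less_eq_real_def)
next
  case (Cons u us)
  let ?p = "gam j" and ?f = "\<lambda>x. gam (e x)"
  have u: "s < u" "u \<le> t" "\<And>r. s \<le> r \<Longrightarrow> r < u \<Longrightarrow> e r = j" "switches e (1 - j) u t us"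
    using Cons.prems by auto
  have p: "?p \<noteq> 0" using Cons.prems assms by auto
  have I: "(?f has_integral ?p * (r - s)) {s..r}" if "s \<le> r" "r \<le> u" for r
    using that u by (intro has_integral_const_before) auto
  have ii: "1 - (1 - j) = j" using Cons.prems by auto
  obtain a y x where tr: "seq_triple (length us) (gam (1 - j)) (gam j) u t (pad t us) = (a, y, x)"
    using prod_cases3 by blast
  have IH: "?f integrable_on {u..t}" "first_min (\<lambda>r. integral {u..r} ?f) u t (a, y, x)"
    using Cons.IH[of "1 - j" u] u Cons.prems unfolding ii tr by auto
  have int: "?f integrable_on {s..t}"
    using Henstock_Kurzweil_Integration.integrable_combine[of s u t ?f] I[of u] IH u by (auto simp: has_integral_integrable)
  have Y: "integral {s..r} ?f = (if r \<le> u then ?p * (r - s) else ?p * (u - s) + integral {u..r} ?f)" if "r \<in> {s..t}" for r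
  proof (cases "r \<le> u")
    case False
    have "?f integrable_on {s..r}" using int that by (rule_tac integrable_on_subinterval) auto
    then have "integral {s..r} ?f = integral {s..u} ?f + integral {u..r} ?f"
      using False u by (intro Henstock_Kurzweil_Integration.integral_combine[symmetric]) auto
    then show ?thesis using False integral_unique[OF I[of u]] u by simp
  qed (use that integral_unique[OF I[of r]] in auto)
  have Y': "integral {s..r} ?f = ?p * (u - s) + integral {u..r} ?f" if "r \<in> {u..t}" for r
    using Y[of r] that u by (cases "r = u") auto
  have F: "integral {u..t} ?f = x" "0 \<le> a" "u + a \<le> t" "integral {u..u + a} ?f = y"
    "\<And>r. r \<in> {u..t} \<Longrightarrow> y \<le> integral {u..r} ?f" "\<And>r. r \<in> {u..<u + a} \<Longrightarrow> y < integral {u..r} ?f"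
    using IH(2) unfolding first_min_def by auto
  have y0: "y \<le> 0" using F(5)[of u] u by simp
  \<comment> \<open>An ascending first segment stays nonnegative and a descending one stays above
    its own end, which in turn is not below the later minimum because
    \<open>y \<le> 0\<close>.\<close>
  have before: "?p * (u - s) + y < integral {s..r} ?f" if "?p * (u - s) + y < 0" "s \<le> r" "r < u" for r
  proof (cases "?p > 0")
    case True
    then have "0 \<le> ?p * (r - s)" using that by simp
    then show ?thesis using Y[of r] that u by auto
  next
    case False
    then have "?p * (u - s) < ?p * (r - s)" using that p by (simp add: mult_less_cancel_left)
    then show ?thesis using Y[of r] that u y0 by auto
  qed
  \<comment> \<open>As \<open>y \<le> 0\<close>, the first segment ends at a nonnegative height;
    having nonzero velocity, it ascends.\<close>
  have nonneg: "0 \<le> ?p * (r - s)" if "\<not> ?p * (u - s) + y < 0" "s \<le> r" for r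
  proof -
    have "0 \<le> ?p * (u - s)" using that y0 by simp
    then have "0 < ?p" using p u by (auto simp: zero_le_mult_iff)
    then show ?thesis using that by simp
  qed
  have split: "P r" if "r \<in> {s..t}" "\<And>r. s \<le> r \<Longrightarrow> r < u \<Longrightarrow> P r" "\<And>r. r \<in> {u..t} \<Longrightarrow> P r" for P and r :: real
    using that by (cases "r < u") auto
  have "first_min (\<lambda>r. integral {s..r} ?f) s t (comb ?p (u - s) (a, y, x))"
  proof (cases "?p * (u - s) + y < 0")
    case True
    have "?p * (u - s) + y \<le> integral {s..r} ?f" if "r \<in> {s..t}" for r
      using that
    proof (rule split)
      show "?p * (u - s) + y \<le> integral {s..r} ?f" if "r \<in> {u..t}" for r
        using Y'[OF that] F(5)[OF that] by simp
    qed (use before[OF True] in \<open>auto intro: less_imp_le\<close>)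
    moreover have "?p * (u - s) + y < integral {s..r} ?f" if "r \<in> {s..<u + a}" for r
    proof (cases "r < u")
      case False
      then show ?thesis using Y'[of r] F(3) F(6)[of r] that by auto
    qed (use before[OF True] that in auto)
    ultimately show ?thesis
      using True F(1-4) Y'[of t] Y'[of "u + a"] u by (auto simp: first_min_def comb_def)
  next
    case False
    have "0 \<le> integral {s..r} ?f" if "r \<in> {s..t}" for r
      using that
    proof (rule split)
      show "0 \<le> integral {s..r} ?f" if "s \<le> r" "r < u" for r
        using Y[of r] nonneg[OF False] that u by auto
      show "0 \<le> integral {s..r} ?f" if "r \<in> {u..t}" for r
        using Y'[OF that] F(5)[OF that] False by linarith
    qed
    then show ?thesis
      using False Y'[of t] F(1) u by (auto simp: first_min_def comb_def)
  qed
  then show ?case using int by (simp add: tr del: One_nat_def)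
qed

lemma first_min_run:
  assumes "first_min (\<lambda>u. X u \<omega>) 0 t (a, y, x)"
  shows "run_min X t \<omega> = y" "time_min X t \<omega> = a" "X t \<omega> = x"
proof -
  note F = assms[unfolded first_min_def prod.case]
  show y: "run_min X t \<omega> = y"
    unfolding run_min_def
  proof (rule cInf_eq_minimum)
    show "y \<in> (\<lambda>u. X u \<omega>) ` {0..t}" using F by (intro image_eqI[of _ _ a]) auto
  qed (use F in auto)
  show "time_min X t \<omega> = a"
    unfolding time_min_def y
  proof (rule cInf_eq_minimum)
    show "a \<in> {u \<in> {0..t}. X u \<omega> = y}" using F by auto
    show "a \<le> u" if "u \<in> {u \<in> {0..t}. X u \<omega> = y}" for u
      using F that by (force simp: not_less[symmetric])
  qed
  show "X t \<omega> = x" using F by simp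
qed

lemma run_max_uminus:
  "run_max X t \<omega> = - run_min (\<lambda>u \<omega>. - X u \<omega>) t \<omega>" "time_max X t \<omega> = time_min (\<lambda>u \<omega>. - X u \<omega>) t \<omega>"
proof -
  have "Inf ((\<lambda>u. - X u \<omega>) ` {0..t}) = - Sup ((\<lambda>u. X u \<omega>) ` {0..t})"
    by (simp add: Inf_real_def image_image)
  then show r: "run_max X t \<omega> = - run_min (\<lambda>u \<omega>. - X u \<omega>) t \<omega>"
    by (simp add: run_max_def run_min_def)
  show "time_max X t \<omega> = time_min (\<lambda>u \<omega>. - X u \<omega>) t \<omega>"
    unfolding time_max_def time_min_def r by (intro arg_cong[where f = Inf]) auto
qed

lemma telegraph_uminus: "telegraph (\<lambda>i. - gam i) eps = (\<lambda>u \<omega>. - telegraph gam eps u \<omega>)"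
  by (simp add: telegraph_def fun_eq_iff)

section \<open>Counting and existence of switchings\<close>

lemma switches_jump_set:
  assumes "switches e j s t us" "s \<le> t" "j \<in> {0, 1}"
  shows "{u. s < u \<and> u \<le> t \<and> \<not> (\<forall>\<^sub>F r in at_left u. e r = e u)} = set us \<and> distinct us \<and> (\<forall>u\<in>set us. s < u)"
  using assms
proof (induction us arbitrary: j s)
  case Nil
  have "\<forall>\<^sub>F r in at_left u. e r = e u" if "s < u" "u \<le> t" for u
    using that Nil by (auto simp: eventually_at_left_field intro!: exI[of _ s])
  then show ?case by auto
next
  case (Cons u us)
  have u: "s < u" "u \<le> t" "\<And>r. s \<le> r \<Longrightarrow> r < u \<Longrightarrow> e r = j" "switches e (1 - j) u t us"
    using Cons.prems by auto
  have eu: "e u = 1 - j" using switches_start[OF u(4,2)] .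
  have left: "\<forall>\<^sub>F r in at_left v. e r = j" if "s < v" "v \<le> u" for v
    using that u by (auto simp: eventually_at_left_field intro!: exI[of _ s])
  have "\<not> (\<forall>\<^sub>F r in at_left u. e r = e u)"
  proof
    assume "\<forall>\<^sub>F r in at_left u. e r = e u"
    with left[OF u(1) order_refl] have "\<forall>\<^sub>F r in at_left u. j = 1 - j"
      by eventually_elim (use eu in auto)
    then show False using Cons.prems by auto
  qed
  moreover have "\<forall>\<^sub>F r in at_left v. e r = e v" if "s < v" "v < u" for v
    using left[of v] u(3)[of v] that by auto
  ultimately have "{v. s < v \<and> v \<le> t \<and> \<not> (\<forall>\<^sub>F r in at_left v. e r = e v)} =
      insert u {v. u < v \<and> v \<le> t \<and> \<not> (\<forall>\<^sub>F r in at_left v. e r = e v)}"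
    using u by (auto; metis linorder_neqE_linordered_idom order.strict_trans)
  moreover have "{v. u < v \<and> v \<le> t \<and> \<not> (\<forall>\<^sub>F r in at_left v. e r = e v)} = set us \<and> distinct us \<and> (\<forall>v\<in>set us. u < v)"
    using Cons.IH[OF u(4,2)] Cons.prems by auto
  ultimately show ?case using u by auto
qed

lemma switches_extend:
  assumes "switches e j s r us" "s \<le> r" "r \<le> t" "\<forall>x\<in>{r..t}. e x = e r"
  shows "switches e j s t us"
  using assms(1,2)
proof (induction us arbitrary: j s)
  case Nil
  then have "e x = j" if "x \<in> {s..t}" for x
    using that assms(4) by (cases "x \<le> r") auto
  then show ?case by simp
qed (use assms(3) in auto)

lemma switches_append:
  assumes "switches e j s r us" "s \<le> r" "r < t" "\<forall>x\<in>{r..<t}. e x = e r" "e t \<noteq> e r" "j \<in> {0, 1}" "e t \<in> {0, 1}"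
  shows "switches e j s t (us @ [t])"
  using assms(1,2,6)
proof (induction us arbitrary: j s)
  case Nil
  then have "e x = j" if "x \<in> {s..<t}" for x
    using that assms(4) by (cases "x \<le> r") auto
  moreover have "e r = j" using Nil by auto
  ultimately show ?case using Nil assms(3,5,7) by auto
qed (use assms(3) in auto)

context switching
begin

text \<open>Let \<open>u\<close> be the supremum of the times up to which a finite list describes
  the path. The left limit at \<open>u\<close> makes the path constant just before \<open>u\<close>,
  so a list reaches \<open>u\<close>, extended by \<open>u\<close> itself if the state changes
  there. Right continuity then forbids \<open>u < t\<close>.\<close>

lemma switches_exist:
  assumes "\<omega> \<in> space M" "t \<ge> 0"
  shows "\<exists>us. switches (\<lambda>r. eps r \<omega>) (eps 0 \<omega>) 0 t us"
proof -
  let ?e = "\<lambda>r. eps r \<omega>"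
  let ?P = "\<lambda>r. \<exists>us. switches ?e (eps 0 \<omega>) 0 r us"
  have st: "?e r \<in> {0, 1}" if "0 \<le> r" for r using states[of r \<omega>] assms that by simp
  define S where "S = {r \<in> {0..t}. ?P r}"
  define u where "u = Sup S"
  have "?P 0" by (rule exI[of _ "[]"]) simp
  then have S0: "0 \<in> S" using assms by (simp add: S_def)
  have bdd: "bdd_above S" by (rule bdd_aboveI[of _ t]) (simp add: S_def)
  have u: "0 \<le> u" "u \<le> t"
    unfolding u_def using S0 bdd by (auto intro: cSup_upper cSup_least simp: S_def)
  have ext: "?P v" if "?P r" "0 \<le> r" "r \<le> v" "\<forall>x\<in>{r..v}. ?e x = ?e r" for r v
    using switches_extend that by blast
  have Pu: "?P u"
  proof (cases "u = 0")
    case False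
    then obtain j where "\<forall>\<^sub>F r in at_left u. ?e r = j"
      using left_limits[of u \<omega>] u assms by auto
    then obtain b where b: "b < u" "\<And>r. b < r \<Longrightarrow> r < u \<Longrightarrow> ?e r = j"
      by (auto simp: eventually_at_left_field)
    obtain r where r: "r \<in> S" "max b 0 < r \<or> r = u"
      using less_cSupD[of S "max b 0"] S0 b False u unfolding u_def
      by (metis empty_iff max_less_iff_conj order_le_less)
    have "r \<le> u" unfolding u_def using r bdd by (intro cSup_upper)
    show ?thesis
    proof (cases "r = u")
      case False
      then have ru: "b < r" "0 \<le> r" "r < u" using r \<open>r \<le> u\<close> by auto
      have const: "\<forall>x\<in>{r..<u}. ?e x = ?e r" using b(2) ru by auto
      obtain us where us: "switches ?e (eps 0 \<omega>) 0 r us" using r by (auto simp: S_def)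
      show ?thesis
      proof (cases "?e u = ?e r")
        case True
        have "\<forall>x\<in>{r..u}. ?e x = ?e r"
        proof
          show "?e x = ?e r" if "x \<in> {r..u}" for x
          proof (cases "x = u")
            case False
            then show ?thesis using that by (intro bspec[OF const]) auto
          qed (use True in simp)
        qed
        moreover have "?P r" using us by blast
        ultimately show ?thesis using ext ru by (meson less_imp_le)
      next
        case False
        have "switches ?e (eps 0 \<omega>) 0 u (us @ [u])"
          by (rule switches_append[OF us ru(2,3) const False]) (use st u in auto)
        then show ?thesis by blast
      qed
    qed (use r in \<open>auto simp: S_def\<close>)
  qed (use \<open>?P 0\<close> in simp)
  have "u = t"
  proof (rule ccontr)
    assume "u \<noteq> t"
    then have "u < t" using u by simp
    obtain b where b: "b > u" "\<And>r. u < r \<Longrightarrow> r < b \<Longrightarrow> ?e r = ?e u"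
      using right_continuous[of u \<omega>] assms u by (auto simp: eventually_at_right_field)
    obtain v where v: "u < v" "v < min b t" using dense[of u "min b t"] b \<open>u < t\<close> by auto
    have "\<forall>x\<in>{u..v}. ?e x = ?e u"
    proof
      show "?e x = ?e u" if "x \<in> {u..v}" for x
        using that b(2)[of x] v by (cases "x = u") auto
    qed
    from ext[OF Pu u(1) less_imp_le[OF v(1)] this] have "?P v" .
    then have "v \<in> S" using v u by (simp add: S_def)
    then have "v \<le> u" unfolding u_def using bdd by (intro cSup_upper)
    then show False using v by simp
  qed
  then show ?thesis using Pu by simp
qed

lemma num_switch_eq:
  assumes "\<omega> \<in> space M" "t \<ge> 0" "switches (\<lambda>r. eps r \<omega>) j 0 t us" "j \<in> {0, 1}"
  shows "num_switch eps t \<omega> = length us"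
  using switches_jump_set[OF assms(3,2,4)] unfolding num_switch_def by (simp add: distinct_card)

end

section \<open>Identification of the explicit densities\<close>

context switching
begin

text \<open>Within one starting state the event is a \<open>path_event\<close> for a measurable set
  of sequences, and at time 0 the whole space serves as the past event. Conditioning cancels the
  probability of the start.\<close>

lemma min_law:
  assumes t: "t \<ge> 0" and i: "i \<in> {0, 1}" and start: "emeasure M (starts_at M eps i) > 0"
    and gam: "gam 0 \<noteq> 0" "gam 1 \<noteq> 0" and C: "C \<in> sets borel"
  shows "emeasure (cond_start M eps i) {\<omega> \<in> space M. (time_min (telegraph gam eps) t \<omega>,
      run_min (telegraph gam eps) t \<omega>, telegraph gam eps t \<omega>) \<in> C \<and> num_switch eps t \<omega> = n} =
    W n (lam i) (lam (1 - i)) (gam i) (gam (1 - i)) t (indicator C)"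
proof -
  define D where "D j = {w. seq_triple n (gam j) (gam (1 - j)) 0 t w \<in> C}" for j
  have D [measurable]: "D j \<in> sets seqs" for j
  proof -
    note [measurable] = C
    have "{w \<in> space seqs. seq_triple n (gam j) (gam (1 - j)) 0 t w \<in> C} \<in> sets seqs" by measurable
    then show ?thesis by (simp add: D_def space_PiM)
  qed
  let ?Ev = "{\<omega> \<in> space M. (time_min (telegraph gam eps) t \<omega>,
      run_min (telegraph gam eps) t \<omega>, telegraph gam eps t \<omega>) \<in> C \<and> num_switch eps t \<omega> = n}"
  have ev: "starts_at M eps j \<inter> ?Ev = path_event n 0 t j (D j)" if j: "j \<in> {0, 1}" for j
  proof (intro equalityI subsetI)
    fix \<omega> assume w: "\<omega> \<in> starts_at M eps j \<inter> ?Ev"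
    then have sp: "\<omega> \<in> space M" and "eps 0 \<omega> = j" by (auto simp: starts_at_def)
    with switches_exist[OF sp t] obtain us where us: "switches (\<lambda>r. eps r \<omega>) j 0 t us" by auto
    obtain a y x where tr: "seq_triple (length us) (gam j) (gam (1 - j)) 0 t (pad t us) = (a, y, x)"
      using prod_cases3 by blast
    have "first_min (\<lambda>u. telegraph gam eps u \<omega>) 0 t (a, y, x)"
      using switches_first_min[OF us t j gam] unfolding tr telegraph_def by blast
    from first_min_run[of "telegraph gam eps", OF this] num_switch_eq[OF sp t us j] w
    show "\<omega> \<in> path_event n 0 t j (D j)"
      using us sp tr by (auto simp: path_event_def D_def)
  next
    fix \<omega> assume "\<omega> \<in> path_event n 0 t j (D j)"
    then obtain us where sp: "\<omega> \<in> space M" and us: "length us = n" "switches (\<lambda>r. eps r \<omega>) j 0 t us" "pad t us \<in> D j"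
      by (auto simp: path_event_def)
    obtain a y x where tr: "seq_triple (length us) (gam j) (gam (1 - j)) 0 t (pad t us) = (a, y, x)"
      using prod_cases3 by blast
    have "first_min (\<lambda>u. telegraph gam eps u \<omega>) 0 t (a, y, x)"
      using switches_first_min[OF us(2) t j gam] unfolding tr telegraph_def by blast
    from first_min_run[of "telegraph gam eps", OF this] num_switch_eq[OF sp t us(2) j] switches_start[OF us(2) t]
    show "\<omega> \<in> starts_at M eps j \<inter> ?Ev"
      using us sp tr by (auto simp: D_def starts_at_def)
  qed
  have top: "space M \<in> past M eps 0"
    unfolding past_def by (rule sigma_sets_top)
  \<comment> \<open>Measurability of the event is obtained from both starting states together; the
    conditional measure is defined through it.\<close>
  have "?Ev = (\<Union>j\<in>{0, 1}. starts_at M eps j \<inter> ?Ev)"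
    using states[of 0] by (auto simp: starts_at_def)
  also have "\<dots> = path_event n 0 t 0 (D 0) \<union> path_event n 0 t 1 (D 1)"
    using ev[of 0] ev[of 1] by auto
  also have "\<dots> \<in> events"
    using path_event_law[OF order_refl t top _ D] by (intro sets.Un) auto
  finally have Ev: "?Ev \<in> events" .
  have st: "starts_at M eps i = {\<omega> \<in> space M. eps 0 \<omega> = i}" by (simp add: starts_at_def)
  have sti: "starts_at M eps i \<in> events" unfolding st by (rule past_events[OF past_basic]) auto
  have "emeasure (cond_start M eps i) ?Ev = emeasure M (starts_at M eps i \<inter> ?Ev) / emeasure M (starts_at M eps i)"
    unfolding cond_start_def by (rule emeasure_uniform_measure[OF sti Ev])
  also have "emeasure M (starts_at M eps i \<inter> ?Ev) = emeasure M (space M \<inter> path_event n 0 t i (D i))"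
    unfolding ev[OF i] by (rule arg_cong[where f = "emeasure M"]) (auto simp: path_event_def)
  also have "\<dots> = emeasure M (starts_at M eps i) * jump_law n (lam i) (lam (1 - i)) 0 t (indicator (D i))"
  proof -
    have "space M \<inter> {\<omega> \<in> space M. eps 0 \<omega> = i} = {\<omega> \<in> space M. eps 0 \<omega> = i}" by auto
    with conjunct2[OF path_event_law[OF order_refl t top i D[of i], of n]] show ?thesis
      unfolding st by metis
  qed
  also have "jump_law n (lam i) (lam (1 - i)) 0 t (indicator (D i)) = W n (lam i) (lam (1 - i)) (gam i) (gam (1 - i)) t (indicator C)"
  proof -
    have "(\<lambda>w. indicator C (seq_triple n (gam i) (gam (1 - i)) 0 t w)) = (indicator (D i) :: _ \<Rightarrow> ennreal)"
      by (auto simp: D_def indicator_def fun_eq_iff)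
    with jump_law_seq_triple[of n "lam i" "lam (1 - i)" 0 t "indicator C" "gam i" "gam (1 - i)"]
    show ?thesis by simp
  qed
  also have "emeasure M (starts_at M eps i) * W n (lam i) (lam (1 - i)) (gam i) (gam (1 - i)) t (indicator C) /
      emeasure M (starts_at M eps i) = W n (lam i) (lam (1 - i)) (gam i) (gam (1 - i)) t (indicator C)"
    using start by (subst mult.commute) (auto intro!: ennreal_mult_divide_eq)
  finally show ?thesis .
qed

lemma max_law:
  assumes "t \<ge> 0" "i \<in> {0, 1}" "emeasure M (starts_at M eps i) > 0"
    and "gam 0 \<noteq> 0" "gam 1 \<noteq> 0" and C [measurable]: "C \<in> sets borel"
  shows "emeasure (cond_start M eps i) {\<omega> \<in> space M. (time_max (telegraph gam eps) t \<omega>,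
      run_max (telegraph gam eps) t \<omega>, telegraph gam eps t \<omega>) \<in> C \<and> num_switch eps t \<omega> = n} =
    W n (lam i) (lam (1 - i)) (- gam i) (- gam (1 - i)) t (\<lambda>(s, y, x). indicator C (s, - y, - x))"
proof -
  let ?C = "{z. (fst z, - fst (snd z), - snd (snd z)) \<in> C}"
  have "?C \<in> sets borel"
  proof -
    have "{z \<in> space (borel :: (real \<times> real \<times> real) measure). (fst z, - fst (snd z), - snd (snd z)) \<in> C} \<in> sets borel"
      using C unfolding borel_prod[symmetric] by measurable
    then show ?thesis by simp
  qed
  from min_law[OF assms(1-3), of "\<lambda>i. - gam i", OF _ _ this, of n]
  show ?thesis using assms(4,5)
    by (simp add: telegraph_uminus run_max_uminus split_beta' indicator_def[abs_def])
qed

end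

section \<open>The ballot densities in explicit form\<close>

lemma dens_odd:
  assumes "U > 0" "V > 0" "0 < x" "x < U * r"
  defines "A \<equiv> (x + V * r) / (U + V)" and "D \<equiv> (U * r - x) / (U + V)"
  shows "dens (Suc (2 * m)) a b U V r x =
    (A * D) ^ m / (fact m)\<^sup>2 * ((x + V / (real m + 1) * D) / (U * A)) * (exp (- a * A - b * D) / (U + V))"
proof -
  have D: "D > 0" using assms by (simp add: D_def)
  have eq: "A - x / U = V / U * D" unfolding A_def D_def using assms by (intro time_up_minus)
  \<comment> \<open>With this relation the ballot factor
    \<open>1 - m * V * D / ((m + 1) * (U * A))\<close> takes the form
    \<open>(x + V / (m + 1) * D) / (U * A)\<close> of the explicit formulas.\<close>
  have x: "x = U * A - V * D" using eq assms(1) by (simp add: field_simps)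
  have "0 < x / U" "0 \<le> V / U * D" using assms D by auto
  then have A: "A > 0" using eq by linarith
  have "ballot (V / U) (Suc (2 * m)) A D = (A * D) ^ m / (fact m)\<^sup>2 * ((x + V / (real m + 1) * D) / (U * A))"
  proof (cases m)
    case 0
    then show ?thesis using A assms(1) by (simp add: x ballot_def)
  next
    case (Suc k)
    have "real m * (V / U) * A ^ (m - 1) * D ^ (m + 1) / (fact m * fact (m + 1)) =
        A ^ m * D ^ m / (fact m)\<^sup>2 * (real m * V * D / ((real m + 1) * (U * A)))"
    proof -
      have "c * (V / U) * P * (D * Q) / (F * (N * F)) = (A * P) * Q / F\<^sup>2 * (c * V * D / (N * (U * A)))"
        if "F \<noteq> 0" "N \<noteq> 0" for c P Q F N :: real
        using A assms(1) that by (simp add: field_simps power2_eq_square)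
      from this[of "fact m" "real m + 1" "real m" "A ^ k" "D ^ m"] show ?thesis
        by (simp add: Suc add.commute)
    qed
    moreover have "(x + V / (real m + 1) * D) / (U * A) = 1 - real m * V * D / ((real m + 1) * (U * A))"
    proof -
      have "(x + V / N * D) / (U * A) = 1 - (N - 1) * V * D / (N * (U * A))" if "N \<noteq> 0" for N :: real
        using A assms(1) that by (simp add: x field_simps)
      from this[of "real m + 1"] show ?thesis by simp
    qed
    ultimately show ?thesis
      unfolding ballot_odd by (simp add: power_mult_distrib right_diff_distrib)
  qed
  then show ?thesis using assms(3,4) by (simp add: dens_def A_def[symmetric] D_def[symmetric])
qed

lemma dens_even:
  assumes "U > 0" "V > 0" "0 < x" "x < U * r"
  defines "A \<equiv> (x + V * r) / (U + V)" and "D \<equiv> (U * r - x) / (U + V)"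
  shows "dens (Suc (Suc (2 * m))) a b U V r x =
    (A * D) ^ m / (fact m * fact (m + 1)) * (x / U) * (exp (- a * A - b * D) / (U + V))"
proof -
  have eq: "A - x / U = V / U * D" unfolding A_def D_def using assms by (intro time_up_minus)
  have "ballot (V / U) (Suc (Suc (2 * m))) A D = A ^ m * D ^ m * (A - V / U * D) / (fact m * fact (m + 1))"
    unfolding ballot_even by (simp add: algebra_simps)
  also have "A - V / U * D = x / U" using eq by simp
  finally show ?thesis
    using assms(3,4) by (simp add: dens_def A_def[symmetric] D_def[symmetric] power_mult_distrib)
qed

lemma rates_odd: "rates (Suc (2 * m)) a b = a * (a * b) ^ m"
  by (simp add: rates_def power_mult_distrib)

lemma rates_even: "rates (Suc (Suc (2 * m))) a b = (a * b) * (a * b) ^ m"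
  by (simp add: rates_def power_mult_distrib)

lemma index_cases:
  assumes "n > 0"
  obtains m where "n = Suc (2 * m)" | m where "n = Suc (Suc (2 * m))"
  using assms by (metis even_pos_cases odd_cases)

text \<open>\<open>xi gam 0\<close> and \<open>xi gam 1\<close> are the occupation times
  \<open>A\<close> and \<open>D\<close> for \<open>U = gam 0\<close> and
  \<open>V = - gam 1\<close>.\<close>

lemma xi_alt:
  "xi gam 0 t x = (x + - gam 1 * t) / (gam 0 + - gam 1)" "xi gam 1 t x = (gam 0 * t - x) / (gam 0 + - gam 1)"
  "xi gam 0 t x = (gam 0 * 0 + - gam 1 * t - - x) / (- gam 1 + gam 0)" "xi gam 1 t x = (- x + gam 0 * t) / (- gam 1 + gam 0)"
  by (simp_all add: xi_def)

lemma g_plus_eq: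
  assumes n: "n > 0" and gam: "gam 0 > 0" "gam 1 < 0"
  shows "g_plus lam gam t x n = rates n (lam 0) (lam 1) * dens n (lam 0) (lam 1) (gam 0) (- gam 1) t x"
proof (cases "0 < x \<and> x < gam 0 * t")
  case True
  have V: "- gam 1 > 0" using gam by simp
  from n show ?thesis
  proof (cases rule: index_cases)
    case (1 m)
    show ?thesis
      using True unfolding 1 rates_odd dens_odd[OF gam(1) V conjunct1[OF True] conjunct2[OF True]] xi_alt(1,2)[symmetric]
      by (simp add: g_plus_def zz_def theta_def power_mult_distrib mult_ac add_ac)
  next
    case (2 m)
    show ?thesis
      using True unfolding 2 rates_even dens_even[OF gam(1) V conjunct1[OF True] conjunct2[OF True]] xi_alt(1,2)[symmetric]
      by (simp add: g_plus_def zz_def theta_def power_mult_distrib mult_ac)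
  qed
qed (auto simp: g_plus_def dens_def)

text \<open>A first passage of \<open>y\<close> is an end at the strict maximum, so reversed time
  yields the density of paths that stay positive, with the rates of the forward path. The factor
  \<open>gam 0\<close> turns a density in position into one in time. Since the passage happens in
  state 0, the parity of \<open>n\<close> fixes the starting state.\<close>

lemma f_dens_pos:
  assumes n: "n > 0" and gam: "gam 0 > 0" "gam 1 < 0" and y: "y > 0" and i: "i = alt n 0 1"
  shows "f_dens lam gam i s y n = gam 0 * (rates n (lam 1) (lam 0) * dens n (lam 0) (lam 1) (gam 0) (- gam 1) s y)"
proof (cases "y < gam 0 * s")
  case True
  have V: "- gam 1 > 0" using gam by simp
  have sy: "s > y / gam 0" using True gam by (simp add: field_simps)
  from n show ?thesis
  proof (cases rule: index_cases)
    case (1 m)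
    show ?thesis
      using y sy gam unfolding 1 rates_odd dens_odd[OF gam(1) V y True] xi_alt(1,2)[symmetric]
      by (simp add: f_dens_def i 1 alt_def zz_def theta_def power_mult_distrib mult_ac)
  next
    case (2 m)
    show ?thesis
      using y sy gam unfolding 2 rates_even dens_even[OF gam(1) V y True] xi_alt(1,2)[symmetric]
      by (simp add: f_dens_def i 2 alt_def zz_def theta_def power_mult_distrib mult_ac)
  qed
next
  case False
  then have "\<not> s > y / gam 0" using gam by (simp add: field_simps)
  then show ?thesis using False y by (simp add: f_dens_def dens_def)
qed

text \<open>Exchanging the two states and reflecting the line maps the minimum to the maximum.\<close>

lemma g_minus_reflect:
  assumes "gam 0 > 0" "gam 1 < 0"
  shows "g_minus lam gam t x n = g_plus (\<lambda>i. lam (1 - i)) (\<lambda>i. - gam (1 - i)) t (- x) n"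
proof -
  have [simp]: "xi (\<lambda>i. - gam (Suc 0 - i)) 0 t (- x) = xi gam (Suc 0) t x" "xi (\<lambda>i. - gam (Suc 0 - i)) (Suc 0) t (- x) = xi gam 0 t x"
    by (simp_all add: xi_def)
  have [simp]: "zz (\<lambda>i. lam (Suc 0 - i)) (\<lambda>i. - gam (Suc 0 - i)) t (- x) = zz lam gam t x"
    "theta (\<lambda>i. lam (Suc 0 - i)) (\<lambda>i. - gam (Suc 0 - i)) t (- x) = theta lam gam t x"
    by (simp_all add: zz_def theta_def mult_ac)
  show ?thesis
  proof (cases "gam 1 * t < x \<and> x < 0")
    case True
    show ?thesis using True
      by (simp add: g_minus_def g_plus_def Let_def algebra_simps diff_divide_distrib add_divide_distrib)
  qed (auto simp: g_minus_def g_plus_def)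
qed

lemma f_dens_reflect:
  assumes "gam 0 > 0" "gam 1 < 0" "i \<in> {0, 1}" "y < 0"
  shows "f_dens lam gam i s y n = f_dens (\<lambda>i. lam (1 - i)) (\<lambda>i. - gam (1 - i)) (1 - i) s (- y) n"
proof -
  have [simp]: "xi (\<lambda>i. - gam (Suc 0 - i)) 0 s (- y) = xi gam (Suc 0) s y" "xi (\<lambda>i. - gam (Suc 0 - i)) (Suc 0) s (- y) = xi gam 0 s y"
    by (simp_all add: xi_def)
  have [simp]: "zz (\<lambda>i. lam (Suc 0 - i)) (\<lambda>i. - gam (Suc 0 - i)) s (- y) = zz lam gam s y"
    "theta (\<lambda>i. lam (Suc 0 - i)) (\<lambda>i. - gam (Suc 0 - i)) s (- y) = theta lam gam s y"
    by (simp_all add: zz_def theta_def mult_ac)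
  show ?thesis using assms(3,4) by (auto simp: f_dens_def Let_def mult_ac)
qed

lemma f_dens_neg:
  assumes n: "n > 0" and gam: "gam 0 > 0" "gam 1 < 0" and y: "y < 0" and i: "i = alt n 1 0"
  shows "f_dens lam gam i s y n = - gam 1 * (rates n (lam 0) (lam 1) * dens n (lam 1) (lam 0) (- gam 1) (gam 0) s (- y))"
  using f_dens_pos[of n "\<lambda>i. - gam (1 - i)" "- y" "1 - i" "\<lambda>i. lam (1 - i)" s] f_dens_reflect[of gam i y lam s n] assms
  by (auto simp: alt_def)

lemma g_minus_eq:
  assumes n: "n > 0" and gam: "gam 0 > 0" "gam 1 < 0"
  shows "g_minus lam gam t x n = rates n (lam 1) (lam 0) * dens n (lam 1) (lam 0) (- gam 1) (gam 0) t (- x)"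
  using g_plus_eq[of n "\<lambda>i. - gam (1 - i)" "\<lambda>i. lam (1 - i)" t "- x"] g_minus_reflect[OF gam, of lam t x n] assms
  by simp

section \<open>The product formula\<close>

lemma sum_odd_indices:
  fixes T :: "nat \<Rightarrow> ennreal"
  assumes "\<And>j. even j \<Longrightarrow> T j = 0"
  shows "(\<Sum>j<n. T j) = (\<Sum>k=1..n div 2. T (2 * k - 1))"
proof -
  have "(\<Sum>k=1..n div 2. T (2 * k - 1)) = sum T ((\<lambda>k. 2 * k - 1) ` {1..n div 2})"
    by (subst sum.reindex) (auto simp: inj_on_def)
  also have "\<dots> = (\<Sum>j<n. T j)"
  proof (rule sum.mono_neutral_left)
    show "\<forall>j\<in>{..<n} - (\<lambda>k. 2 * k - 1) ` {1..n div 2}. T j = 0"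
    proof
      fix j assume j: "j \<in> {..<n} - (\<lambda>k. 2 * k - 1) ` {1..n div 2}"
      have "even j"
      proof (rule ccontr)
        assume "odd j"
        then obtain m where "j = Suc (2 * m)" by (rule odd_cases)
        then have "j = 2 * Suc m - 1" "Suc m \<in> {1..n div 2}" using j by auto
        then show False using j by blast
      qed
      then show "T j = 0" by (rule assms)
    qed
  qed auto
  finally show ?thesis ..
qed

lemma sum_even_indices:
  fixes T :: "nat \<Rightarrow> ennreal"
  assumes "\<And>j. odd j \<Longrightarrow> T j = 0" and "n \<ge> 1"
  shows "(\<Sum>j<n. T j) = (\<Sum>k=0..(n - 1) div 2. T (2 * k))"
proof -
  have "(\<Sum>k=0..(n - 1) div 2. T (2 * k)) = sum T ((\<lambda>k. 2 * k) ` {0..(n - 1) div 2})"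
    by (subst sum.reindex) (auto simp: inj_on_def)
  also have "\<dots> = (\<Sum>j<n. T j)"
  proof (rule sum.mono_neutral_left)
    show "\<forall>j\<in>{..<n} - (\<lambda>k. 2 * k) ` {0..(n - 1) div 2}. T j = 0"
    proof
      fix j assume j: "j \<in> {..<n} - (\<lambda>k. 2 * k) ` {0..(n - 1) div 2}"
      have "odd j"
      proof
        assume "even j"
        then obtain m where "j = 2 * m" by (rule evenE)
        then have "j = 2 * m" "m \<in> {0..(n - 1) div 2}" using j by auto
        then show False using j by blast
      qed
      then show "T j = 0" by (rule assms)
    qed
  qed (use assms(2) in auto)
  finally show ?thesis ..
qed

text \<open>
  The sign is 1 for the minimum of the telegraph process and - 1 for its maximum, which is treated as the
  minimum of the reflected process.
\<close>

locale split_data =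
  fixes \<alpha> \<beta> U V t \<sigma> :: real and F :: "nat \<Rightarrow> real \<Rightarrow> real measure" and G :: "nat \<Rightarrow> real \<Rightarrow> real measure"
    and B :: "(real \<times> real \<times> real) set"
  assumes pos: "\<alpha> > 0" "\<beta> > 0" "U > 0" "V > 0" "t > 0"
    and sign: "\<sigma> = 1 \<or> \<sigma> = - 1"
    and G: "\<And>m r \<phi>. r > 0 \<Longrightarrow> \<phi> \<in> borel_measurable borel \<Longrightarrow>
      (\<integral>\<^sup>+x. \<phi> x \<partial>G m r) = surv m \<alpha> \<beta> U (- V) r 0 (\<lambda>x. \<phi> (\<sigma> * x))"
    and sets_G: "\<And>m r. sets (G m r) = sets borel"
    and F_0: "\<And>y h. y < 0 \<Longrightarrow> h \<in> borel_measurable borel \<Longrightarrow>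
      (\<integral>\<^sup>+s. h s \<partial>F 0 (\<sigma> * y)) = ennreal (exp (- \<beta> * (- y / V))) * h (- y / V)"
    and F: "\<And>j y h. j > 0 \<Longrightarrow> y < 0 \<Longrightarrow> h \<in> borel_measurable borel \<Longrightarrow>
      (\<integral>\<^sup>+s. h s \<partial>F j (\<sigma> * y)) = (\<integral>\<^sup>+s. ennreal (V * (rates j \<alpha> \<beta> * dens j \<beta> \<alpha> V U s (- y))) * h s \<partial>lborel)"
    and B [measurable]: "B \<in> sets borel"
    and supp: "\<And>s y x. (s, y, x) \<in> B \<Longrightarrow> 0 < s \<and> s < t \<and> \<sigma> * y < 0"
begin

lemma sign2 [simp]: "\<sigma> * (\<sigma> * x) = x" "\<sigma> * \<sigma> = 1"
  using sign by auto

text \<open>The weight of all continuations of a minimum \<open>y\<close> at time \<open>s\<close>.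
  Paths are in reflected coordinates while \<open>B\<close> is in the original ones, hence the
  factors \<open>\<sigma>\<close>.\<close>

definition after :: "nat \<Rightarrow> real \<Rightarrow> real \<Rightarrow> ennreal" where
  "after m s y = surv m \<alpha> \<beta> U (- V) (t - s) 0 (\<lambda>x. indicator B (s, \<sigma> * y, \<sigma> * (x + y)))"

lemma measurable_after [measurable (raw)]:
  assumes [measurable]: "f \<in> borel_measurable N" "g \<in> borel_measurable N"
  shows "(\<lambda>x. after m (f x) (g x)) \<in> borel_measurable N"
proof -
  have [measurable]: "B \<in> sets (borel \<Otimes>\<^sub>M borel \<Otimes>\<^sub>M borel)" unfolding borel_prod by (rule B)
  show ?thesis unfolding after_def by measurable
qed

lemma after_outside: "\<not> (0 < s \<and> s < t \<and> y < 0) \<Longrightarrow> after m s y = 0"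
proof -
  assume "\<not> (0 < s \<and> s < t \<and> y < 0)"
  then have "(s, \<sigma> * y, z) \<notin> B" for z using supp[of s "\<sigma> * y" z] by auto
  then have "(\<lambda>x. indicator B (s, \<sigma> * y, \<sigma> * (x + y))) = (\<lambda>x. 0 :: ennreal)" by auto
  then show ?thesis by (simp add: after_def)
qed

lemma split_meas_level:
  assumes k: "k \<in> borel_measurable borel" and Fk: "\<And>y. y < 0 \<Longrightarrow> (\<integral>\<^sup>+s. after m s y \<partial>F j (\<sigma> * y)) = k y"
  shows "split_meas t (F j) (G m) B = (\<integral>\<^sup>+y. k y * indicator {..<0} y \<partial>lborel)"
proof -
  have [measurable]: "B \<in> sets (borel \<Otimes>\<^sub>M borel \<Otimes>\<^sub>M borel)" unfolding borel_prod by (rule B)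
  have x: "(\<integral>\<^sup>+x. indicator B (s, y, x) \<partial>distr (G m (t - s)) borel (\<lambda>x. x + y)) = after m s (\<sigma> * y)" for s y
  proof -
    have "(\<integral>\<^sup>+x. indicator B (s, y, x) \<partial>distr (G m (t - s)) borel (\<lambda>x. x + y)) =
        (\<integral>\<^sup>+x. indicator B (s, y, x + y) \<partial>G m (t - s))"
      by (rule nn_integral_distr) (auto simp: measurable_cong_sets[OF sets_G refl])
    also have "\<dots> = after m s (\<sigma> * y)"
    proof (cases "s < t")
      case True
      then show ?thesis
        by (subst G) (auto simp: after_def distrib_left)
    next
      case False
      then have "(s, y, z) \<notin> B" for z using supp by blast
      then show ?thesis using False by (simp add: after_outside)
    qed
    finally show ?thesis .
  qed
  have "split_meas t (F j) (G m) B = (\<integral>\<^sup>+y. (\<integral>\<^sup>+s. after m s (\<sigma> * y) \<partial>F j y) \<partial>lborel)"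
    by (simp add: split_meas_def x)
  also have "\<dots> = (\<integral>\<^sup>+y. k (\<sigma> * y) * indicator {..<0} (\<sigma> * y) \<partial>lborel)"
  proof (rule nn_integral_cong)
    fix y
    show "(\<integral>\<^sup>+s. after m s (\<sigma> * y) \<partial>F j y) = k (\<sigma> * y) * indicator {..<0} (\<sigma> * y)"
      using Fk[of "\<sigma> * y"] by (cases "\<sigma> * y < 0") (simp_all add: after_outside)
  qed
  also have "\<dots> = (\<integral>\<^sup>+y. k y * indicator {..<0} y \<partial>lborel)"
    using sign k by (subst (2) nn_integral_real_affine[where c = \<sigma> and t = 0]) auto
  finally show ?thesis .
qed

text \<open>On the left stands a density in the level at a fixed time, inside
  \<open>split_meas\<close> one in time at a fixed level. They differ by the speed \<open>V\<close>
  of the path at its minimum, the source of the divisor in \<open>\<beta> / V\<close>; Fubini does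
  the rest.\<close>

lemma term_pos:
  assumes j: "j > 0"
  shows "(\<integral>\<^sup>+v\<in>{0..t}. ennreal \<beta> * ending j (alt j \<beta> \<alpha>) (alt j \<alpha> \<beta>) (alt j (- V) U) (alt j U (- V)) (t - v)
      (after m (t - v)) \<partial>lborel) = ennreal (\<beta> / V) * split_meas t (F j) (G m) B"
proof -
  let ?c = "rates j \<alpha> \<beta>" and ?d = "\<lambda>s y. dens j \<beta> \<alpha> V U s (- y)"
  have c: "0 \<le> ?c" using pos by (intro rates_nonneg)
  have split: "split_meas t (F j) (G m) B =
      (\<integral>\<^sup>+y. (\<integral>\<^sup>+s. ennreal (V * (?c * ?d s y)) * after m s y \<partial>lborel) * indicator {..<0} y \<partial>lborel)"
    by (rule split_meas_level) (use j in \<open>simp_all add: F\<close>)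
  have "(\<integral>\<^sup>+v\<in>{0..t}. ennreal \<beta> * ending j (alt j \<beta> \<alpha>) (alt j \<alpha> \<beta>) (alt j (- V) U) (alt j U (- V)) (t - v)
      (after m (t - v)) \<partial>lborel) =
    (\<integral>\<^sup>+s\<in>{0..t}. ennreal \<beta> * ending j (alt j \<beta> \<alpha>) (alt j \<alpha> \<beta>) (alt j (- V) U) (alt j U (- V)) s (after m s) \<partial>lborel)"
    by (subst (2) nn_integral_reflect) auto
  also have "\<dots> = (\<integral>\<^sup>+s. (\<integral>\<^sup>+y. ennreal (\<beta> / V) * (ennreal (V * (?c * ?d s y)) * after m s y * indicator {..<0} y) \<partial>lborel) \<partial>lborel)"
  proof (rule nn_integral_cong)
    fix s
    show "ennreal \<beta> * ending j (alt j \<beta> \<alpha>) (alt j \<alpha> \<beta>) (alt j (- V) U) (alt j U (- V)) s (after m s) * indicator {0..t} s =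
      (\<integral>\<^sup>+y. ennreal (\<beta> / V) * (ennreal (V * (?c * ?d s y)) * after m s y * indicator {..<0} y) \<partial>lborel)"
    proof (cases "0 < s \<and> s < t")
      case True
      have "ennreal \<beta> * ending j (alt j \<beta> \<alpha>) (alt j \<alpha> \<beta>) (alt j (- V) U) (alt j U (- V)) s (after m s) =
          ennreal \<beta> * (ennreal ?c * (\<integral>\<^sup>+x. ennreal (dens j \<beta> \<alpha> V U s x) * after m s (- x) \<partial>lborel))"
        using pos j True by (subst ending_density) auto
      also have "(\<integral>\<^sup>+x. ennreal (dens j \<beta> \<alpha> V U s x) * after m s (- x) \<partial>lborel) =
          (\<integral>\<^sup>+y. ennreal (?d s y) * after m s y \<partial>lborel)"
        by (subst nn_integral_real_affine[where c = "- 1" and t = 0]) auto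
      also have "ennreal \<beta> * (ennreal ?c * \<dots>) = (\<integral>\<^sup>+y. ennreal \<beta> * (ennreal ?c * (ennreal (?d s y) * after m s y)) \<partial>lborel)"
        by (simp add: nn_integral_cmult)
      also have "\<dots> = (\<integral>\<^sup>+y. ennreal (\<beta> / V) * (ennreal (V * (?c * ?d s y)) * after m s y * indicator {..<0} y) \<partial>lborel)"
      proof (rule nn_integral_cong)
        fix y
        have "\<beta> / V * (V * (?c * ?d s y)) = \<beta> * (?c * ?d s y)" using pos by simp
        then have "ennreal (\<beta> / V) * ennreal (V * (?c * ?d s y)) = ennreal \<beta> * (ennreal ?c * ennreal (?d s y))"
          using pos c by (simp add: ennreal_mult'[symmetric])
        then show "ennreal \<beta> * (ennreal ?c * (ennreal (?d s y) * after m s y)) =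
            ennreal (\<beta> / V) * (ennreal (V * (?c * ?d s y)) * after m s y * indicator {..<0} y)"
          by (cases "y < 0") (simp_all add: after_outside mult.assoc[symmetric])
      qed
      finally show ?thesis using True by simp
    next
      case False
      then have z: "after m s = (\<lambda>y. 0)" by (intro ext after_outside) auto
      show ?thesis unfolding z by simp
    qed
  qed
  also have "\<dots> = (\<integral>\<^sup>+y. (\<integral>\<^sup>+s. ennreal (\<beta> / V) * (ennreal (V * (?c * ?d s y)) * after m s y * indicator {..<0} y) \<partial>lborel) \<partial>lborel)"
    by (rule lborel_pair.Fubini') (unfold split_beta', measurable)
  also have "\<dots> = ennreal (\<beta> / V) * split_meas t (F j) (G m) B"
    unfolding split by (simp add: nn_integral_cmult nn_integral_multc)
  finally show ?thesis .
qed

text \<open>Without a switching before the minimum, time and level determine each other by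
  \<open>y = - V * s\<close>, and the Jacobian of this substitution is again
  \<open>V\<close>.\<close>

lemma term_0:
  "(\<integral>\<^sup>+v\<in>{0..t}. ennreal \<beta> * ending 0 \<beta> \<alpha> (- V) U (t - v) (after m (t - v)) \<partial>lborel) =
    ennreal (\<beta> / V) * split_meas t (F 0) (G m) B"
proof -
  let ?k = "\<lambda>y. ennreal (exp (- \<beta> * (- y / V))) * after m (- y / V) y"
  have split: "split_meas t (F 0) (G m) B = (\<integral>\<^sup>+y. ?k y * indicator {..<0} y \<partial>lborel)"
    by (rule split_meas_level) (simp_all add: F_0)
  have "(\<integral>\<^sup>+v\<in>{0..t}. ennreal \<beta> * ending 0 \<beta> \<alpha> (- V) U (t - v) (after m (t - v)) \<partial>lborel) =
    (\<integral>\<^sup>+s\<in>{0..t}. ennreal \<beta> * ending 0 \<beta> \<alpha> (- V) U s (after m s) \<partial>lborel)"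
    by (subst (2) nn_integral_reflect) auto
  also have "\<dots> = (\<integral>\<^sup>+s. ennreal \<beta> * (?k (- V * s) * indicator {..<0} (- V * s)) \<partial>lborel)"
  proof (rule nn_integral_cong)
    fix s
    show "ennreal \<beta> * ending 0 \<beta> \<alpha> (- V) U s (after m s) * indicator {0..t} s =
        ennreal \<beta> * (?k (- V * s) * indicator {..<0} (- V * s))"
    proof (cases "0 < s \<and> s < t")
      case True
      then show ?thesis using pos by (simp add: ending_0)
    next
      case False
      then have z: "after m s = (\<lambda>y. 0)" by (intro ext after_outside) auto
      show ?thesis using pos by (simp add: z)
    qed
  qed
  also have "\<dots> = ennreal (\<beta> / V) * (ennreal V * (\<integral>\<^sup>+s. ?k (- V * s) * indicator {..<0} (- V * s) \<partial>lborel))"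
    using pos by (subst nn_integral_cmult) (auto simp: mult.assoc[symmetric] ennreal_mult'[symmetric])
  also have "ennreal V * (\<integral>\<^sup>+s. ?k (- V * s) * indicator {..<0} (- V * s) \<partial>lborel) = split_meas t (F 0) (G m) B"
    unfolding split using pos by (subst (2) nn_integral_real_affine[where c = "- V" and t = 0]) auto
  finally show ?thesis .
qed

lemma term_impossible:
  "(\<integral>\<^sup>+v\<in>{0..t}. ennreal \<beta> * ending j (alt j \<alpha> \<beta>) (alt j \<beta> \<alpha>) (alt j U (- V)) (alt j (- V) U) (t - v)
      (after m (t - v)) \<partial>lborel) = 0"
proof -
  have "(\<integral>\<^sup>+v\<in>{0..t}. ennreal \<beta> * ending j (alt j \<alpha> \<beta>) (alt j \<beta> \<alpha>) (alt j U (- V)) (alt j (- V) U) (t - v)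
      (after m (t - v)) \<partial>lborel) = (\<integral>\<^sup>+(v::real). 0 \<partial>lborel)"
  proof (intro nn_integral_cong_AE, use AE_lborel_singleton[of t] in eventually_elim)
    case (elim v)
    then show ?case using pos by (cases "v \<in> {0..t}") (auto simp: ending_impossible)
  qed
  then show ?thesis by simp
qed

lemma W_terms:
  assumes "(a, b, p, q) = (\<alpha>, \<beta>, U, - V) \<or> (a, b, p, q) = (\<beta>, \<alpha>, - V, U)"
  shows "W n a b p q t (\<lambda>(s, y, x). indicator B (s, \<sigma> * y, \<sigma> * x)) =
    (\<Sum>j<n. \<integral>\<^sup>+v\<in>{0..t}. ennreal \<beta> * ending j a b p q (t - v) (after (n - 1 - j) (t - v)) \<partial>lborel)"
proof -
  have "W n a b p q t (\<lambda>(s, y, x). indicator B (s, \<sigma> * y, \<sigma> * x)) =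
    (\<Sum>j<n. \<integral>\<^sup>+v\<in>{0..t}. ennreal \<beta> * ending j a b p q (t - v)
      (\<lambda>y. surv (n - 1 - j) \<alpha> \<beta> U (- V) v 0 (\<lambda>x. (\<lambda>(s, y, x). indicator B (s, \<sigma> * y, \<sigma> * x)) (t - v, y, x + y))) \<partial>lborel)"
  proof (rule W_decompose[OF pos(1-4) less_imp_le[OF pos(5)] assms])
    have [measurable]: "B \<in> sets (borel \<Otimes>\<^sub>M borel \<Otimes>\<^sub>M borel)" unfolding borel_prod by (rule B)
    show "(\<lambda>(s, y, x). indicator B (s, \<sigma> * y, \<sigma> * x) :: ennreal) \<in> borel_measurable borel"
      unfolding split_beta' borel_prod[symmetric] by measurable
    show "\<not> (s < t \<and> y < 0) \<Longrightarrow> (\<lambda>(s, y, x). indicator B (s, \<sigma> * y, \<sigma> * x) :: ennreal) (s, y, x) = 0" for s y x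
      using supp[of s "\<sigma> * y" "\<sigma> * x"] by (auto simp: indicator_def)
  qed
  then show ?thesis by (simp add: after_def[abs_def])
qed

text \<open>The minimum is reached while descending, so a path that starts upwards has an odd number
  of switchings before it; the even terms vanish by \<open>term_impossible\<close>.\<close>

lemma W_up:
  "W n \<alpha> \<beta> U (- V) t (\<lambda>(s, y, x). indicator B (s, \<sigma> * y, \<sigma> * x)) =
    ennreal (\<beta> / V) * (\<Sum>k=1..n div 2. split_meas t (F (2 * k - 1)) (G (n - 2 * k)) B)"
proof -
  let ?T = "\<lambda>j. \<integral>\<^sup>+v\<in>{0..t}. ennreal \<beta> * ending j \<alpha> \<beta> U (- V) (t - v) (after (n - 1 - j) (t - v)) \<partial>lborel"
  have "W n \<alpha> \<beta> U (- V) t (\<lambda>(s, y, x). indicator B (s, \<sigma> * y, \<sigma> * x)) = (\<Sum>j<n. ?T j)"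
    by (rule W_terms) simp
  also have "\<dots> = (\<Sum>k=1..n div 2. ?T (2 * k - 1))"
  proof (rule sum_odd_indices)
    show "?T j = 0" if "even j" for j using term_impossible[of j "n - 1 - j"] that by (simp add: alt_def)
  qed
  also have "\<dots> = (\<Sum>k=1..n div 2. ennreal (\<beta> / V) * split_meas t (F (2 * k - 1)) (G (n - 2 * k)) B)"
  proof (rule sum.cong[OF refl])
    fix k assume k: "k \<in> {1..n div 2}"
    then have "n - 1 - (2 * k - 1) = n - 2 * k" "odd (2 * k - 1)" "2 * k - 1 > 0" by auto
    then show "?T (2 * k - 1) = ennreal (\<beta> / V) * split_meas t (F (2 * k - 1)) (G (n - 2 * k)) B"
      using term_pos[of "2 * k - 1" "n - 2 * k"] unfolding alt_def by simp
  qed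
  finally show ?thesis by (simp add: sum_distrib_left)
qed

lemma W_down:
  assumes "n \<ge> 1"
  shows "W n \<beta> \<alpha> (- V) U t (\<lambda>(s, y, x). indicator B (s, \<sigma> * y, \<sigma> * x)) =
    ennreal (\<beta> / V) * (\<Sum>k=0..(n - 1) div 2. split_meas t (F (2 * k)) (G (n - 2 * k - 1)) B)"
proof -
  let ?T = "\<lambda>j. \<integral>\<^sup>+v\<in>{0..t}. ennreal \<beta> * ending j \<beta> \<alpha> (- V) U (t - v) (after (n - 1 - j) (t - v)) \<partial>lborel"
  have "W n \<beta> \<alpha> (- V) U t (\<lambda>(s, y, x). indicator B (s, \<sigma> * y, \<sigma> * x)) = (\<Sum>j<n. ?T j)"
    by (rule W_terms) simp
  also have "\<dots> = (\<Sum>k=0..(n - 1) div 2. ?T (2 * k))"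
  proof (rule sum_even_indices[OF _ assms])
    show "?T j = 0" if "odd j" for j using term_impossible[of j "n - 1 - j"] that by (simp add: alt_def)
  qed
  also have "\<dots> = (\<Sum>k=0..(n - 1) div 2. ennreal (\<beta> / V) * split_meas t (F (2 * k)) (G (n - 2 * k - 1)) B)"
  proof (rule sum.cong[OF refl])
    fix k :: nat
    have "n - 1 - 2 * k = n - 2 * k - 1" by simp
    then show "?T (2 * k) = ennreal (\<beta> / V) * split_meas t (F (2 * k)) (G (n - 2 * k - 1)) B"
      using term_pos[of "2 * k" "n - 2 * k - 1"] term_0[of "n - 1"] by (cases "k = 0") (auto simp: alt_def)
  qed
  finally show ?thesis by (simp add: sum_distrib_left)
qed

end

section \<open>Integrals against the explicit measures\<close>

lemma nn_integral_point_mass: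
  "\<phi> \<in> borel_measurable borel \<Longrightarrow> (\<integral>\<^sup>+x. \<phi> x \<partial>point_mass c a) = ennreal c * \<phi> a"
  unfolding point_mass_def by (subst nn_integral_scale_measure) (simp_all add: nn_integral_return)

lemma sets_point_mass [simp]: "sets (point_mass c a) = sets borel"
  by (simp add: point_mass_def)

lemma nn_integral_G_plus:
  assumes pos: "lam 0 > 0" "lam 1 > 0" "gam 0 > 0" "gam 1 < 0" "r > 0" and [measurable]: "\<phi> \<in> borel_measurable borel"
  shows "(\<integral>\<^sup>+x. \<phi> x \<partial>G_plus lam gam r m) = surv m (lam 0) (lam 1) (gam 0) (gam 1) r 0 \<phi>"
proof (cases "m = 0")
  case True
  then show ?thesis using pos by (simp add: G_plus_def nn_integral_point_mass surv_0 mult.commute)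
next
  case False
  let ?d = "dens m (lam 0) (lam 1) (gam 0) (- gam 1) r"
  have "(\<integral>\<^sup>+x. \<phi> x \<partial>G_plus lam gam r m) = (\<integral>\<^sup>+x. ennreal (rates m (lam 0) (lam 1) * ?d x) * \<phi> x \<partial>lborel)"
    using False pos by (simp add: G_plus_def g_plus_eq nn_integral_density)
  also have "\<dots> = (\<integral>\<^sup>+x. ennreal (rates m (lam 0) (lam 1)) * (ennreal (?d x) * \<phi> x) \<partial>lborel)"
    using pos by (intro nn_integral_cong) (simp add: ennreal_mult' rates_nonneg mult.assoc)
  also have "\<dots> = surv m (lam 0) (lam 1) (gam 0) (- (- gam 1)) r 0 \<phi>"
    using pos False by (subst surv_density) (auto simp: nn_integral_cmult)
  finally show ?thesis by simp
qed

lemma nn_integral_G_minus: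
  assumes pos: "lam 0 > 0" "lam 1 > 0" "gam 0 > 0" "gam 1 < 0" "r > 0" and [measurable]: "\<phi> \<in> borel_measurable borel"
  shows "(\<integral>\<^sup>+x. \<phi> x \<partial>G_minus lam gam r m) = surv m (lam 1) (lam 0) (- gam 1) (- gam 0) r 0 (\<lambda>x. \<phi> (- x))"
proof (cases "m = 0")
  case True
  then show ?thesis using pos mult_nonneg_nonpos[of r "gam 1"]
    by (simp add: G_minus_def nn_integral_point_mass surv_0 mult.commute)
next
  case False
  let ?d = "dens m (lam 1) (lam 0) (- gam 1) (gam 0) r"
  have "(\<integral>\<^sup>+x. \<phi> x \<partial>G_minus lam gam r m) = (\<integral>\<^sup>+x. ennreal (rates m (lam 1) (lam 0) * ?d (- x)) * \<phi> x \<partial>lborel)"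
    using False pos by (simp add: G_minus_def g_minus_eq nn_integral_density)
  also have "\<dots> = (\<integral>\<^sup>+x. ennreal (rates m (lam 1) (lam 0) * ?d x) * \<phi> (- x) \<partial>lborel)"
    by (subst nn_integral_real_affine[where c = "- 1" and t = 0]) auto
  also have "\<dots> = (\<integral>\<^sup>+x. ennreal (rates m (lam 1) (lam 0)) * (ennreal (?d x) * \<phi> (- x)) \<partial>lborel)"
    using pos by (intro nn_integral_cong) (simp add: ennreal_mult' rates_nonneg mult.assoc)
  also have "\<dots> = surv m (lam 1) (lam 0) (- gam 1) (- gam 0) r 0 (\<lambda>x. \<phi> (- x))"
    using pos False by (subst surv_density) (auto simp: nn_integral_cmult)
  finally show ?thesis .
qed

lemma sets_G_plus [simp]: "sets (G_plus lam gam r m) = sets borel"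
  by (simp add: G_plus_def)

lemma sets_G_minus [simp]: "sets (G_minus lam gam r m) = sets borel"
  by (simp add: G_minus_def)

lemma nn_integral_F_meas_0:
  assumes "i = 0 \<and> y > 0 \<or> i = 1 \<and> y < 0" and [measurable]: "h \<in> borel_measurable borel"
  shows "(\<integral>\<^sup>+s. h s \<partial>F_meas lam gam i y 0) = ennreal (exp (- lam i * (y / gam i))) * h (y / gam i)"
proof -
  have "(\<integral>\<^sup>+s. h s \<partial>density (return borel (y / gam i)) (\<lambda>s. ennreal (exp (- lam i * s)))) =
      (\<integral>\<^sup>+s. ennreal (exp (- lam i * s)) * h s \<partial>return borel (y / gam i))"
    by (rule nn_integral_density) (simp_all add: measurable_cong_sets[OF sets_return refl])
  also have "\<dots> = ennreal (exp (- lam i * (y / gam i))) * h (y / gam i)"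
    by (rule nn_integral_return) auto
  finally show ?thesis using assms(1) by (simp add: F_meas_def)
qed

lemma split_data_min:
  assumes pos: "lam 0 > 0" "lam 1 > 0" "gam 0 > 0" "gam 1 < 0" "t > 0"
    and B: "B \<in> sets borel" "B \<subseteq> {(s, y, x). 0 < s \<and> s < t \<and> y < min 0 x}"
  shows "split_data (lam 0) (lam 1) (gam 0) (- gam 1) t 1 (\<lambda>j y. F_meas lam gam (alt j 1 0) y j) (\<lambda>m r. G_plus lam gam r m) B"
proof
  show "(\<integral>\<^sup>+s. h s \<partial>F_meas lam gam (alt j 1 0) (1 * y) j) =
      (\<integral>\<^sup>+s. ennreal (- gam 1 * (rates j (lam 0) (lam 1) * dens j (lam 1) (lam 0) (- gam 1) (gam 0) s (- y))) * h s \<partial>lborel)"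
    if j: "j > 0" and y: "y < 0" and [measurable]: "h \<in> borel_measurable borel" for j y h
    using pos y j by (simp add: F_meas_def f_dens_neg nn_integral_density)
  show "(\<integral>\<^sup>+s. h s \<partial>F_meas lam gam (alt 0 1 0) (1 * y) 0) = ennreal (exp (- lam 1 * (- y / - gam 1))) * h (- y / - gam 1)"
    if "y < 0" "h \<in> borel_measurable borel" for y h
    using nn_integral_F_meas_0[of 1 y h lam gam] that by simp
qed (use pos B in \<open>auto simp: nn_integral_G_plus\<close>)

text \<open>In the reflected process state 1 is the ascending one, so the two rates and the two
  speeds change places.\<close>

lemma split_data_max:
  assumes pos: "lam 0 > 0" "lam 1 > 0" "gam 0 > 0" "gam 1 < 0" "t > 0"
    and B: "B \<in> sets borel" "B \<subseteq> {(s, y, x). 0 < s \<and> s < t \<and> y > max 0 x}"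
  shows "split_data (lam 1) (lam 0) (- gam 1) (gam 0) t (- 1) (\<lambda>j y. F_meas lam gam (alt j 0 1) y j) (\<lambda>m r. G_minus lam gam r m) B"
proof
  show "(\<integral>\<^sup>+s. h s \<partial>F_meas lam gam (alt j 0 1) (- 1 * y) j) =
      (\<integral>\<^sup>+s. ennreal (gam 0 * (rates j (lam 1) (lam 0) * dens j (lam 0) (lam 1) (gam 0) (- gam 1) s (- y))) * h s \<partial>lborel)"
    if j: "j > 0" and y: "y < 0" and [measurable]: "h \<in> borel_measurable borel" for j y h
    using pos y j by (simp add: F_meas_def f_dens_pos nn_integral_density)
  show "(\<integral>\<^sup>+s. h s \<partial>F_meas lam gam (alt 0 0 1) (- 1 * y) 0) = ennreal (exp (- lam 0 * (- y / gam 0))) * h (- y / gam 0)"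
    if "y < 0" "h \<in> borel_measurable borel" for y h
    using nn_integral_F_meas_0[of 0 "- y" h lam gam] that by simp
qed (use pos B in \<open>auto simp: nn_integral_G_minus\<close>)

section \<open>The identities for minimum and maximum\<close>

context switching
begin

context
  fixes gam :: "nat \<Rightarrow> real" and t :: real
  assumes gam: "gam 0 > 0" "gam 1 < 0" and t: "t > 0"
begin

lemma at_start_sets [measurable]:
  assumes "B \<in> sets (borel :: real measure)"
  shows "{(s, y, x). s = c \<and> y = (0::real) \<and> x \<in> B} \<in> sets (borel :: (real \<times> real \<times> real) measure)"
proof -
  have "{(s, y, x). s = c \<and> y = (0::real) \<and> x \<in> B} = {c} \<times> {0} \<times> B" by auto
  then show ?thesis unfolding borel_prod[symmetric] using assms by simp
qed

lemma at_end_sets [measurable]: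
  assumes [measurable]: "B \<in> sets (borel :: real measure)"
  shows "{(s, y, x). s = c \<and> y = x \<and> x \<in> B} \<in> sets (borel :: (real \<times> real \<times> real) measure)"
proof -
  have "{z \<in> space (borel \<Otimes>\<^sub>M borel \<Otimes>\<^sub>M borel). fst z = c \<and> fst (snd z) = snd (snd z) \<and> snd (snd z) \<in> B} \<in>
      sets (borel \<Otimes>\<^sub>M borel \<Otimes>\<^sub>M borel :: (real \<times> real \<times> real) measure)"
    by measurable
  then show ?thesis unfolding borel_prod by (simp add: split_beta')
qed

text \<open>On attainable triples a minimum equal to 0 forces its first time to be 0; the event thus
  says that the path stays nonnegative, which is \<open>surv\<close> from height 0.\<close>

lemma min_at_start:
  assumes "emeasure M (starts_at M eps 0) > 0" and B: "B \<in> sets borel"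
  shows "emeasure (cond_start M eps 0) {\<omega> \<in> space M. time_min (telegraph gam eps) t \<omega> = 0 \<and>
      run_min (telegraph gam eps) t \<omega> = 0 \<and> telegraph gam eps t \<omega> \<in> B \<and> num_switch eps t \<omega> = n} =
    emeasure (G_plus lam gam t n) B"
proof -
  let ?C = "{(s, y, x). s = (0::real) \<and> y = (0::real) \<and> x \<in> B}"
  have "emeasure (cond_start M eps 0) {\<omega> \<in> space M. time_min (telegraph gam eps) t \<omega> = 0 \<and>
      run_min (telegraph gam eps) t \<omega> = 0 \<and> telegraph gam eps t \<omega> \<in> B \<and> num_switch eps t \<omega> = n} =
    W n (lam 0) (lam 1) (gam 0) (gam 1) t (indicator ?C)"
    using min_law[of t 0 gam ?C n] assms gam t at_start_sets[OF B] by simp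
  also have "\<dots> = surv n (lam 0) (lam 1) (gam 0) (gam 1) t 0 (indicator B)"
    unfolding surv_def using lam0 lam1 t by (intro W_cong) (auto simp: indicator_def)
  also have "\<dots> = (\<integral>\<^sup>+x. indicator B x \<partial>G_plus lam gam t n)"
    using B gam t lam0 lam1 by (subst nn_integral_G_plus) auto
  finally show ?thesis using B by simp
qed

lemma max_at_start:
  assumes "emeasure M (starts_at M eps 1) > 0" and B: "B \<in> sets borel"
  shows "emeasure (cond_start M eps 1) {\<omega> \<in> space M. time_max (telegraph gam eps) t \<omega> = 0 \<and>
      run_max (telegraph gam eps) t \<omega> = 0 \<and> telegraph gam eps t \<omega> \<in> B \<and> num_switch eps t \<omega> = n} =
    emeasure (G_minus lam gam t n) B"
proof -
  let ?C = "{(s, y, x). s = (0::real) \<and> y = (0::real) \<and> x \<in> B}"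
  have "emeasure (cond_start M eps 1) {\<omega> \<in> space M. time_max (telegraph gam eps) t \<omega> = 0 \<and>
      run_max (telegraph gam eps) t \<omega> = 0 \<and> telegraph gam eps t \<omega> \<in> B \<and> num_switch eps t \<omega> = n} =
    W n (lam 1) (lam 0) (- gam 1) (- gam 0) t (\<lambda>(s, y, x). indicator ?C (s, - y, - x))"
    using max_law[of t 1 gam ?C n] assms gam t at_start_sets[OF B] by simp
  also have "\<dots> = surv n (lam 1) (lam 0) (- gam 1) (- gam 0) t 0 (\<lambda>x. indicator B (- x))"
    unfolding surv_def using lam0 lam1 t by (intro W_cong) (auto simp: indicator_def)
  also have "\<dots> = (\<integral>\<^sup>+x. indicator B x \<partial>G_minus lam gam t n)"
    using B gam t lam0 lam1 by (subst nn_integral_G_minus) auto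
  finally show ?thesis using B by simp
qed

lemma min_at_end:
  assumes "emeasure M (starts_at M eps i) > 0" "i \<in> {0, 1}" and B: "B \<in> sets borel" "B \<subseteq> {..<0}"
  shows "emeasure (cond_start M eps i) {\<omega> \<in> space M. time_min (telegraph gam eps) t \<omega> = t \<and>
      run_min (telegraph gam eps) t \<omega> = telegraph gam eps t \<omega> \<and> telegraph gam eps t \<omega> \<in> B \<and> num_switch eps t \<omega> = n} =
    ending n (lam i) (lam (1 - i)) (gam i) (gam (1 - i)) t (indicator B)"
proof -
  let ?C = "{(s, y, x). s = t \<and> y = x \<and> x \<in> B}"
  have e: "{\<omega> \<in> space M. time_min (telegraph gam eps) t \<omega> = t \<and>
      run_min (telegraph gam eps) t \<omega> = telegraph gam eps t \<omega> \<and> telegraph gam eps t \<omega> \<in> B \<and> num_switch eps t \<omega> = n} =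
    {\<omega> \<in> space M. (time_min (telegraph gam eps) t \<omega>, run_min (telegraph gam eps) t \<omega>, telegraph gam eps t \<omega>) \<in> ?C \<and> num_switch eps t \<omega> = n}"
    by auto
  \<comment> \<open>The strict inequality \<open>y < 0\<close> required by \<open>ending\<close>
    comes from \<open>B\<close> lying in the negative half-line.\<close>
  have "indicator ?C = (\<lambda>(s, y, x). if s = t \<and> y = x \<and> y < 0 then indicator B x else (0::ennreal))"
    using B(2) by (auto simp: fun_eq_iff indicator_def)
  then show ?thesis
    unfolding e ending_def using min_law[of t i gam ?C n] assms gam t at_end_sets[OF B(1)] by simp
qed

lemma max_at_end:
  assumes "emeasure M (starts_at M eps i) > 0" "i \<in> {0, 1}" and B: "B \<in> sets borel" "B \<subseteq> {0<..}"
  shows "emeasure (cond_start M eps i) {\<omega> \<in> space M. time_max (telegraph gam eps) t \<omega> = t \<and>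
      run_max (telegraph gam eps) t \<omega> = telegraph gam eps t \<omega> \<and> telegraph gam eps t \<omega> \<in> B \<and> num_switch eps t \<omega> = n} =
    ending n (lam i) (lam (1 - i)) (- gam i) (- gam (1 - i)) t (\<lambda>x. indicator B (- x))"
proof -
  let ?C = "{(s, y, x). s = t \<and> y = x \<and> x \<in> B}"
  have e: "{\<omega> \<in> space M. time_max (telegraph gam eps) t \<omega> = t \<and>
      run_max (telegraph gam eps) t \<omega> = telegraph gam eps t \<omega> \<and> telegraph gam eps t \<omega> \<in> B \<and> num_switch eps t \<omega> = n} =
    {\<omega> \<in> space M. (time_max (telegraph gam eps) t \<omega>, run_max (telegraph gam eps) t \<omega>, telegraph gam eps t \<omega>) \<in> ?C \<and> num_switch eps t \<omega> = n}"
    by auto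
  have "(\<lambda>(s, y, x). indicator ?C (s, - y, - x)) = (\<lambda>(s, y, x). if s = t \<and> y = x \<and> y < 0 then indicator B (- x) else (0::ennreal))"
    using B(2) by (auto simp: fun_eq_iff indicator_def)
  then show ?thesis
    unfolding e ending_def using max_law[of t i gam ?C n] assms gam t at_end_sets[OF B(1)] by simp
qed

lemma measurable_f_dens [measurable]: "(\<lambda>x. f_dens lam gam i s x n) \<in> borel_measurable borel"
  unfolding f_dens_def Let_def zz_def theta_def xi_def by measurable

text \<open>Division by the speed \<open>- gam 1\<close> undoes the conversion from position to time
  that is built into \<open>f_dens\<close>.\<close>

lemma ending_min_density:
  assumes n: "n > 0" and i: "i = alt n 1 0" and B [measurable]: "B \<in> sets borel" "B \<subseteq> {..<0}"
  shows "ending n (lam i) (lam (1 - i)) (gam i) (gam (1 - i)) t (indicator B) =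
    emeasure (density lborel (\<lambda>x. ennreal (1 / (- gam 1) * f_dens lam gam i t x n))) B"
proof -
  let ?c = "rates n (lam 0) (lam 1)" and ?d = "dens n (lam 1) (lam 0) (- gam 1) (gam 0) t"
  have c: "?c \<ge> 0" using lam0 lam1 by (rule rates_nonneg)
  have "ending n (alt n (lam 1) (lam 0)) (alt n (lam 0) (lam 1)) (alt n (- (- gam 1)) (gam 0)) (alt n (gam 0) (- (- gam 1))) t (indicator B) =
      ennreal ?c * (\<integral>\<^sup>+x. ennreal (?d x) * indicator B (- x) \<partial>lborel)"
    using lam0 lam1 gam t n by (intro ending_density) auto
  also have "(\<integral>\<^sup>+x. ennreal (?d x) * indicator B (- x) \<partial>lborel) = (\<integral>\<^sup>+x. ennreal (?d (- x)) * indicator B x \<partial>lborel)"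
    by (subst nn_integral_real_affine[where c = "- 1" and t = 0]) auto
  also have "ennreal ?c * \<dots> = (\<integral>\<^sup>+x. ennreal (?c * ?d (- x)) * indicator B x \<partial>lborel)"
    using c by (subst nn_integral_cmult[symmetric]) (auto simp: ennreal_mult' mult.assoc)
  also have "\<dots> = (\<integral>\<^sup>+x. ennreal (1 / (- gam 1) * f_dens lam gam i t x n) * indicator B x \<partial>lborel)"
    using n gam i B(2) by (intro nn_integral_cong) (auto simp: f_dens_neg indicator_def)
  also have "\<dots> = emeasure (density lborel (\<lambda>x. ennreal (1 / (- gam 1) * f_dens lam gam i t x n))) B"
    using B by (subst emeasure_density) auto
  finally show ?thesis using i by (simp add: alt_def split: if_splits)
qed

lemma ending_max_density:
  assumes n: "n > 0" and i: "i = alt n 0 1" and B [measurable]: "B \<in> sets borel" "B \<subseteq> {0<..}"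
  shows "ending n (lam i) (lam (1 - i)) (- gam i) (- gam (1 - i)) t (\<lambda>x. indicator B (- x)) =
    emeasure (density lborel (\<lambda>x. ennreal (1 / gam 0 * f_dens lam gam i t x n))) B"
proof -
  let ?c = "rates n (lam 1) (lam 0)" and ?d = "dens n (lam 0) (lam 1) (gam 0) (- gam 1) t"
  have c: "?c \<ge> 0" using lam1 lam0 by (rule rates_nonneg)
  have "ending n (alt n (lam 0) (lam 1)) (alt n (lam 1) (lam 0)) (alt n (- gam 0) (- gam 1)) (alt n (- gam 1) (- gam 0)) t (\<lambda>x. indicator B (- x)) =
      ennreal ?c * (\<integral>\<^sup>+x. ennreal (?d x) * indicator B (- (- x)) \<partial>lborel)"
    using lam0 lam1 gam t n by (intro ending_density) auto
  also have "\<dots> = (\<integral>\<^sup>+x. ennreal (?c * ?d x) * indicator B x \<partial>lborel)"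
    using c by (subst nn_integral_cmult[symmetric]) (auto simp: ennreal_mult' mult.assoc)
  also have "\<dots> = (\<integral>\<^sup>+x. ennreal (1 / gam 0 * f_dens lam gam i t x n) * indicator B x \<partial>lborel)"
    using n gam i B(2) by (intro nn_integral_cong) (auto simp: f_dens_pos indicator_def)
  also have "\<dots> = emeasure (density lborel (\<lambda>x. ennreal (1 / gam 0 * f_dens lam gam i t x n))) B"
    using B by (subst emeasure_density) auto
  finally show ?thesis using i by (simp add: alt_def split: if_splits)
qed

lemma ending_min_impossible:
  assumes i: "i = alt n 0 1" and B [measurable]: "B \<in> sets borel"
  shows "ending n (lam i) (lam (1 - i)) (gam i) (gam (1 - i)) t (indicator B) = 0"
  using ending_impossible[of "lam 0" "lam 1" "gam 0" "- gam 1" "indicator B" t n] lam0 lam1 gam t i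
  by (simp add: alt_def split: if_splits)

lemma ending_max_impossible:
  assumes i: "i = alt n 1 0" and B [measurable]: "B \<in> sets borel"
  shows "ending n (lam i) (lam (1 - i)) (- gam i) (- gam (1 - i)) t (\<lambda>x. indicator B (- x)) = 0"
  using ending_impossible[of "lam 1" "lam 0" "- gam 1" "gam 0" "\<lambda>x. indicator B (- x)" t n] lam0 lam1 gam t i
  by (simp add: alt_def split: if_splits)

lemma min_inside:
  assumes "emeasure M (starts_at M eps i) > 0" "i \<in> {0, 1}"
    and B: "B \<in> sets borel" "B \<subseteq> {(s, y, x). 0 < s \<and> s < t \<and> y < min 0 x}"
  shows "emeasure (cond_start M eps i) {\<omega> \<in> space M. (time_min (telegraph gam eps) t \<omega>,
      run_min (telegraph gam eps) t \<omega>, telegraph gam eps t \<omega>) \<in> B \<and> num_switch eps t \<omega> = n} =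
    W n (lam i) (lam (1 - i)) (gam i) (gam (1 - i)) t (\<lambda>(s, y, x). indicator B (s, 1 * y, 1 * x))"
  using min_law[of t i gam B n] assms gam t by (simp add: split_beta')

lemma max_inside:
  assumes "emeasure M (starts_at M eps i) > 0" "i \<in> {0, 1}"
    and B: "B \<in> sets borel" "B \<subseteq> {(s, y, x). 0 < s \<and> s < t \<and> y > max 0 x}"
  shows "emeasure (cond_start M eps i) {\<omega> \<in> space M. (time_max (telegraph gam eps) t \<omega>,
      run_max (telegraph gam eps) t \<omega>, telegraph gam eps t \<omega>) \<in> B \<and> num_switch eps t \<omega> = n} =
    W n (lam i) (lam (1 - i)) (- gam i) (- gam (1 - i)) t (\<lambda>(s, y, x). indicator B (s, - 1 * y, - 1 * x))"
  using max_law[of t i gam B n] assms gam t by (simp add: split_beta')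

lemma zero_state: "(0::nat) \<in> {0, 1}" and one_state: "(1::nat) \<in> {0, 1}"
  by auto

lemma parameters_pos: "lam 0 > 0" "lam 1 > 0" "gam 0 > 0" "gam 1 < 0" "t > 0"
  using lam0 lam1 gam t by auto

lemma even_ge_2: "n \<noteq> 0 \<Longrightarrow> even n \<Longrightarrow> n \<ge> 2" for n :: nat
  by presburger

lemma min_at_end_from_0:
  fixes n :: nat
  assumes start: "emeasure M (starts_at M eps 0) > 0" and B: "B \<in> sets borel" "B \<subseteq> {..<(0::real)}"
  shows "emeasure (cond_start M eps 0) {\<omega> \<in> space M. time_min (telegraph gam eps) t \<omega> = t \<and>
        run_min (telegraph gam eps) t \<omega> = telegraph gam eps t \<omega> \<and> telegraph gam eps t \<omega> \<in> B \<and> num_switch eps t \<omega> = n} =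
      (if even n then 0 else emeasure (density lborel (\<lambda>x. ennreal (1 / (- gam 1) * f_dens lam gam 0 t x n))) B)"
  unfolding min_at_end[OF start zero_state B, of n]
  using ending_min_density[ of n 0 B] ending_min_impossible[ of 0 n B] B
  by (cases "even n") (auto simp: alt_def elim: odd_cases)

lemma min_at_end_from_1:
  fixes n :: nat
  assumes start: "emeasure M (starts_at M eps 1) > 0" and B: "B \<in> sets borel" "B \<subseteq> {..<(0::real)}"
  shows "emeasure (cond_start M eps 1) {\<omega> \<in> space M. time_min (telegraph gam eps) t \<omega> = t \<and>
        run_min (telegraph gam eps) t \<omega> = telegraph gam eps t \<omega> \<and> telegraph gam eps t \<omega> \<in> B \<and> num_switch eps t \<omega> = n} =
      (if odd n then 0
       else if n \<ge> 2 then emeasure (density lborel (\<lambda>x. ennreal (1 / (- gam 1) * f_dens lam gam 1 t x n))) B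
       else emeasure (point_mass (exp (- lam 1 * t)) (gam 1 * t)) B)"
proof (cases "n = 0")
  case True
  have "emeasure (point_mass (exp (- lam 1 * t)) (gam 1 * t)) B = (\<integral>\<^sup>+x. indicator B x \<partial>point_mass (exp (- lam 1 * t)) (gam 1 * t))"
    using B by simp
  also have "\<dots> = ending 0 (lam 1) (lam 0) (gam 1) (gam 0) t (indicator B)"
    using B parameters_pos by (subst nn_integral_point_mass) (auto simp: ending_0)
  finally show ?thesis using min_at_end[OF start one_state B, of n] True by simp
next
  case False
  then show ?thesis
    unfolding min_at_end[OF start one_state B, of n]
    using ending_min_density[ of n 1 B] ending_min_impossible[ of 1 n B] B even_ge_2[of n]
    by (cases "even n") (auto simp: alt_def)
qed

lemma max_at_end_from_0:
  fixes n :: nat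
  assumes start: "emeasure M (starts_at M eps 0) > 0" and B: "B \<in> sets borel" "B \<subseteq> {(0::real)<..}"
  shows "emeasure (cond_start M eps 0) {\<omega> \<in> space M. time_max (telegraph gam eps) t \<omega> = t \<and>
        run_max (telegraph gam eps) t \<omega> = telegraph gam eps t \<omega> \<and> telegraph gam eps t \<omega> \<in> B \<and> num_switch eps t \<omega> = n} =
      (if odd n then 0
       else if n \<ge> 2 then emeasure (density lborel (\<lambda>x. ennreal (1 / gam 0 * f_dens lam gam 0 t x n))) B
       else emeasure (point_mass (exp (- lam 0 * t)) (gam 0 * t)) B)"
proof (cases "n = 0")
  case True
  have "emeasure (point_mass (exp (- lam 0 * t)) (gam 0 * t)) B = (\<integral>\<^sup>+x. indicator B x \<partial>point_mass (exp (- lam 0 * t)) (gam 0 * t))"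
    using B by simp
  also have "\<dots> = ending 0 (lam 0) (lam 1) (- gam 0) (- gam 1) t (\<lambda>x. indicator B (- x))"
    using B parameters_pos by (subst nn_integral_point_mass) (auto simp: ending_0)
  finally show ?thesis using max_at_end[OF start zero_state B, of n] True by simp
next
  case False
  then show ?thesis
    unfolding max_at_end[OF start zero_state B, of n]
    using ending_max_density[ of n 0 B] ending_max_impossible[ of 0 n B] B even_ge_2[of n]
    by (cases "even n") (auto simp: alt_def)
qed

lemma max_at_end_from_1:
  fixes n :: nat
  assumes start: "emeasure M (starts_at M eps 1) > 0" and B: "B \<in> sets borel" "B \<subseteq> {(0::real)<..}"
  shows "emeasure (cond_start M eps 1) {\<omega> \<in> space M. time_max (telegraph gam eps) t \<omega> = t \<and>
        run_max (telegraph gam eps) t \<omega> = telegraph gam eps t \<omega> \<and> telegraph gam eps t \<omega> \<in> B \<and> num_switch eps t \<omega> = n} =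
      (if even n then 0 else emeasure (density lborel (\<lambda>x. ennreal (1 / gam 0 * f_dens lam gam 1 t x n))) B)"
  unfolding max_at_end[OF start one_state B, of n]
  using ending_max_density[ of n 1 B] ending_max_impossible[ of 1 n B] B
  by (cases "even n") (auto simp: alt_def elim: odd_cases)

lemma min_inside_from_0:
  fixes n :: nat
  assumes start: "emeasure M (starts_at M eps 0) > 0" and n: "n \<ge> 2" and B: "B \<in> sets borel" "B \<subseteq> {(s, y, x). 0 < s \<and> s < t \<and> y < min 0 x}"
  shows "emeasure (cond_start M eps 0) {\<omega> \<in> space M. (time_min (telegraph gam eps) t \<omega>, run_min (telegraph gam eps) t \<omega>, telegraph gam eps t \<omega>) \<in> B \<and> num_switch eps t \<omega> = n} =
      ennreal (lam 1 / (- gam 1)) * (\<Sum>k=1..n div 2. split_meas t (\<lambda>y. F_meas lam gam 0 y (2 * k - 1)) (\<lambda>r. G_plus lam gam r (n - 2 * k)) B)"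
proof -
  have eq: "(\<Sum>k=1..n div 2. split_meas t (\<lambda>y. F_meas lam gam (alt (2 * k - 1) 1 0) y (2 * k - 1)) (\<lambda>r. G_plus lam gam r (n - 2 * k)) B) =
      (\<Sum>k=1..n div 2. split_meas t (\<lambda>y. F_meas lam gam 0 y (2 * k - 1)) (\<lambda>r. G_plus lam gam r (n - 2 * k)) B)"
    by (intro sum.cong refl) (auto simp: alt_def)
  show ?thesis
    unfolding min_inside[OF start zero_state B, of n] using split_data.W_up[OF split_data_min[OF parameters_pos B], of n] unfolding eq by simp
qed

lemma min_inside_from_1:
  fixes n :: nat
  assumes start: "emeasure M (starts_at M eps 1) > 0" and n: "n \<ge> 1" and B: "B \<in> sets borel" "B \<subseteq> {(s, y, x). 0 < s \<and> s < t \<and> y < min 0 x}"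
  shows "emeasure (cond_start M eps 1) {\<omega> \<in> space M. (time_min (telegraph gam eps) t \<omega>, run_min (telegraph gam eps) t \<omega>, telegraph gam eps t \<omega>) \<in> B \<and> num_switch eps t \<omega> = n} =
      ennreal (lam 1 / (- gam 1)) * (\<Sum>k=0..(n - 1) div 2. split_meas t (\<lambda>y. F_meas lam gam 1 y (2 * k)) (\<lambda>r. G_plus lam gam r (n - 2 * k - 1)) B)"
  unfolding min_inside[OF start one_state B, of n] using split_data.W_down[OF split_data_min[OF parameters_pos B] n] by (simp add: alt_def cong: sum.cong)

lemma max_inside_from_0:
  fixes n :: nat
  assumes start: "emeasure M (starts_at M eps 0) > 0" and n: "n \<ge> 1" and B: "B \<in> sets borel" "B \<subseteq> {(s, y, x). 0 < s \<and> s < t \<and> y > max 0 x}"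
  shows "emeasure (cond_start M eps 0) {\<omega> \<in> space M. (time_max (telegraph gam eps) t \<omega>, run_max (telegraph gam eps) t \<omega>, telegraph gam eps t \<omega>) \<in> B \<and> num_switch eps t \<omega> = n} =
      ennreal (lam 0 / gam 0) * (\<Sum>k=0..(n - 1) div 2. split_meas t (\<lambda>y. F_meas lam gam 0 y (2 * k)) (\<lambda>r. G_minus lam gam r (n - 2 * k - 1)) B)"
  unfolding max_inside[OF start zero_state B, of n] using split_data.W_down[OF split_data_max[OF parameters_pos B] n] by (simp add: alt_def cong: sum.cong)

lemma max_inside_from_1:
  fixes n :: nat
  assumes start: "emeasure M (starts_at M eps 1) > 0" and n: "n \<ge> 2" and B: "B \<in> sets borel" "B \<subseteq> {(s, y, x). 0 < s \<and> s < t \<and> y > max 0 x}"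
  shows "emeasure (cond_start M eps 1) {\<omega> \<in> space M. (time_max (telegraph gam eps) t \<omega>, run_max (telegraph gam eps) t \<omega>, telegraph gam eps t \<omega>) \<in> B \<and> num_switch eps t \<omega> = n} =
      ennreal (lam 0 / gam 0) * (\<Sum>k=1..n div 2. split_meas t (\<lambda>y. F_meas lam gam 1 y (2 * k - 1)) (\<lambda>r. G_minus lam gam r (n - 2 * k)) B)"
proof -
  have eq: "(\<Sum>k=1..n div 2. split_meas t (\<lambda>y. F_meas lam gam (alt (2 * k - 1) 0 1) y (2 * k - 1)) (\<lambda>r. G_minus lam gam r (n - 2 * k)) B) =
      (\<Sum>k=1..n div 2. split_meas t (\<lambda>y. F_meas lam gam 1 y (2 * k - 1)) (\<lambda>r. G_minus lam gam r (n - 2 * k)) B)"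
    by (intro sum.cong refl) (auto simp: alt_def)
  show ?thesis
    unfolding max_inside[OF start one_state B, of n] using split_data.W_up[OF split_data_max[OF parameters_pos B], of n] unfolding eq by simp
qed

end

end

theorem mainTheorem3:
  fixes M :: "'w measure" and eps :: "real \<Rightarrow> 'w \<Rightarrow> nat"
    and lam gam :: "nat \<Rightarrow> real" and t :: real
  assumes "two_state_markov M eps lam"
    and "lam 0 > 0" and "lam 1 > 0"
    and "gam 0 > 0" and "gam 1 < 0"
    and "t > 0"
  shows
   "(emeasure M (starts_at M eps 0) > 0 \<longrightarrow>
      (\<forall>n B. B \<in> sets borel \<and> B \<subseteq> {0<..} \<longrightarrow>
          emeasure (cond_start M eps 0)
            {\<omega> \<in> space M. time_min (telegraph gam eps) t \<omega> = 0 \<and>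
              run_min (telegraph gam eps) t \<omega> = 0 \<and>
              telegraph gam eps t \<omega> \<in> B \<and>
              num_switch eps t \<omega> = n}
          = emeasure (G_plus lam gam t n) B)) \<and>
    (emeasure M (starts_at M eps 1) > 0 \<longrightarrow>
      (\<forall>n B. B \<in> sets borel \<and> B \<subseteq> {..<0} \<longrightarrow>
          emeasure (cond_start M eps 1)
            {\<omega> \<in> space M. time_max (telegraph gam eps) t \<omega> = 0 \<and>
              run_max (telegraph gam eps) t \<omega> = 0 \<and>
              telegraph gam eps t \<omega> \<in> B \<and>
              num_switch eps t \<omega> = n}
          = emeasure (G_minus lam gam t n) B)) \<and>
    (emeasure M (starts_at M eps 0) > 0 \<longrightarrow>
      (\<forall>n B. B \<in> sets borel \<and> B \<subseteq> {..<0} \<longrightarrow>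
          emeasure (cond_start M eps 0)
            {\<omega> \<in> space M. time_min (telegraph gam eps) t \<omega> = t \<and>
              run_min (telegraph gam eps) t \<omega> = telegraph gam eps t \<omega> \<and>
              telegraph gam eps t \<omega> \<in> B \<and>
              num_switch eps t \<omega> = n}
          = (if even n then 0
             else emeasure (density lborel
                 (\<lambda>x. ennreal (1 / (- gam 1) * f_dens lam gam 0 t x n))) B))) \<and>
    (emeasure M (starts_at M eps 1) > 0 \<longrightarrow>
      (\<forall>n B. B \<in> sets borel \<and> B \<subseteq> {..<0} \<longrightarrow>
          emeasure (cond_start M eps 1)
            {\<omega> \<in> space M. time_min (telegraph gam eps) t \<omega> = t \<and>
              run_min (telegraph gam eps) t \<omega> = telegraph gam eps t \<omega> \<and>
              telegraph gam eps t \<omega> \<in> B \<and>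
              num_switch eps t \<omega> = n}
          = (if odd n then 0
             else if n \<ge> 2 then emeasure (density lborel
                 (\<lambda>x. ennreal (1 / (- gam 1) * f_dens lam gam 1 t x n))) B
             else emeasure (point_mass (exp (- lam 1 * t)) (gam 1 * t)) B))) \<and>
    (emeasure M (starts_at M eps 0) > 0 \<longrightarrow>
      (\<forall>n B. B \<in> sets borel \<and> B \<subseteq> {0<..} \<longrightarrow>
          emeasure (cond_start M eps 0)
            {\<omega> \<in> space M. time_max (telegraph gam eps) t \<omega> = t \<and>
              run_max (telegraph gam eps) t \<omega> = telegraph gam eps t \<omega> \<and>
              telegraph gam eps t \<omega> \<in> B \<and>
              num_switch eps t \<omega> = n}
          = (if odd n then 0
             else if n \<ge> 2 then emeasure (density lborel
                 (\<lambda>x. ennreal (1 / gam 0 * f_dens lam gam 0 t x n))) B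
             else emeasure (point_mass (exp (- lam 0 * t)) (gam 0 * t)) B))) \<and>
    (emeasure M (starts_at M eps 1) > 0 \<longrightarrow>
      (\<forall>n B. B \<in> sets borel \<and> B \<subseteq> {0<..} \<longrightarrow>
          emeasure (cond_start M eps 1)
            {\<omega> \<in> space M. time_max (telegraph gam eps) t \<omega> = t \<and>
              run_max (telegraph gam eps) t \<omega> = telegraph gam eps t \<omega> \<and>
              telegraph gam eps t \<omega> \<in> B \<and>
              num_switch eps t \<omega> = n}
          = (if even n then 0
             else emeasure (density lborel
                 (\<lambda>x. ennreal (1 / gam 0 * f_dens lam gam 1 t x n))) B))) \<and>
    (emeasure M (starts_at M eps 0) > 0 \<longrightarrow>
      (\<forall>n B. n \<ge> 2 \<and> B \<in> sets borel \<and> B \<subseteq> {(s, y, x). 0 < s \<and> s < t \<and> y < min 0 x} \<longrightarrow>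
          emeasure (cond_start M eps 0)
            {\<omega> \<in> space M. (time_min (telegraph gam eps) t \<omega>,
               run_min (telegraph gam eps) t \<omega>, telegraph gam eps t \<omega>) \<in> B \<and>
              num_switch eps t \<omega> = n}
          = ennreal (lam 1 / (- gam 1)) * (\<Sum>k=1..n div 2.
              split_meas t (\<lambda>y. F_meas lam gam 0 y (2 * k - 1)) (\<lambda>r. G_plus lam gam r (n - 2 * k)) B))) \<and>
    (emeasure M (starts_at M eps 1) > 0 \<longrightarrow>
      (\<forall>n B. n \<ge> 1 \<and> B \<in> sets borel \<and> B \<subseteq> {(s, y, x). 0 < s \<and> s < t \<and> y < min 0 x} \<longrightarrow>
          emeasure (cond_start M eps 1)
            {\<omega> \<in> space M. (time_min (telegraph gam eps) t \<omega>,
               run_min (telegraph gam eps) t \<omega>, telegraph gam eps t \<omega>) \<in> B \<and>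
              num_switch eps t \<omega> = n}
          = ennreal (lam 1 / (- gam 1)) * (\<Sum>k=0..(n - 1) div 2.
              split_meas t (\<lambda>y. F_meas lam gam 1 y (2 * k)) (\<lambda>r. G_plus lam gam r (n - 2 * k - 1)) B))) \<and>
    (emeasure M (starts_at M eps 0) > 0 \<longrightarrow>
      (\<forall>n B. n \<ge> 1 \<and> B \<in> sets borel \<and> B \<subseteq> {(s, y, x). 0 < s \<and> s < t \<and> y > max 0 x} \<longrightarrow>
          emeasure (cond_start M eps 0)
            {\<omega> \<in> space M. (time_max (telegraph gam eps) t \<omega>,
               run_max (telegraph gam eps) t \<omega>, telegraph gam eps t \<omega>) \<in> B \<and>
              num_switch eps t \<omega> = n}
          = ennreal (lam 0 / gam 0) * (\<Sum>k=0..(n - 1) div 2.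
              split_meas t (\<lambda>y. F_meas lam gam 0 y (2 * k)) (\<lambda>r. G_minus lam gam r (n - 2 * k - 1)) B))) \<and>
    (emeasure M (starts_at M eps 1) > 0 \<longrightarrow>
      (\<forall>n B. n \<ge> 2 \<and> B \<in> sets borel \<and> B \<subseteq> {(s, y, x). 0 < s \<and> s < t \<and> y > max 0 x} \<longrightarrow>
          emeasure (cond_start M eps 1)
            {\<omega> \<in> space M. (time_max (telegraph gam eps) t \<omega>,
               run_max (telegraph gam eps) t \<omega>, telegraph gam eps t \<omega>) \<in> B \<and>
              num_switch eps t \<omega> = n}
          = ennreal (lam 0 / gam 0) * (\<Sum>k=1..n div 2.
              split_meas t (\<lambda>y. F_meas lam gam 1 y (2 * k - 1)) (\<lambda>r. G_minus lam gam r (n - 2 * k)) B)))"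
proof -
  have S: "switching M eps lam"
    using assms(1-3) by (simp add: switching_def switching_axioms_def)
  note facts = switching.min_at_start[OF S assms(4-6)] switching.max_at_start[OF S assms(4-6)] switching.min_at_end_from_0[OF S assms(4-6)] switching.min_at_end_from_1[OF S assms(4-6)] switching.max_at_end_from_0[OF S assms(4-6)] switching.max_at_end_from_1[OF S assms(4-6)] switching.min_inside_from_0[OF S assms(4-6)] switching.min_inside_from_1[OF S assms(4-6)] switching.max_inside_from_0[OF S assms(4-6)] switching.max_inside_from_1[OF S assms(4-6)]
  show ?thesis
    by (intro conjI impI allI; elim conjE; rule facts; assumption)
qed

end
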